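(* Let $(W,S)$ be a Coxeter system with $|S|=n<\infty$, and let $\Xi=\Xi(W,S)$ be its two-sided Coxeter complex. Then: (1) $\Xi$ is a balanced boolean complex of dimension $2n-1$. (2) The facets (maximal faces) of $\Xi$ are in bijection with the elements of $W$ (the facet corresponding to $w$ being $F_w=(\emptyset,w,\emptyset)$), and the Coxeter complex $\Sigma=\Sigma(W,S)$ is a relative subcomplex of $\Xi$, i.e. $\Sigma$ is isomorphic as a poset to the order filter $\{F\in\Xi : (\emptyset,e,S)\leq_{\Xi}F\}$ of $\Xi$. (3) $\Xi$ is shellable, and any linear extension $w_1,w_2,\ldots$ of the two-sided weak order on $W$ gives a shelling order $F_{w_1},F_{w_2},\ldots$ for $\Xi$. (4) If $W$ is infinite, then $\Xi$ (i.e. its geometric realization) is contractible. (5) If $W$ is finite, then (a) the geometric realization of $\Xi$ is (homeomorphic to) a sphere, and (b) the refined $h$-polynomial of $\Xi$ is the two-sided $W$-Eulerian polynomial: \[ h(\Xi;s,t)=\sum_{w\in W}s^{\mathrm{des}_L(w)}t^{\mathrm{des}_R(w)}. \]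
   Context: Let $(W,S)$ be a Coxeter system with $S$ finite, $|S|=n$, identity $e$ and length function $\ell$. For $J\subseteq S$, $W_J$ is the subgroup generated by $J$. Descents and ascents: $\mathrm{Des}_L(w)=\{s\in S:\ell(sw)<\ell(w)\}$, $\mathrm{Des}_R(w)=\{s\in S:\ell(ws)<\ell(w)\}$, $\mathrm{Asc}_L(w)=S-\mathrm{Des}_L(w)$, $\mathrm{Asc}_R(w)=S-\mathrm{Des}_R(w)$, $\mathrm{des}_L(w)=|\mathrm{Des}_L(w)|$, $\mathrm{des}_R(w)=|\mathrm{Des}_R(w)|$. For $I,J\subseteq S$ let ${}^IW^J=\{w\in W: I\subseteq \mathrm{Asc}_L(w),\ J\subseteq\mathrm{Asc}_R(w)\}$, the set of minimal length representatives of the double cosets in $W_I\backslash W/W_J$. Two-sided Coxeter complex: $\Xi=\{(I,w,J): I,J\subseteq S,\ w\in{}^IW^J\}$, partially ordered by $(I,w,J)\leq_{\Xi}(I',w',J')$ if and only if $I\supseteq I'$, $J\supseteq J'$ and $W_IwW_J\supseteq W_{I'}w'W_{J'}$. Its elements are called faces; its minimum is $(S,e,S)$. The dimension of the face $(I,w,J)$ is $|S-I|+|S-J|-1$ (one less than its rank), and vertices are the faces of dimension $0$. Coxeter complex: $\Sigma=\{wW_J:w\in W,\ J\subseteq S\}$, ordered by reverse inclusion: $wW_J\leq_\Sigma w'W_{J'}$ if and only if $wW_J\supseteq w'W_{J'}$. Two-sided weak order on $W$: the partial order $\leq_{LR}$ that is the transitive closure of the cover relations "$v$ covers $u$ if and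 only if $\ell(v)=\ell(u)+1$ and $vu^{-1}\in S$ or $u^{-1}v\in S$". A linear extension means an enumeration $w_1,w_2,\ldots$ of all the elements of $W$ such that $w_i\leq_{LR}w_j$ implies $i\leq j$. A boolean complex (simplicial poset) is a poset with a unique minimum in which every interval from the minimum to an element is isomorphic to a finite boolean algebra; each element is thus viewed as an abstract simplex, and the complex has a geometric realization as a cell complex with simplices as closed cells. A boolean complex of dimension $d-1$ is balanced if its vertices can be colored with $d$ colors so that the vertices of each face have distinct colors. A shelling of a boolean complex whose facets all have the same dimension is an ordering $F_1,F_2,\ldots$ of its facets such that for every $k\geq2$ the intersection $\partial F_k\cap\bigcup_{i=1}^{k-1}\partial F_i$ is a pure complex of codimension one (each of its maximal faces has dimension $\dim F_k-1$), where $\partial F$ is the set of proper faces of $F$; the complex is shellable if it has a shelling. Refined $h$-polynomial (for $W$ finite): for $I,J\subseteq S$ let $f_{I,J}$ be the number of faces of $\Xi$ of the form $(S-I,w,S-J)$, let \[ h_{I,J}=\sum_{K\subseteq I,\ L\subseteq J}(-1)^{|I-K|+|J-L|}f_{K,L}, \] and set $h(\Xi;s,t)=\sum_{I,J\subseteq S}h_{I,J}\,s^{|I|}t^{|J|}$. *)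

theory Defs
  imports
    "HOL-Analysis.Analysis"
    "HOL-Algebra.Generated_Groups"
    "HOL-Computational_Algebra.Polynomial"
    "HOL-Library.Extended_Nat"
begin

section \<open>Coxeter systems\<close>

text \<open>The group \<open>W\<close> is a group in the sense of HOL-Algebra and \<open>S\<close> is a subset of its carrier.\<close>

definition coxeter_matrix :: "'a set \<Rightarrow> ('a \<Rightarrow> 'a \<Rightarrow> enat) \<Rightarrow> bool" where
  "coxeter_matrix S m \<longleftrightarrow>
     (\<forall>s\<in>S. m s s = 1) \<and>
     (\<forall>s\<in>S. \<forall>t\<in>S. m s t = m t s) \<and>
     (\<forall>s\<in>S. \<forall>t\<in>S. s \<noteq> t \<longrightarrow> m s t \<ge> 2)"

text \<open>
  The congruence on words over \<open>S\<close> generated by \<open>(st)^m(s,t) = 1\<close> for finite \<open>m(s,t)\<close>.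
  Since \<open>m(s,s) = 1\<close>, the relations \<open>s s = 1\<close> are included, so formal inverses are not needed: the
  quotient of the free monoid by this congruence is the group with the Coxeter presentation.
\<close>

inductive coxeter_cong :: "'a set \<Rightarrow> ('a \<Rightarrow> 'a \<Rightarrow> enat) \<Rightarrow> 'a list \<Rightarrow> 'a list \<Rightarrow> bool"
  for S m where
  refl: "coxeter_cong S m u u"
| sym: "coxeter_cong S m u v \<Longrightarrow> coxeter_cong S m v u"
| trans: "coxeter_cong S m u v \<Longrightarrow> coxeter_cong S m v w \<Longrightarrow> coxeter_cong S m u w"
| relator: "s \<in> S \<Longrightarrow> t \<in> S \<Longrightarrow> m s t = enat k \<Longrightarrow>
    coxeter_cong S m (u @ concat (replicate k [s, t]) @ v) (u @ v)"

definition word_prod :: "('a, 'b) monoid_scheme \<Rightarrow> 'a list \<Rightarrow> 'a" where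
  "word_prod W ws = foldr (\<lambda>x y. x \<otimes>\<^bsub>W\<^esub> y) ws \<one>\<^bsub>W\<^esub>"

definition coxeter_system :: "('a, 'b) monoid_scheme \<Rightarrow> 'a set \<Rightarrow> bool" where
  "coxeter_system W S \<longleftrightarrow>
     group W \<and> S \<subseteq> carrier W \<and> generate W S = carrier W \<and>
     (\<exists>m. coxeter_matrix S m \<and>
        (\<forall>u\<in>lists S. \<forall>v\<in>lists S. word_prod W u = word_prod W v \<longleftrightarrow> coxeter_cong S m u v))"

definition len :: "('a, 'b) monoid_scheme \<Rightarrow> 'a set \<Rightarrow> 'a \<Rightarrow> nat" where
  "len W S w = (LEAST k. \<exists>u\<in>lists S. length u = k \<and> word_prod W u = w)"

definition Des_L :: "('a, 'b) monoid_scheme \<Rightarrow> 'a set \<Rightarrow> 'a \<Rightarrow> 'a set" where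
  "Des_L W S w = {s\<in>S. len W S (s \<otimes>\<^bsub>W\<^esub> w) < len W S w}"

definition Des_R :: "('a, 'b) monoid_scheme \<Rightarrow> 'a set \<Rightarrow> 'a \<Rightarrow> 'a set" where
  "Des_R W S w = {s\<in>S. len W S (w \<otimes>\<^bsub>W\<^esub> s) < len W S w}"

definition Asc_L :: "('a, 'b) monoid_scheme \<Rightarrow> 'a set \<Rightarrow> 'a \<Rightarrow> 'a set" where
  "Asc_L W S w = S - Des_L W S w"

definition Asc_R :: "('a, 'b) monoid_scheme \<Rightarrow> 'a set \<Rightarrow> 'a \<Rightarrow> 'a set" where
  "Asc_R W S w = S - Des_R W S w"

definition des_L :: "('a, 'b) monoid_scheme \<Rightarrow> 'a set \<Rightarrow> 'a \<Rightarrow> nat" where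
  "des_L W S w = card (Des_L W S w)"

definition des_R :: "('a, 'b) monoid_scheme \<Rightarrow> 'a set \<Rightarrow> 'a \<Rightarrow> nat" where
  "des_R W S w = card (Des_R W S w)"

definition min_double_reps :: "('a, 'b) monoid_scheme \<Rightarrow> 'a set \<Rightarrow> 'a set \<Rightarrow> 'a set \<Rightarrow> 'a set" where
  "min_double_reps W S I J = {w \<in> carrier W. I \<subseteq> Asc_L W S w \<and> J \<subseteq> Asc_R W S w}"

definition double_coset :: "('a, 'b) monoid_scheme \<Rightarrow> 'a set \<Rightarrow> 'a \<Rightarrow> 'a set \<Rightarrow> 'a set" where
  "double_coset W I w J = generate W I <#>\<^bsub>W\<^esub> (w <#\<^bsub>W\<^esub> generate W J)"


section \<open>The two-sided Coxeter complex, the Coxeter complex, the two-sided weak order\<close>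

definition Xi :: "('a, 'b) monoid_scheme \<Rightarrow> 'a set \<Rightarrow> ('a set \<times> 'a \<times> 'a set) set" where
  "Xi W S = {(I, w, J). I \<subseteq> S \<and> J \<subseteq> S \<and> w \<in> min_double_reps W S I J}"

definition Xi_le :: "('a, 'b) monoid_scheme \<Rightarrow> 'a set \<times> 'a \<times> 'a set \<Rightarrow> 'a set \<times> 'a \<times> 'a set \<Rightarrow> bool" where
  "Xi_le W = (\<lambda>(I, w, J) (I', w', J').
     I' \<subseteq> I \<and> J' \<subseteq> J \<and> double_coset W I' w' J' \<subseteq> double_coset W I w J)"

definition Sigma_cox :: "('a, 'b) monoid_scheme \<Rightarrow> 'a set \<Rightarrow> 'a set set" where
  "Sigma_cox W S = {w <#\<^bsub>W\<^esub> generate W J | w J. w \<in> carrier W \<and> J \<subseteq> S}"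

definition Sigma_le :: "'a set \<Rightarrow> 'a set \<Rightarrow> bool" where
  "Sigma_le A B \<longleftrightarrow> B \<subseteq> A"

definition weak_LR_cover :: "('a, 'b) monoid_scheme \<Rightarrow> 'a set \<Rightarrow> 'a \<Rightarrow> 'a \<Rightarrow> bool" where
  "weak_LR_cover W S u v \<longleftrightarrow>
     u \<in> carrier W \<and> v \<in> carrier W \<and> len W S v = len W S u + 1 \<and>
     (v \<otimes>\<^bsub>W\<^esub> inv\<^bsub>W\<^esub> u \<in> S \<or> inv\<^bsub>W\<^esub> u \<otimes>\<^bsub>W\<^esub> v \<in> S)"

definition weak_LR :: "('a, 'b) monoid_scheme \<Rightarrow> 'a set \<Rightarrow> 'a \<Rightarrow> 'a \<Rightarrow> bool" where
  "weak_LR W S = (weak_LR_cover W S)\<^sup>*\<^sup>*"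

text \<open>
  Enumerations of a (finite or countably infinite) set \<open>A\<close> without repetition are bijections from
  the following index set to \<open>A\<close>; indices start at \<open>0\<close>.
\<close>

definition enum_index :: "'c set \<Rightarrow> nat set" where
  "enum_index A = (if finite A then {..<card A} else UNIV)"

definition linear_extension :: "('a, 'b) monoid_scheme \<Rightarrow> 'a set \<Rightarrow> (nat \<Rightarrow> 'a) \<Rightarrow> bool" where
  "linear_extension W S w \<longleftrightarrow>
     bij_betw w (enum_index (carrier W)) (carrier W) \<and>
     (\<forall>i\<in>enum_index (carrier W). \<forall>j\<in>enum_index (carrier W). weak_LR W S (w i) (w j) \<longrightarrow> i \<le> j)"


section \<open>Boolean complexes\<close>

text \<open>A poset is given by its set of elements \<open>P\<close> and a relation \<open>leq\<close>, relevant only on \<open>P\<close>.\<close>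

definition is_poset :: "'f set \<Rightarrow> ('f \<Rightarrow> 'f \<Rightarrow> bool) \<Rightarrow> bool" where
  "is_poset P leq \<longleftrightarrow> reflp_on P leq \<and> antisymp_on P leq \<and> transp_on P leq"

definition poset_iso :: "'f set \<Rightarrow> ('f \<Rightarrow> 'f \<Rightarrow> bool) \<Rightarrow> 'g set \<Rightarrow> ('g \<Rightarrow> 'g \<Rightarrow> bool) \<Rightarrow> ('f \<Rightarrow> 'g) \<Rightarrow> bool" where
  "poset_iso P leq Q leq' f \<longleftrightarrow> bij_betw f P Q \<and> (\<forall>x\<in>P. \<forall>y\<in>P. leq x y \<longleftrightarrow> leq' (f x) (f y))"

definition is_minimum :: "'f set \<Rightarrow> ('f \<Rightarrow> 'f \<Rightarrow> bool) \<Rightarrow> 'f \<Rightarrow> bool" where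
  "is_minimum P leq m \<longleftrightarrow> m \<in> P \<and> (\<forall>x\<in>P. leq m x)"

definition boolean_complex :: "'f set \<Rightarrow> ('f \<Rightarrow> 'f \<Rightarrow> bool) \<Rightarrow> bool" where
  "boolean_complex P leq \<longleftrightarrow>
     is_poset P leq \<and>
     (\<exists>!m. is_minimum P leq m) \<and>
     (\<forall>F\<in>P. \<exists>(k::nat) f. poset_iso {G\<in>P. leq G F} leq (Pow {..<k}) (\<subseteq>) f)"

definition vertices :: "'f set \<Rightarrow> ('f \<Rightarrow> 'f \<Rightarrow> bool) \<Rightarrow> 'f set" where
  "vertices P leq = {v\<in>P. \<not> is_minimum P leq v \<and> (\<forall>u\<in>P. leq u v \<longrightarrow> u = v \<or> is_minimum P leq u)}"

definition verts_of :: "'f set \<Rightarrow> ('f \<Rightarrow> 'f \<Rightarrow> bool) \<Rightarrow> 'f \<Rightarrow> 'f set" where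
  "verts_of P leq F = {v\<in>vertices P leq. leq v F}"

definition face_dim :: "'f set \<Rightarrow> ('f \<Rightarrow> 'f \<Rightarrow> bool) \<Rightarrow> 'f \<Rightarrow> int" where
  "face_dim P leq F = int (card (verts_of P leq F)) - 1"

definition has_complex_dim :: "'f set \<Rightarrow> ('f \<Rightarrow> 'f \<Rightarrow> bool) \<Rightarrow> int \<Rightarrow> bool" where
  "has_complex_dim P leq d \<longleftrightarrow> (\<forall>F\<in>P. face_dim P leq F \<le> d) \<and> (\<exists>F\<in>P. face_dim P leq F = d)"

definition balanced :: "'f set \<Rightarrow> ('f \<Rightarrow> 'f \<Rightarrow> bool) \<Rightarrow> bool" where
  "balanced P leq \<longleftrightarrow>
     (\<exists>(d::nat) c. has_complex_dim P leq (int d - 1) \<and>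
        c ` vertices P leq \<subseteq> {..<d} \<and> (\<forall>F\<in>P. inj_on c (verts_of P leq F)))"

definition maximal_elems :: "'f set \<Rightarrow> ('f \<Rightarrow> 'f \<Rightarrow> bool) \<Rightarrow> 'f set" where
  "maximal_elems A leq = {F\<in>A. \<forall>G\<in>A. leq F G \<longrightarrow> G = F}"

abbreviation facets :: "'f set \<Rightarrow> ('f \<Rightarrow> 'f \<Rightarrow> bool) \<Rightarrow> 'f set" where
  "facets P leq \<equiv> maximal_elems P leq"

text \<open>The set of proper faces of \<open>F\<close> contains the minimum of \<open>P\<close> (the empty face).\<close>

definition bd :: "'f set \<Rightarrow> ('f \<Rightarrow> 'f \<Rightarrow> bool) \<Rightarrow> 'f \<Rightarrow> 'f set" where
  "bd P leq F = {G\<in>P. leq G F \<and> G \<noteq> F}"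

definition shelling :: "'f set \<Rightarrow> ('f \<Rightarrow> 'f \<Rightarrow> bool) \<Rightarrow> (nat \<Rightarrow> 'f) \<Rightarrow> bool" where
  "shelling P leq F \<longleftrightarrow>
     (\<forall>G\<in>facets P leq. \<forall>H\<in>facets P leq. face_dim P leq G = face_dim P leq H) \<and>
     bij_betw F (enum_index (facets P leq)) (facets P leq) \<and>
     (\<forall>k\<in>enum_index (facets P leq). k \<ge> 1 \<longrightarrow>
        (\<forall>G\<in>maximal_elems (bd P leq (F k) \<inter> (\<Union>i<k. bd P leq (F i))) leq.
           face_dim P leq G = face_dim P leq (F k) - 1))"

definition shellable :: "'f set \<Rightarrow> ('f \<Rightarrow> 'f \<Rightarrow> bool) \<Rightarrow> bool" where
  "shellable P leq \<longleftrightarrow> (\<exists>F. shelling P leq F)"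


section \<open>Geometric realization of a boolean complex\<close>

definition closed_simplex :: "'f set \<Rightarrow> ('f \<Rightarrow> real) set" where
  "closed_simplex V = {x. (\<forall>v. 0 \<le> x v) \<and> (\<forall>v. v \<notin> V \<longrightarrow> x v = 0) \<and> sum x V = 1}"

definition simplex_topology :: "'f set \<Rightarrow> ('f \<Rightarrow> real) topology" where
  "simplex_topology V = subtopology (powertop_real UNIV) (closed_simplex V)"

definition supp :: "('f \<Rightarrow> real) \<Rightarrow> 'f set" where
  "supp x = {v. x v \<noteq> 0}"

text \<open>
  The realization is the union of the closed simplices spanned by the vertices of the faces, glued
  along common faces, with the weak (CW) topology. Since distinct faces may have the same vertices,
  a point is a pair of the unique face \<open>G\<close> whose open simplex contains the point, and its barycentric
  coordinates, which are positive exactly at the vertices of \<open>G\<close>. The minimum of \<open>P\<close>, which has no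
  vertices, contributes no points.
\<close>

definition realization_points :: "'f set \<Rightarrow> ('f \<Rightarrow> 'f \<Rightarrow> bool) \<Rightarrow> ('f \<times> ('f \<Rightarrow> real)) set" where
  "realization_points P leq =
     {(G, x). G \<in> P \<and> x \<in> closed_simplex (verts_of P leq G) \<and> supp x = verts_of P leq G}"

definition char_map :: "'f set \<Rightarrow> ('f \<Rightarrow> 'f \<Rightarrow> bool) \<Rightarrow> 'f \<Rightarrow> ('f \<Rightarrow> real) \<Rightarrow> 'f \<times> ('f \<Rightarrow> real)" where
  "char_map P leq F x = ((THE G. G \<in> P \<and> leq G F \<and> verts_of P leq G = supp x), x)"

definition realization :: "'f set \<Rightarrow> ('f \<Rightarrow> 'f \<Rightarrow> bool) \<Rightarrow> ('f \<times> ('f \<Rightarrow> real)) topology" where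
  "realization P leq = topology (\<lambda>U. U \<subseteq> realization_points P leq \<and>
     (\<forall>F\<in>P. openin (simplex_topology (verts_of P leq F))
        {x \<in> closed_simplex (verts_of P leq F). char_map P leq F x \<in> U}))"

lemma openin_realization:
  "openin (realization P leq) U \<longleftrightarrow> U \<subseteq> realization_points P leq \<and>
     (\<forall>F\<in>P. openin (simplex_topology (verts_of P leq F))
        {x \<in> closed_simplex (verts_of P leq F). char_map P leq F x \<in> U})"
proof -
  let ?pre = "\<lambda>F U. {x \<in> closed_simplex (verts_of P leq F). char_map P leq F x \<in> U}"
  have 1: "?pre F (A \<inter> B) = ?pre F A \<inter> ?pre F B" for F A B
    by auto
  have 2: "?pre F (\<Union>K) = (\<Union>A\<in>K. ?pre F A)" for F K
    by auto
  have "istopology (\<lambda>U. U \<subseteq> realization_points P leq \<and>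
     (\<forall>F\<in>P. openin (simplex_topology (verts_of P leq F)) (?pre F U)))"
    unfolding istopology_def 1 2 by blast
  then show ?thesis
    unfolding realization_def by (simp add: topology_inverse')
qed

text \<open>The face with a given vertex set below \<open>F\<close>, as used in the characteristic map, exists uniquely.\<close>

lemma boolean_complex_face_unique:
  assumes bc: "boolean_complex P leq" and F: "F \<in> P" and A: "A \<subseteq> verts_of P leq F"
  shows "\<exists>!G. G \<in> P \<and> leq G F \<and> verts_of P leq G = A"
proof -
  let ?I = "{G\<in>P. leq G F}"
  from bc have "reflp_on P leq" "transp_on P leq"
    by (auto simp: boolean_complex_def is_poset_def)
  then have tr: "leq x z" if "leq x y" "leq y z" "x \<in> P" "y \<in> P" "z \<in> P" for x y z
    using that by (meson transp_onD)
  from bc obtain b where b: "is_minimum P leq b" and b_unique: "\<And>m. is_minimum P leq m \<Longrightarrow> m = b"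
    unfolding boolean_complex_def by blast
  then have min_iff: "is_minimum P leq m \<longleftrightarrow> m = b" for m by blast
  from bc F obtain k :: nat and f where "poset_iso ?I leq (Pow {..<k}) (\<subseteq>) f"
    unfolding boolean_complex_def by blast
  then have bij: "bij_betw f ?I (Pow {..<k})"
    and ord: "\<And>x y. x \<in> ?I \<Longrightarrow> y \<in> ?I \<Longrightarrow> leq x y \<longleftrightarrow> f x \<subseteq> f y"
    by (auto simp: poset_iso_def)
  have fsub: "f x \<subseteq> {..<k}" if "x \<in> ?I" for x
    using bij_betwE[OF bij] that by auto
  have surj: "\<exists>x\<in>?I. f x = X" if "X \<subseteq> {..<k}" for X
  proof -
    have "X \<in> f ` ?I" using that bij_betw_imp_surj_on[OF bij] by simp
    then show ?thesis by auto
  qed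
  have inj: "x = y" if "x \<in> ?I" "y \<in> ?I" "f x = f y" for x y
    using inj_onD[OF bij_betw_imp_inj_on[OF bij] that(3) that(1,2)] .
  have bI: "b \<in> ?I" using b F by (auto simp: is_minimum_def)
  have fb: "f b = {}"
  proof -
    obtain z where z: "z \<in> ?I" "f z = {}" using surj[of "{}"] by auto
    then have "leq b z" using b by (auto simp: is_minimum_def)
    then show ?thesis using ord[OF bI z(1)] z(2) by auto
  qed
  have atom: "v \<in> vertices P leq \<longleftrightarrow> (\<exists>i. f v = {i})" if v: "v \<in> ?I" for v
  proof
    assume vv: "v \<in> vertices P leq"
    then have "f v \<noteq> {}" using inj[OF v bI] fb min_iff by (auto simp: vertices_def)
    then obtain i where i: "i \<in> f v" by auto
    then have "{i} \<subseteq> {..<k}" using fsub[OF v] by auto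
    then obtain u where u: "u \<in> ?I" "f u = {i}" using surj by blast
    then have "leq u v" using ord[OF u(1) v] i by auto
    then have "u = v \<or> u = b" using vv u(1) min_iff by (auto simp: vertices_def)
    then show "\<exists>i. f v = {i}" using u(2) fb by auto
  next
    assume "\<exists>i. f v = {i}"
    then obtain i where i: "f v = {i}" by auto
    have "u = v \<or> u = b" if "u \<in> P" "leq u v" for u
    proof -
      have uI: "u \<in> ?I" using that v F tr[of u v F] by simp
      then have "f u \<subseteq> {i}" using ord[OF uI v] that i by auto
      then have "f u = f b \<or> f u = f v" using i fb by auto
      then show ?thesis using inj[OF uI bI] inj[OF uI v] by blast
    qed
    then show "v \<in> vertices P leq" using v i fb min_iff by (auto simp: vertices_def)
  qed
  have vI: "verts_of P leq G = {v\<in>?I. (\<exists>i\<in>f G. f v = {i})}" if G: "G \<in> ?I" for G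
  proof -
    have "v \<in> verts_of P leq G \<longleftrightarrow> v \<in> ?I \<and> (\<exists>i\<in>f G. f v = {i})" for v
    proof -
      have "v \<in> ?I" if "v \<in> verts_of P leq G"
        using that G F tr[of v G F] by (simp add: verts_of_def vertices_def)
      moreover have "v \<in> verts_of P leq G \<longleftrightarrow> (\<exists>i\<in>f G. f v = {i})" if v: "v \<in> ?I"
        using atom[OF v] ord[OF v G] by (auto simp: verts_of_def)
      ultimately show ?thesis by blast
    qed
    then show ?thesis by blast
  qed
  have FI: "F \<in> ?I" using \<open>reflp_on P leq\<close> F by (auto dest: reflp_onD)
  define X where "X = {i. \<exists>v\<in>A. f v = {i}}"
  have AI: "A \<subseteq> {v\<in>?I. (\<exists>i\<in>f F. f v = {i})}" using A vI[OF FI] by simp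
  have "X \<subseteq> {..<k}"
  proof
    fix i assume "i \<in> X"
    then obtain v where "v \<in> A" "f v = {i}" by (auto simp: X_def)
    moreover from this have "v \<in> ?I" using AI by auto
    ultimately show "i \<in> {..<k}" using fsub[of v] by simp
  qed
  then obtain G where G: "G \<in> ?I" "f G = X" using surj by blast
  have vG: "verts_of P leq G = A"
  proof
    show "verts_of P leq G \<subseteq> A"
    proof
      fix v assume "v \<in> verts_of P leq G"
      then obtain i where v: "v \<in> ?I" "i \<in> X" "f v = {i}" using vI[OF G(1)] G(2) by auto
      then obtain u where "u \<in> A" "f u = {i}" by (auto simp: X_def)
      moreover from this have "u \<in> ?I" using AI by auto
      ultimately show "v \<in> A" using inj[OF v(1), of u] v(3) by auto
    qed
    show "A \<subseteq> verts_of P leq G"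
    proof
      fix v assume v: "v \<in> A"
      then obtain i where "v \<in> ?I" "f v = {i}" using AI by auto
      moreover from this v have "i \<in> f G" using G(2) by (auto simp: X_def)
      ultimately show "v \<in> verts_of P leq G" using vI[OF G(1)] by blast
    qed
  qed
  have "H = G" if H: "H \<in> ?I" "verts_of P leq H = A" for H
  proof -
    have "i \<in> f H \<longleftrightarrow> i \<in> f G" for i
    proof -
      have *: "i \<in> f K \<longleftrightarrow> i < k \<and> (\<exists>v\<in>verts_of P leq K. f v = {i})" if K: "K \<in> ?I" for K
      proof
        assume i: "i \<in> f K"
        then have "{i} \<subseteq> {..<k}" using fsub[OF K] by auto
        then obtain u where "u \<in> ?I" "f u = {i}" using surj by blast
        then show "i < k \<and> (\<exists>v\<in>verts_of P leq K. f v = {i})"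
          using vI[OF K] i \<open>{i} \<subseteq> {..<k}\<close> by auto
      next
        assume "i < k \<and> (\<exists>v\<in>verts_of P leq K. f v = {i})"
        then show "i \<in> f K" using vI[OF K] by auto
      qed
      show ?thesis using *[OF H(1)] *[OF G(1)] H(2) vG by simp
    qed
    then show ?thesis using inj[OF H(1) G(1)] by auto
  qed
  then show ?thesis using G(1) vG by blast
qed

lemma topspace_realization:
  assumes "boolean_complex P leq"
  shows "topspace (realization P leq) = realization_points P leq"
proof -
  have "char_map P leq F x \<in> realization_points P leq"
    if F: "F \<in> P" and x: "x \<in> closed_simplex (verts_of P leq F)" for F x
  proof -
    have sub: "supp x \<subseteq> verts_of P leq F" using x by (auto simp: closed_simplex_def supp_def)
    let ?G = "THE G. G \<in> P \<and> leq G F \<and> verts_of P leq G = supp x"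
    have G: "?G \<in> P \<and> leq ?G F \<and> verts_of P leq ?G = supp x"
      by (rule theI'[OF boolean_complex_face_unique[OF assms F sub]])
    have "finite (verts_of P leq F)"
      using x sum.infinite[of "verts_of P leq F" x] by (force simp: closed_simplex_def)
    then have "sum x (verts_of P leq F) = sum x (supp x)"
      using sub by (intro sum.mono_neutral_right) (auto simp: supp_def)
    then have "x \<in> closed_simplex (supp x)" using x by (auto simp: closed_simplex_def supp_def)
    then show ?thesis using G by (auto simp: char_map_def realization_points_def)
  qed
  then have "{x \<in> closed_simplex (verts_of P leq F). char_map P leq F x \<in> realization_points P leq}
      = topspace (simplex_topology (verts_of P leq F))" if "F \<in> P" for F
    using that by (auto simp: simplex_topology_def)
  then have "openin (realization P leq) (realization_points P leq)"
    unfolding openin_realization by simp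
  then show ?thesis
    by (metis openin_realization openin_subset openin_topspace subset_antisym)
qed

text \<open>
  The unit sphere in the Euclidean space of dimension \<open>d\<close>. For \<open>d > 0\<close> it is the library's sphere
  of dimension \<open>d - 1\<close>; for \<open>d = 0\<close> it is empty, i.e. the sphere of dimension \<open>-1\<close>.
\<close>

definition unit_sphere :: "nat \<Rightarrow> (nat \<Rightarrow> real) topology" where
  "unit_sphere d = subtopology (Euclidean_space d) {x. (\<Sum>i<d. x i ^ 2) = 1}"

lemma unit_sphere_Suc: "unit_sphere (Suc d) = nsphere d"
  by (simp add: unit_sphere_def nsphere_def lessThan_Suc_atMost)


section \<open>The refined h-polynomial\<close>

definition f_num :: "('a, 'b) monoid_scheme \<Rightarrow> 'a set \<Rightarrow> 'a set \<Rightarrow> 'a set \<Rightarrow> nat" where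
  "f_num W S I J = card {F \<in> Xi W S. \<exists>w. F = (S - I, w, S - J)}"

definition h_num :: "('a, 'b) monoid_scheme \<Rightarrow> 'a set \<Rightarrow> 'a set \<Rightarrow> 'a set \<Rightarrow> int" where
  "h_num W S I J =
     (\<Sum>K\<in>Pow I. \<Sum>L\<in>Pow J. (- 1) ^ (card (I - K) + card (J - L)) * int (f_num W S K L))"

text \<open>
  Polynomials in \<open>s\<close> and \<open>t\<close> with integer coefficients are polynomials in \<open>s\<close> whose coefficients are
  polynomials in \<open>t\<close>.
\<close>

definition monom_st :: "int \<Rightarrow> nat \<Rightarrow> nat \<Rightarrow> int poly poly" where
  "monom_st c i j = monom (monom c j) i"

definition h_poly :: "('a, 'b) monoid_scheme \<Rightarrow> 'a set \<Rightarrow> int poly poly" where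
  "h_poly W S = (\<Sum>I\<in>Pow S. \<Sum>J\<in>Pow S. monom_st (h_num W S I J) (card I) (card J))"

end

theory Submission
  imports Defs "HOL-Library.Sublist"
begin

text \<open>
  Two facts about a Coxeter group carry the whole proof.

  \<^item> A double coset \<open>W\<^sub>I w W\<^sub>J\<close> contains exactly one element without descents in \<open>I\<close> and \<open>J\<close>, and
    every other element of the double coset is above it in the two-sided weak order
    (\<open>min_rep_exists\<close>, \<open>min_rep_weak_le\<close>).
  \<^item> If \<open>W\<close> is finite and \<open>I\<close> and \<open>J\<close> consist of left and right descents of \<open>w\<close>, then every element of
    \<open>W\<^sub>I w W\<^sub>J\<close> is below \<open>w\<close> (\<open>max_rep_weak_ge\<close>): multiplication by the longest element reverses the
    order and reduces this to the first fact.

  Both rest on the exchange condition. It follows from the presentation by a parity argument: for a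
  word \<open>s\<^sub>1 \<dots> s\<^sub>k\<close>, the number of indices \<open>i\<close> for which \<open>s\<^sub>1 \<dots> s\<^sub>i \<dots> s\<^sub>1\<close> is a given element is unchanged
  modulo 2 when a relator is inserted, so its parity depends on the product of the word alone.

  By the first fact a face is a pair of types with a double coset. Below a face only the types can
  vary, which gives Boolean intervals, and there are just two vertices for each generator. A face of
  \<open>F\<^sub>w\<close> lies in an earlier facet if and only if \<open>w\<close> is not the minimal element of its double coset. Then \<open>w\<close>
  has a descent in one of the types, and the wall belonging to this descent is a face of codimension
  one above the given face and shared with an earlier facet: this is the shelling.

  The realization is obtained from copies of one simplex \<open>\<Delta>\<close>, one for each \<open>w\<close>, by identifying equal
  points \<open>z\<close> of the copies for \<open>w\<close> and \<open>w'\<close> if \<open>w\<close> and \<open>w'\<close> lie in the same double coset for the types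
  formed by the vanishing coordinates of \<open>z\<close>. In the order of a linear extension, the copy for \<open>w\<close> is
  glued to the earlier ones along the facets of \<open>\<Delta>\<close> opposite to the vertices in a set \<open>D\<close>, the descents of
  \<open>w\<close>. Moving mass from the coordinates in \<open>D\<close> to those in the complement \<open>V - D\<close>, equally shared, sweeps out
  \<open>\<Delta>\<close> by segments that end in these facets.

  For finite \<open>W\<close> the union of the first copies is a ball as long as the last copy is missing. Indeed,
  placing the segments of the next simplex radially on top of a round ball yields a star-shaped body
  with continuous radius, hence a ball (\<open>attach_simplex\<close>). The radius is continuous because, by the second
  fact, a point of the contact region that lies in another boundary facet also lies in a facet of the
  new simplex opposite to a vertex in \<open>V - D\<close>, where the segments have length zero. The last simplex has \<open>D = V\<close> and
  caps the ball, so that a sphere arises (\<open>final_stage\<close>).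

  For infinite \<open>W\<close> the set \<open>D\<close> is never all of \<open>V\<close>. Every simplex after the first can be pushed along its segments
  into earlier ones, and these motions fit together to a flow that carries the whole space into the first
  simplex in a time that is bounded on every simplex (\<open>noncompact_gluing\<close>).

  Finally, the flag numbers \<open>f\<close> count elements by inclusions of their descent sets, and inclusion-exclusion
  turns inclusions into equalities.
\<close>

section \<open>Gluing continuous functions\<close>

text \<open>
  A continuous map from a compact space to a Hausdorff space is a quotient map onto its image. Functions
  on the boundary of a ball are given on the simplices that cover it, and their continuity is tested there.
\<close>

lemma continuous_on_image_compact:
  fixes g :: "'a::topological_space \<Rightarrow> 'b::t2_space" and f :: "'b \<Rightarrow> 'c::topological_space"
  assumes "compact K" "continuous_on K g" "continuous_on K (\<lambda>x. f (g x))"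
  shows "continuous_on (g ` K) f"
  unfolding continuous_on_closed_invariant
proof (intro allI impI)
  fix B :: "'c set" assume "closed B"
  then obtain A where A: "closed A" "A \<inter> K = (\<lambda>x. f (g x)) -` B \<inter> K"
    using assms(3) unfolding continuous_on_closed_invariant by metis
  have "compact (K \<inter> A)" using assms(1) A(1) by (rule compact_Int_closed)
  then have "compact (g ` (K \<inter> A))"
    using assms(2) by (meson compact_continuous_image continuous_on_subset inf_le1)
  then have "closed (g ` (K \<inter> A))" by (rule compact_imp_closed)
  moreover have "g ` (K \<inter> A) \<inter> g ` K = f -` B \<inter> g ` K"
    using A(2) by blast
  ultimately show "\<exists>A. closed A \<and> A \<inter> g ` K = f -` B \<inter> g ` K" by blast
qed

text \<open>
  Radial formulas are continuous away from the centre, where they involve a direction; at the centre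
  only a bound by the radius is available.
\<close>

lemma continuous_on_squeeze:
  fixes f q :: "'a::topological_space \<Rightarrow> real"
  assumes q: "continuous_on X q" and f: "continuous_on {x\<in>X. q x \<noteq> 0} f"
    and le: "\<And>x. x \<in> X \<Longrightarrow> \<bar>f x\<bar> \<le> \<bar>q x\<bar>"
  shows "continuous_on X f"
  unfolding continuous_on_def
proof
  fix x assume x: "x \<in> X"
  have qx: "(q \<longlongrightarrow> q x) (at x within X)" using q x by (simp add: continuous_on_def)
  show "(f \<longlongrightarrow> f x) (at x within X)"
  proof (cases "q x = 0")
    case True
    then have "f x = 0" using le[OF x] by simp
    moreover have "(f \<longlongrightarrow> 0) (at x within X)"
    proof (rule Lim_null_comparison)
      show "\<forall>\<^sub>F y in at x within X. norm (f y) \<le> \<bar>q y\<bar>"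
        using le by (auto simp: eventually_at_filter intro: always_eventually)
      show "((\<lambda>y. \<bar>q y\<bar>) \<longlongrightarrow> 0) (at x within X)"
        using tendsto_rabs[OF qx] True by simp
    qed
    ultimately show ?thesis by simp
  next
    case False
    have "open (- {0::real})" by (simp add: open_Compl)
    then obtain U where U: "open U" "U \<inter> X = q -` (- {0}) \<inter> X"
      using q unfolding continuous_on_open_invariant by metis
    have "at x within {x\<in>X. q x \<noteq> 0} = at x within X"
      by (rule at_within_nhd[where S=U]) (use U x False in auto)
    moreover have "(f \<longlongrightarrow> f x) (at x within {x\<in>X. q x \<noteq> 0})"
      using f x False by (simp add: continuous_on_def)
    ultimately show ?thesis by simp
  qed
qed

section \<open>Simplices in barycentric coordinates\<close>

lemma continuous_on_coordinate [continuous_intros]: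
  fixes X :: "('v \<Rightarrow> real) set"
  shows "continuous_on X (\<lambda>z. z v)"
  by (rule continuous_on_subset[OF continuous_on_product_coordinates]) simp

lemma closed_simplex_eq:
  assumes "finite V"
  shows "closed_simplex V = (\<Pi>\<^sub>E v\<in>UNIV. if v \<in> V then {0..1} else {0::real}) \<inter> {x. sum x V = 1}"
    (is "_ = ?B \<inter> _")
proof -
  have "x v \<le> 1" if "\<forall>v. 0 \<le> x v" "sum x V = 1" "v \<in> V" for x :: "'a \<Rightarrow> real" and v
    using that assms member_le_sum[of v V x] by simp
  moreover have "x \<in> ?B \<longleftrightarrow> (\<forall>v. 0 \<le> x v \<and> (v \<in> V \<longrightarrow> x v \<le> 1) \<and> (v \<notin> V \<longrightarrow> x v = 0))" for x
    by (simp add: PiE_iff) (metis atLeastAtMost_iff order.refl singletonD singletonI)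
  ultimately show ?thesis
    unfolding closed_simplex_def set_eq_iff Int_iff mem_Collect_eq by metis
qed

lemma compact_closed_simplex:
  assumes "finite V"
  shows "compact (closed_simplex V)"
proof -
  have "compactin (product_topology (\<lambda>_. euclidean) UNIV) (\<Pi>\<^sub>E v\<in>UNIV. if v \<in> V then {0..1} else {0::real})"
    by (rule compactin_PiE[THEN iffD2]) auto
  then have "compact (\<Pi>\<^sub>E v\<in>UNIV. if v \<in> V then {0..1} else {0::real})"
    by (simp add: euclidean_product_topology)
  moreover have "closed {x::'a \<Rightarrow> real. sum x V = 1}"
    by (intro closed_Collect_eq continuous_intros)
  ultimately show ?thesis unfolding closed_simplex_eq[OF assms] by (rule compact_Int_closed)
qed

definition facet_at :: "'v set \<Rightarrow> 'v \<Rightarrow> ('v \<Rightarrow> real) set" where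
  "facet_at V v = {z \<in> closed_simplex V. z v = 0}"

lemma compact_facet_at: "finite V \<Longrightarrow> compact (facet_at V v)"
proof -
  assume "finite V"
  have "closed {z::'a \<Rightarrow> real. z v = 0}" by (intro closed_Collect_eq continuous_intros)
  then show ?thesis
    using compact_Int_closed[OF compact_closed_simplex[OF \<open>finite V\<close>], of "{z. z v = 0}"]
    by (simp add: facet_at_def Int_def)
qed

text \<open>
  The time until the first coordinate in \<open>A\<close> vanishes if mass is drained from \<open>A\<close> at unit speed and in
  equal shares.
\<close>

definition scaled_min :: "'v set \<Rightarrow> ('v \<Rightarrow> real) \<Rightarrow> real" where
  "scaled_min A z = real (card A) * Min (z ` A)"

lemma continuous_on_scaled_min [continuous_intros]:
  assumes "finite A" "A \<noteq> {}"
  shows "continuous_on X (scaled_min A)"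
proof -
  have "continuous_on X (\<lambda>z. Min (z ` A))"
    using assms
  proof (induction A rule: finite_ne_induct)
    case (insert a A)
    then have "(\<lambda>z::'a\<Rightarrow>real. Min (z ` insert a A)) = (\<lambda>z. min (z a) (Min (z ` A)))" by auto
    then show ?case using insert by (auto intro!: continuous_intros)
  qed (auto intro!: continuous_intros)
  then show ?thesis unfolding scaled_min_def by (intro continuous_intros)
qed

lemma scaled_min_shift:
  fixes c :: real
  assumes "finite A" "A \<noteq> {}" "\<And>v. v \<in> A \<Longrightarrow> y v = z v + c"
  shows "scaled_min A y = scaled_min A z + card A * c"
proof -
  have "y ` A = (\<lambda>v. z v + c) ` A" using assms(3) by auto
  then have "Min (y ` A) = Min (z ` A) + c" using Min_add_commute[OF assms(1,2), of z c] by simp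
  then show ?thesis by (simp add: scaled_min_def algebra_simps)
qed

lemma scaled_min_le_sum:
  assumes "finite A" "A \<noteq> {}"
  shows "scaled_min A z \<le> sum z A"
  unfolding scaled_min_def using assms by (intro sum_bounded_below) auto

lemma scaled_min_bounds:
  assumes "finite V" "A \<subseteq> V" "A \<noteq> {}" "z \<in> closed_simplex V"
  shows "0 \<le> scaled_min A z" "scaled_min A z \<le> 1"
proof -
  have fin: "finite A" using assms finite_subset by blast
  have "0 \<le> Min (z ` A)" using assms fin by (auto simp: closed_simplex_def)
  then show "0 \<le> scaled_min A z" by (simp add: scaled_min_def)
  have "scaled_min A z \<le> sum z A" using fin assms by (intro scaled_min_le_sum) auto
  also have "\<dots> \<le> sum z V" using assms by (intro sum_mono2) (auto simp: closed_simplex_def)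
  finally show "scaled_min A z \<le> 1" using assms by (auto simp: closed_simplex_def)
qed

lemma scaled_min_eq_0_iff:
  assumes "finite V" "A \<subseteq> V" "A \<noteq> {}" "z \<in> closed_simplex V"
  shows "scaled_min A z = 0 \<longleftrightarrow> (\<exists>v\<in>A. z v = 0)"
proof -
  have fin: "finite A" using assms finite_subset by blast
  have nn: "\<And>v. 0 \<le> z v" using assms by (auto simp: closed_simplex_def)
  have "scaled_min A z = 0 \<longleftrightarrow> Min (z ` A) = 0" using fin assms by (simp add: scaled_min_def)
  also have "\<dots> \<longleftrightarrow> 0 \<in> z ` A"
    using fin assms nn by (subst Min_eq_iff) auto
  finally show ?thesis by auto
qed

text \<open>
  Mass flows at unit speed out of the coordinates in \<open>D\<close> and into those in \<open>V - D\<close>, shared equally in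
  both sets.
\<close>

definition push :: "'v set \<Rightarrow> 'v set \<Rightarrow> real \<Rightarrow> ('v \<Rightarrow> real) \<Rightarrow> 'v \<Rightarrow> real" where
  "push V D t z = (\<lambda>v. z v + t * (if v \<in> D then - 1 / card D else if v \<in> V then 1 / card (V - D) else 0))"

definition retract :: "'v set \<Rightarrow> 'v set \<Rightarrow> ('v \<Rightarrow> real) \<Rightarrow> 'v \<Rightarrow> real" where
  "retract V D z = push V D (scaled_min D z) z"

lemma push_0 [simp]: "push V D 0 z = z"
  by (simp add: push_def)

lemma push_push: "push V D s (push V D t z) = push V D (s + t) z"
  by (auto simp: push_def algebra_simps add_divide_distrib)

text \<open>
  The vertices of a simplex are divided into two nonempty sets. Every point then lies on one segment of
  the motion, which ends as soon as a coordinate in \<open>D\<close> vanishes and starts where a coordinate in \<open>V - D\<close>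
  does; the scaled minima over \<open>D\<close> and \<open>V - D\<close> are the times to the end and from the start. So the simplex is
  the region between its facets opposite to the vertices in \<open>D\<close> and a graph over them, whose height is the
  scaled minimum over \<open>V - D\<close>.
\<close>

locale split_simplex =
  fixes V D :: "'v set"
  assumes finite_V: "finite V" and D_sub: "D \<subset> V" and D_ne: "D \<noteq> {}"
begin

lemma finite_D: "finite D" and card_D: "0 < card D" and DcV: "D \<subseteq> V"
  and finite_co: "finite (V - D)" and co_ne: "V - D \<noteq> {}" and card_co: "0 < card (V - D)"
  using finite_V D_sub D_ne finite_subset by (auto simp: card_gt_0_iff)

lemma scaled_min_D_push: "scaled_min D (push V D t z) = scaled_min D z - t"
  using scaled_min_shift[OF finite_D D_ne, of "push V D t z" z "- t / card D"] card_D
  by (simp add: push_def)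

lemma scaled_min_co_push: "scaled_min (V - D) (push V D t z) = scaled_min (V - D) z + t"
  using scaled_min_shift[OF finite_co co_ne, of "push V D t z" z "t / card (V - D)"] card_co
  by (simp add: push_def)

lemma push_in_simplex:
  assumes z: "z \<in> closed_simplex V" and t: "t \<le> scaled_min D z" "- t \<le> scaled_min (V - D) z"
  shows "push V D t z \<in> closed_simplex V"
proof -
  have "0 \<le> push V D t z v" for v
  proof -
    consider "v \<in> D" | "v \<in> V - D" | "v \<notin> V" by blast
    then show ?thesis
    proof cases
      case 1
      then have "Min (z ` D) \<le> z v" using finite_D by auto
      moreover have "t / card D \<le> Min (z ` D)"
        using t(1) card_D by (simp add: scaled_min_def field_simps)
      ultimately show ?thesis using 1 by (simp add: push_def)
    next
      case 2
      then have "Min (z ` (V - D)) \<le> z v" using finite_co by auto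
      moreover have "- t / card (V - D) \<le> Min (z ` (V - D))"
        using t(2) card_co by (simp add: scaled_min_def field_simps)
      ultimately show ?thesis using 2 by (simp add: push_def)
    next
      case 3
      then show ?thesis using z DcV by (auto simp: push_def closed_simplex_def)
    qed
  qed
  moreover have "sum (push V D t z) V = 1"
  proof -
    have "sum (push V D t z) V = sum (push V D t z) D + sum (push V D t z) (V - D)"
      using finite_V DcV by (metis add.commute sum.subset_diff)
    also have "sum (push V D t z) D = (\<Sum>v\<in>D. z v - t / card D)"
      by (rule sum.cong) (auto simp: push_def)
    also have "\<dots> = sum z D - t"
      using card_D by (simp add: sum_subtractf)
    also have "sum (push V D t z) (V - D) = (\<Sum>v\<in>V - D. z v + t / card (V - D))"
      by (rule sum.cong) (auto simp: push_def)
    also have "\<dots> = sum z (V - D) + t"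
      using card_co by (simp add: sum.distrib)
    finally show ?thesis
      using z finite_V DcV sum.subset_diff[of D V z] by (auto simp: closed_simplex_def)
  qed
  ultimately show ?thesis using z DcV by (auto simp: closed_simplex_def push_def)
qed

lemma
  assumes "z \<in> closed_simplex V"
  shows retract_in_simplex: "retract V D z \<in> closed_simplex V"
    and retract_zero: "\<exists>d\<in>D. retract V D z d = 0"
    and scaled_min_co_retract: "scaled_min (V - D) (retract V D z) = scaled_min D z + scaled_min (V - D) z"
    and push_retract: "push V D (- scaled_min D z) (retract V D z) = z"
proof -
  note b = scaled_min_bounds[OF finite_V DcV D_ne assms] scaled_min_bounds[OF finite_V Diff_subset co_ne assms]
  show r: "retract V D z \<in> closed_simplex V"
    unfolding retract_def using b by (intro push_in_simplex assms) auto
  have "scaled_min D (retract V D z) = 0" by (simp add: retract_def scaled_min_D_push)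
  then show "\<exists>d\<in>D. retract V D z d = 0" using scaled_min_eq_0_iff[OF finite_V DcV D_ne r] by simp
  show "scaled_min (V - D) (retract V D z) = scaled_min D z + scaled_min (V - D) z"
    by (simp add: retract_def scaled_min_co_push)
  show "push V D (- scaled_min D z) (retract V D z) = z"
    by (simp add: retract_def push_push)
qed

lemma retract_eq_self: "z \<in> closed_simplex V \<Longrightarrow> d \<in> D \<Longrightarrow> z d = 0 \<Longrightarrow> retract V D z = z"
  using scaled_min_eq_0_iff[OF finite_V DcV D_ne, of z] by (auto simp: retract_def)

lemma continuous_on_push [continuous_intros]:
  assumes "continuous_on X f" "continuous_on X g"
  shows "continuous_on X (\<lambda>x. push V D (f x) (g x))"
  unfolding push_def
  by (intro continuous_intros assms continuous_on_product_then_coordinatewise[OF assms(2)])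

lemma continuous_on_retract: "continuous_on X (retract V D)"
  unfolding retract_def
  by (intro continuous_intros finite_D D_ne)

lemma retract_unpush:
  assumes b: "b \<in> closed_simplex V" "d \<in> D" "b d = 0" and t: "0 \<le> t" "t \<le> scaled_min (V - D) b"
  shows "push V D (- t) b \<in> closed_simplex V" "scaled_min D (push V D (- t) b) = t"
    "retract V D (push V D (- t) b) = b"
proof -
  have m0: "scaled_min D b = 0" using b scaled_min_eq_0_iff[OF finite_V DcV D_ne] by auto
  show "push V D (- t) b \<in> closed_simplex V" using b t m0 by (intro push_in_simplex) auto
  show s: "scaled_min D (push V D (- t) b) = t" using m0 by (simp add: scaled_min_D_push)
  show "retract V D (push V D (- t) b) = b"
    unfolding retract_def s by (simp add: push_push)
qed

end

section \<open>Round balls\<close>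

definition nrm :: "nat \<Rightarrow> (nat \<Rightarrow> real) \<Rightarrow> real" where
  "nrm N x = sqrt (\<Sum>i<N. (x i)\<^sup>2)"

definition round_ball :: "nat \<Rightarrow> (nat \<Rightarrow> real) set" where
  "round_ball N = {x. (\<forall>i\<ge>N. x i = 0) \<and> nrm N x \<le> 1}"

definition round_sphere :: "nat \<Rightarrow> (nat \<Rightarrow> real) set" where
  "round_sphere N = {x. (\<forall>i\<ge>N. x i = 0) \<and> nrm N x = 1}"

definition scale :: "real \<Rightarrow> (nat \<Rightarrow> real) \<Rightarrow> nat \<Rightarrow> real" where
  "scale c x = (\<lambda>i. c * x i)"

lemma nrm_nonneg [simp]: "0 \<le> nrm N x"
  by (simp add: nrm_def sum_nonneg)

lemma nrm_scale: "nrm N (scale c x) = \<bar>c\<bar> * nrm N x"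
  by (simp add: nrm_def scale_def power_mult_distrib real_sqrt_mult flip: sum_distrib_left)

lemma nrm_zero [simp]: "nrm N (\<lambda>_. 0) = 0"
  by (simp add: nrm_def)

lemma scale_scale [simp]: "scale a (scale b x) = scale (a * b) x"
  and scale_1 [simp]: "scale 1 x = x"
  and scale_0 [simp]: "scale 0 x = (\<lambda>_. 0)"
  and scale_zero [simp]: "scale c (\<lambda>_. 0) = (\<lambda>_. 0)"
  by (auto simp: scale_def)

lemma abs_le_nrm: "i < N \<Longrightarrow> \<bar>x i\<bar> \<le> nrm N x"
proof -
  assume "i < N"
  then have "(x i)\<^sup>2 \<le> (\<Sum>i<N. (x i)\<^sup>2)" by (intro member_le_sum) auto
  then show ?thesis unfolding nrm_def by (rule real_le_rsqrt[of "\<bar>x i\<bar>", simplified])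
qed

lemma nrm_eq_0_iff: "nrm N x = 0 \<longleftrightarrow> (\<forall>i<N. x i = 0)"
  by (auto simp: nrm_def sum_nonneg_eq_0_iff)

lemma nrm_0_imp_zero: "\<lbrakk>nrm N x = 0; \<forall>i\<ge>N. x i = 0\<rbrakk> \<Longrightarrow> x = (\<lambda>_. 0)"
  using nrm_eq_0_iff[of N x] not_le by (metis (mono_tags))

lemma continuous_on_nrm [continuous_intros]:
  assumes "continuous_on X f"
  shows "continuous_on X (\<lambda>x. nrm N (f x))"
  unfolding nrm_def
  by (intro continuous_intros continuous_on_product_then_coordinatewise[OF assms])

lemma continuous_on_scale [continuous_intros]:
  assumes "continuous_on X c" "continuous_on X f"
  shows "continuous_on X (\<lambda>x. scale (c x) (f x))"
  unfolding scale_def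
  by (intro continuous_intros assms continuous_on_product_then_coordinatewise[OF assms(2)])

lemma continuous_on_scale_squeeze:
  assumes "continuous_on X q" "continuous_on {x\<in>X. q x \<noteq> 0} f"
    and "\<And>x. x \<in> X \<Longrightarrow> nrm N (f x) \<le> \<bar>q x\<bar>" and "\<And>x i. x \<in> X \<Longrightarrow> N \<le> i \<Longrightarrow> f x i = 0"
  shows "continuous_on X f"
proof (rule continuous_on_coordinatewise_then_product)
  fix i
  show "continuous_on X (\<lambda>x. f x i)"
  proof (rule continuous_on_squeeze[OF assms(1)])
    show "continuous_on {x \<in> X. q x \<noteq> 0} (\<lambda>x. f x i)"
      using assms(2) by (rule continuous_on_product_then_coordinatewise)
    show "\<bar>f x i\<bar> \<le> \<bar>q x\<bar>" if "x \<in> X" for x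
      using assms(3,4)[OF that] abs_le_nrm[of i N "f x"] by (cases "i < N") force+
  qed
qed

lemma round_ball_polar:
  assumes "x \<in> round_ball N"
  obtains "x = (\<lambda>_. 0)"
  | r \<theta> where "0 < r" "r \<le> 1" "\<theta> \<in> round_sphere N" "x = scale r \<theta>"
proof (cases "nrm N x = 0")
  case True
  then show ?thesis using that(1) nrm_0_imp_zero assms by (auto simp: round_ball_def)
next
  case False
  then have pos: "0 < nrm N x" using nrm_nonneg[of N x] by linarith
  then have "scale (1 / nrm N x) x \<in> round_sphere N"
    using assms by (auto simp: round_sphere_def round_ball_def nrm_scale) (simp add: scale_def)
  then show ?thesis using that(2)[of "nrm N x" "scale (1 / nrm N x) x"] pos assms
    by (auto simp: round_ball_def)
qed

lemma scale_sphere_in_ball: "\<theta> \<in> round_sphere N \<Longrightarrow> \<bar>r\<bar> \<le> 1 \<Longrightarrow> scale r \<theta> \<in> round_ball N"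
  by (auto simp: round_sphere_def round_ball_def nrm_scale) (simp add: scale_def)

lemma nrm_scale_sphere: "\<theta> \<in> round_sphere N \<Longrightarrow> nrm N (scale r \<theta>) = \<bar>r\<bar>"
  by (simp add: round_sphere_def nrm_scale)

lemma scale_sphere_eq:
  assumes "\<theta> \<in> round_sphere N" "\<theta>' \<in> round_sphere N" "0 < r" "0 \<le> r'" "scale r \<theta> = scale r' \<theta>'"
  shows "r = r' \<and> \<theta> = \<theta>'"
proof -
  have "r = r'" using nrm_scale_sphere[OF assms(1), of r] nrm_scale_sphere[OF assms(2), of r'] assms(3-5) by simp
  moreover have "\<theta> i = \<theta>' i" for i using fun_cong[OF assms(5), of i] \<open>r = r'\<close> assms(3) by (simp add: scale_def)
  ultimately show ?thesis by auto
qed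

section \<open>Attaching a simplex to a ball\<close>

definition (in split_simplex) base :: "('v \<Rightarrow> real) set" where
  "base = (\<Union>d\<in>D. facet_at V d)"

text \<open>
  The facets opposite to the vertices in \<open>D\<close> are embedded by \<open>\<gamma>\<close> into the boundary sphere of a ball. The closed set \<open>C\<close>
  covers the rest of the sphere and meets the image only in points over which the segments of the simplex
  have length zero. This is what makes the height of the simplex over the sphere continuous.
\<close>

locale attach_simplex = split_simplex V D for V D :: "'v set" +
  fixes N :: nat and \<gamma> :: "('v \<Rightarrow> real) \<Rightarrow> nat \<Rightarrow> real" and C :: "(nat \<Rightarrow> real) set"
  assumes \<gamma>_cont: "continuous_on base \<gamma>" and \<gamma>_inj: "inj_on \<gamma> base"
    and closed_C: "closed C" and sphere_eq: "\<gamma> ` base \<union> C = round_sphere N"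
    and frontier: "\<And>b. b \<in> base \<Longrightarrow> \<gamma> b \<in> C \<Longrightarrow> \<exists>v\<in>V - D. b v = 0"
begin

text \<open>
  Stacking the segments radially on the ball gives the body whose radius in direction \<open>\<theta>\<close> is
  \<open>1 + height \<theta>\<close>. After dividing by this radius it is the round ball again; \<open>shrink\<close> is then the
  inclusion of the old ball and \<open>collar\<close> that of the simplex.
\<close>

definition "height x = (if x \<in> \<gamma> ` base then scaled_min (V - D) (the_inv_into base \<gamma> x) else 0)"

definition "shrink x = scale (1 / (1 + height (scale (1 / nrm N x) x))) x"

definition "collar z =
  scale ((1 + scaled_min D z) / (1 + scaled_min D z + scaled_min (V - D) z)) (\<gamma> (retract V D z))"

lemma base_iff: "b \<in> base \<longleftrightarrow> b \<in> closed_simplex V \<and> (\<exists>d\<in>D. b d = 0)"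
  by (auto simp: base_def facet_at_def)

lemma compact_base: "compact base"
  unfolding base_def by (intro compact_UN finite_D compact_facet_at finite_V)

lemma height_\<gamma>: "b \<in> base \<Longrightarrow> height (\<gamma> b) = scaled_min (V - D) b"
  by (simp add: height_def the_inv_into_f_f[OF \<gamma>_inj])

lemma height_C: "x \<in> C \<Longrightarrow> height x = 0"
proof (cases "x \<in> \<gamma> ` base")
  case True
  moreover assume "x \<in> C"
  ultimately obtain b where "b \<in> base" "x = \<gamma> b" "\<exists>v\<in>V - D. b v = 0" using frontier by blast
  then show ?thesis
    using height_\<gamma> scaled_min_eq_0_iff[OF finite_V Diff_subset co_ne, of b] by (auto simp: base_iff)
qed (simp add: height_def)

lemma height_bounds: "0 \<le> height x" "height x \<le> 1"
proof -
  have "0 \<le> height x \<and> height x \<le> 1"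
  proof (cases "x \<in> \<gamma> ` base")
    case True
    then obtain b where "b \<in> base" "x = \<gamma> b" by blast
    then show ?thesis
      using height_\<gamma> scaled_min_bounds[OF finite_V Diff_subset co_ne, of b] by (simp add: base_iff)
  qed (simp add: height_def)
  then show "0 \<le> height x" "height x \<le> 1" by auto
qed

lemma continuous_on_height: "continuous_on (round_sphere N) height"
  unfolding sphere_eq[symmetric]
proof (rule continuous_on_closed_Un)
  show "closed (\<gamma> ` base)"
    using compact_base \<gamma>_cont compact_continuous_image compact_imp_closed by blast
  have "continuous_on base (\<lambda>x. height (\<gamma> x))"
    by (rule continuous_on_eq[OF continuous_on_scaled_min[OF finite_co co_ne]]) (simp add: height_\<gamma>)
  then show "continuous_on (\<gamma> ` base) height"
    by (rule continuous_on_image_compact[OF compact_base \<gamma>_cont])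
  show "continuous_on C height"
    by (rule continuous_on_eq[OF continuous_on_const[of _ 0]]) (simp add: height_C)
qed (rule closed_C)

lemma shrink_polar: "\<theta> \<in> round_sphere N \<Longrightarrow> 0 < r \<Longrightarrow> shrink (scale r \<theta>) = scale (r / (1 + height \<theta>)) \<theta>"
  by (simp add: shrink_def nrm_scale_sphere)

lemma shrink_zero [simp]: "shrink (\<lambda>_. 0) = (\<lambda>_. 0)"
  by (simp add: shrink_def)

lemma continuous_on_shrink: "continuous_on (round_ball N) shrink"
proof (rule continuous_on_scale_squeeze[where q="nrm N" and N=N])
  show "continuous_on (round_ball N) (nrm N)" by (intro continuous_intros continuous_on_id)
  let ?X = "{x \<in> round_ball N. nrm N x \<noteq> 0}"
  have dir: "continuous_on ?X (\<lambda>x. scale (1 / nrm N x) x)"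
    by (intro continuous_intros) auto
  have "continuous_on ?X (\<lambda>x. height (scale (1 / nrm N x) x))"
  proof (rule continuous_on_compose2[OF continuous_on_height dir])
    show "(\<lambda>x. scale (1 / nrm N x) x) ` ?X \<subseteq> round_sphere N"
      by (auto simp: round_sphere_def round_ball_def nrm_scale) (simp add: scale_def)
  qed
  then show "continuous_on ?X shrink"
    unfolding shrink_def using height_bounds(1)
    by (intro continuous_intros) (smt (verit, best))+
  show "nrm N (shrink x) \<le> \<bar>nrm N x\<bar>" for x
    using height_bounds(1)[of "scale (1 / nrm N x) x"]
    by (simp add: shrink_def nrm_scale field_simps mult_left_le)
qed (auto simp: shrink_def round_ball_def scale_def)

lemma continuous_on_collar: "continuous_on (closed_simplex V) collar"
proof -
  have "continuous_on (closed_simplex V) (\<lambda>z. \<gamma> (retract V D z))"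
    by (rule continuous_on_compose2[OF \<gamma>_cont continuous_on_retract])
      (use retract_in_simplex retract_zero in \<open>auto simp: base_iff\<close>)
  moreover have "1 + scaled_min D z + scaled_min (V - D) z \<noteq> 0" if "z \<in> closed_simplex V" for z
    using scaled_min_bounds(1)[OF finite_V DcV D_ne that] scaled_min_bounds(1)[OF finite_V Diff_subset co_ne that]
    by simp
  ultimately show ?thesis
    unfolding collar_def
    by (intro continuous_on_scale continuous_on_divide continuous_on_add continuous_on_const
        continuous_on_scaled_min finite_D D_ne finite_co co_ne) auto
qed

lemma retract_in_base: "z \<in> closed_simplex V \<Longrightarrow> retract V D z \<in> base"
  using retract_in_simplex retract_zero by (auto simp: base_iff)

lemma \<gamma>_sphere: "b \<in> base \<Longrightarrow> \<gamma> b \<in> round_sphere N"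
  using sphere_eq by auto

text \<open>
  In direction \<open>\<theta>\<close> the old ball reaches only the radii up to \<open>1 / (1 + height \<theta>)\<close>. Recovering the
  preimage from such a radius settles both injectivity and the intersection with the simplex.
\<close>

lemma shrink_nz:
  assumes "x \<in> round_ball N" "shrink x = scale s \<theta>" "\<theta> \<in> round_sphere N" "0 < s"
  shows "s * (1 + height \<theta>) \<le> 1 \<and> x = scale (s * (1 + height \<theta>)) \<theta>"
  using assms(1)
proof (cases rule: round_ball_polar)
  case 1
  then have "scale s \<theta> = (\<lambda>_. 0)" using assms(2) by simp
  then have "nrm N (scale s \<theta>) = 0" by simp
  then show ?thesis using assms(3,4) by (simp add: nrm_scale_sphere)
next
  case (2 r \<theta>')
  have h: "0 < 1 + height \<theta>'" using height_bounds(1)[of \<theta>'] by simp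
  have "scale s \<theta> = scale (r / (1 + height \<theta>')) \<theta>'" using assms(2) 2 shrink_polar by simp
  then have "s = r / (1 + height \<theta>') \<and> \<theta> = \<theta>'"
    using 2 h assms by (intro scale_sphere_eq[of _ N]) auto
  then show ?thesis using 2 h by simp
qed

lemma inj_on_shrink: "inj_on shrink (round_ball N)"
proof (rule inj_onI)
  fix x y assume xy: "x \<in> round_ball N" "y \<in> round_ball N" "shrink x = shrink y"
  have *: "x = y" if "x \<in> round_ball N" "y \<in> round_ball N" "shrink x = shrink y" "y \<noteq> (\<lambda>_. 0)" for x y
    using that(2)
  proof (cases rule: round_ball_polar)
    case (2 r \<theta>)
    have h: "0 < 1 + height \<theta>" using height_bounds(1)[of \<theta>] by simp
    have "shrink x = scale (r / (1 + height \<theta>)) \<theta>"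
      unfolding that(3) 2(4) by (rule shrink_polar[OF 2(3,1)])
    from shrink_nz[OF that(1) this 2(3)] have "x = scale r \<theta>" using 2(1) h by simp
    then show ?thesis using 2(4) by metis
  qed (use that in simp)
  show "x = y" using *[of x y] *[of y x] xy by metis
qed

lemma collar_factor:
  assumes "z \<in> closed_simplex V"
  shows "0 \<le> scaled_min D z" "0 \<le> scaled_min (V - D) z"
    "height (\<gamma> (retract V D z)) = scaled_min D z + scaled_min (V - D) z"
    "\<gamma> (retract V D z) \<in> round_sphere N"
    "0 < (1 + scaled_min D z) / (1 + scaled_min D z + scaled_min (V - D) z)"
  using assms scaled_min_bounds(1)[OF finite_V DcV D_ne assms]
    scaled_min_bounds(1)[OF finite_V Diff_subset co_ne assms]
    height_\<gamma>[OF retract_in_base] scaled_min_co_retract \<gamma>_sphere[OF retract_in_base]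
  by auto

text \<open>
  The simplex starts at radius \<open>1\<close> before rescaling, where the ball ends; so they have in common only the
  points of the contact region, that is the points with \<open>scaled_min D z = 0\<close>.
\<close>

lemma shrink_eq_collar_iff:
  assumes x: "x \<in> round_ball N" and z: "z \<in> closed_simplex V"
  shows "shrink x = collar z \<longleftrightarrow> z \<in> base \<and> x = \<gamma> z"
proof
  note f = collar_factor[OF z]
  assume "shrink x = collar z"
  have e: "(1 + scaled_min D z) / (1 + scaled_min D z + scaled_min (V - D) z)
      * (1 + height (\<gamma> (retract V D z))) = 1 + scaled_min D z"
    unfolding f(3) using f(1,2) by (simp add: add.assoc)
  have le: "1 + scaled_min D z \<le> 1" and xeq: "x = scale (1 + scaled_min D z) (\<gamma> (retract V D z))"
    using shrink_nz[OF x \<open>shrink x = collar z\<close>[unfolded collar_def] f(4,5), unfolded e] by auto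
  then have m0: "scaled_min D z = 0" using f(1) by simp
  then have "z \<in> base" using z scaled_min_eq_0_iff[OF finite_V DcV D_ne z] by (simp add: base_iff)
  moreover have "retract V D z = z" by (simp add: retract_def m0)
  ultimately show "z \<in> base \<and> x = \<gamma> z" using xeq m0 by simp
next
  assume zx: "z \<in> base \<and> x = \<gamma> z"
  then have "scaled_min D z = 0" using z scaled_min_eq_0_iff[OF finite_V DcV D_ne z] by (simp add: base_iff)
  then have "collar z = scale (1 / (1 + height (\<gamma> z))) (\<gamma> z)"
    using height_\<gamma> zx by (simp add: collar_def retract_def)
  also have "\<dots> = shrink x" using shrink_polar[OF \<gamma>_sphere, of z 1] zx by simp
  finally show "shrink x = collar z" by simp
qed

lemma inj_on_collar: "inj_on collar (closed_simplex V)"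
proof (rule inj_onI)
  fix y z assume y: "y \<in> closed_simplex V" and z: "z \<in> closed_simplex V" and eq: "collar y = collar z"
  note fy = collar_factor[OF y] and fz = collar_factor[OF z]
  let ?c = "\<lambda>z. (1 + scaled_min D z) / (1 + scaled_min D z + scaled_min (V - D) z)"
  have e: "?c y = ?c z \<and> \<gamma> (retract V D y) = \<gamma> (retract V D z)"
    using scale_sphere_eq[OF fy(4) fz(4) fy(5) _ eq[unfolded collar_def]] fz(5) by simp
  then have r: "retract V D y = retract V D z"
    using inj_onD[OF \<gamma>_inj] retract_in_base y z by blast
  have "scaled_min D y + scaled_min (V - D) y = scaled_min D z + scaled_min (V - D) z"
    using fy(3) fz(3) e by simp
  then have "scaled_min D y = scaled_min D z" using e fy(1,2) by (auto simp: add.assoc)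
  then show "y = z" using push_retract[OF y] push_retract[OF z] r by metis
qed

text \<open>
  The old boundary stays on the boundary exactly where nothing has been stacked on it.
\<close>

lemma nrm_shrink_eq_1_iff:
  assumes "x \<in> round_ball N"
  shows "nrm N (shrink x) = 1 \<longleftrightarrow> x \<in> round_sphere N \<and> (\<forall>b\<in>base. x = \<gamma> b \<longrightarrow> (\<exists>v\<in>V - D. b v = 0))"
proof -
  have height0: "height x = 0 \<longleftrightarrow> (\<forall>b\<in>base. x = \<gamma> b \<longrightarrow> (\<exists>v\<in>V - D. b v = 0))" for x
  proof (cases "x \<in> \<gamma> ` base")
    case True
    then obtain b where "b \<in> base" "x = \<gamma> b" by blast
    moreover have "\<And>b'. b' \<in> base \<Longrightarrow> \<gamma> b = \<gamma> b' \<Longrightarrow> b' = b" using \<open>b \<in> base\<close> \<gamma>_inj by (auto dest: inj_onD)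
    ultimately show ?thesis
      using height_\<gamma> scaled_min_eq_0_iff[OF finite_V Diff_subset co_ne, of b] by (auto simp: base_iff)
  qed (auto simp: height_def)
  show ?thesis using assms
  proof (cases rule: round_ball_polar)
    case 1
    then show ?thesis by (simp add: round_sphere_def)
  next
    case (2 r \<theta>)
    have h: "0 \<le> height \<theta>" by (rule height_bounds)
    have "nrm N (shrink x) = r / (1 + height \<theta>)"
      using 2 shrink_polar h by (simp add: nrm_scale_sphere)
    moreover have "r / (1 + height \<theta>) = 1 \<longleftrightarrow> r = 1 \<and> height \<theta> = 0"
      using 2 h by (auto simp: field_simps)
    moreover have "x \<in> round_sphere N \<longleftrightarrow> r = 1"
      using 2 assms nrm_scale_sphere[OF 2(3), of r] by (auto simp: round_sphere_def round_ball_def)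
    ultimately show ?thesis using 2(4) height0[of \<theta>] by auto
  qed
qed

lemma nrm_collar_eq_1_iff:
  assumes "z \<in> closed_simplex V"
  shows "nrm N (collar z) = 1 \<longleftrightarrow> (\<exists>v\<in>V - D. z v = 0)"
proof -
  note f = collar_factor[OF assms]
  have "nrm N (collar z) = (1 + scaled_min D z) / (1 + scaled_min D z + scaled_min (V - D) z)"
    using f nrm_scale_sphere[OF f(4)] by (simp add: collar_def)
  also have "\<dots> = 1 \<longleftrightarrow> scaled_min (V - D) z = 0"
    using f(1,2) by (auto simp: field_simps)
  finally show ?thesis using scaled_min_eq_0_iff[OF finite_V Diff_subset co_ne assms] by simp
qed

text \<open>
  Each ray is covered up to the radius \<open>1 / (1 + height \<theta>)\<close> by the old ball and beyond by the segment of
  the simplex that sits on it.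
\<close>

lemma shrink_collar_cover: "shrink ` round_ball N \<union> collar ` closed_simplex V = round_ball N"
proof
  show "shrink ` round_ball N \<union> collar ` closed_simplex V \<subseteq> round_ball N"
  proof (intro Un_least image_subsetI)
    fix x assume "x \<in> round_ball N"
    then show "shrink x \<in> round_ball N"
    proof (cases rule: round_ball_polar)
      case (2 r \<theta>)
      have "0 \<le> r / (1 + height \<theta>)" "r / (1 + height \<theta>) \<le> 1"
        using height_bounds(1)[of \<theta>] 2(1,2) by (simp_all add: field_simps)
      then show ?thesis
        unfolding 2(4) shrink_polar[OF 2(3,1)] by (intro scale_sphere_in_ball 2(3)) (simp only: abs_of_nonneg)
    qed (simp add: round_ball_def)
  next
    fix z assume z: "z \<in> closed_simplex V"
    note f = collar_factor[OF z]
    have "(1 + scaled_min D z) / (1 + scaled_min D z + scaled_min (V - D) z) \<le> 1"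
      using f(1,2) by (simp add: field_simps)
    then show "collar z \<in> round_ball N"
      unfolding collar_def using f(5) by (intro scale_sphere_in_ball f(4)) (simp only: abs_of_pos)
  qed
  show "round_ball N \<subseteq> shrink ` round_ball N \<union> collar ` closed_simplex V"
  proof
    fix x assume x: "x \<in> round_ball N"
    then show "x \<in> shrink ` round_ball N \<union> collar ` closed_simplex V"
    proof (cases rule: round_ball_polar)
      case 1
      then show ?thesis using x shrink_zero by (metis UnI1 image_eqI)
    next
      case (2 r \<theta>)
      let ?s = "r * (1 + height \<theta>)"
      have h: "0 < 1 + height \<theta>" using height_bounds(1)[of \<theta>] by simp
      then have s: "0 < ?s" using 2(1) by simp
      show ?thesis
      proof (cases "?s \<le> 1")
        case True
        then have "scale ?s \<theta> \<in> round_ball N" using s by (intro scale_sphere_in_ball 2(3)) simp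
        moreover have "shrink (scale ?s \<theta>) = x"
          unfolding shrink_polar[OF 2(3) s] 2(4) using h by simp
        ultimately show ?thesis by blast
      next
        case False
        then have "height \<theta> \<noteq> 0" using 2(2) by auto
        then obtain b where b: "b \<in> base" "\<theta> = \<gamma> b" by (auto simp: height_def split: if_split_asm)
        then obtain d where d: "b \<in> closed_simplex V" "d \<in> D" "b d = 0" by (auto simp: base_iff)
        have hb: "height \<theta> = scaled_min (V - D) b" using b height_\<gamma> by simp
        have "?s \<le> 1 + height \<theta>" using 2(2) h by simp
        then have t: "0 \<le> ?s - 1" "?s - 1 \<le> scaled_min (V - D) b" using False hb by auto
        \<comment> \<open>The part of the radius beyond the ball tells how far to move back from \<open>b\<close> along its segment.\<close>
        let ?z = "push V D (- (?s - 1)) b"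
        note u = retract_unpush[OF d t]
        have "scaled_min (V - D) ?z = scaled_min (V - D) b - (?s - 1)"
          by (simp add: scaled_min_co_push)
        then have "collar ?z = scale (?s / (1 + height \<theta>)) \<theta>"
          unfolding collar_def u(2,3) using hb b by (simp add: add.commute)
        also have "\<dots> = x" unfolding 2(4) using h by simp
        finally show ?thesis using u(1) by blast
      qed
    qed
  qed
qed

end

section \<open>Coning off the boundary of a simplex\<close>

definition simplex_boundary :: "'v set \<Rightarrow> ('v \<Rightarrow> real) set" where
  "simplex_boundary V = (\<Union>v\<in>V. facet_at V v)"

lemma simplex_boundary_iff: "z \<in> simplex_boundary V \<longleftrightarrow> z \<in> closed_simplex V \<and> (\<exists>v\<in>V. z v = 0)"
  by (auto simp: simplex_boundary_def facet_at_def)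

text \<open>
  Central projection from the barycentre to the boundary. The scaled minimum is \<open>1\<close> at the barycentre,
  where the quotient has the default value, and \<open>0\<close> on the boundary.
\<close>

definition radial :: "'v set \<Rightarrow> ('v \<Rightarrow> real) \<Rightarrow> 'v \<Rightarrow> real" where
  "radial V z = (\<lambda>v. if v \<in> V then (z v - scaled_min V z / card V) / (1 - scaled_min V z) else 0)"

lemma simplex_ext:
  assumes "y \<in> closed_simplex V" "z \<in> closed_simplex V" "\<And>v. v \<in> V \<Longrightarrow> y v = z v"
  shows "y = z"
proof
  fix v show "y v = z v" using assms by (cases "v \<in> V") (auto simp: closed_simplex_def)
qed

text \<open>
  A homeomorphism from the boundary of a simplex to a sphere extends to a homeomorphism from the simplex
  to the ball, because both are cones over their boundaries. The extension serves for the first simplex of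
  a gluing and, once all facets of the last simplex have been mapped to a sphere, for the last one.
\<close>

locale coned_simplex =
  fixes V :: "'v set" and N :: nat and \<gamma> :: "('v \<Rightarrow> real) \<Rightarrow> nat \<Rightarrow> real"
  assumes finite_V: "finite V" and V_ne: "V \<noteq> {}"
    and \<gamma>_cont: "continuous_on (simplex_boundary V) \<gamma>"
    and \<gamma>_inj: "inj_on \<gamma> (simplex_boundary V)"
    and \<gamma>_onto: "\<gamma> ` simplex_boundary V = round_sphere N"
begin

definition "lid z = scale (1 - scaled_min V z) (\<gamma> (radial V z))"

lemma card_V: "0 < card V"
  using finite_V V_ne by (simp add: card_gt_0_iff)

lemmas min_bounds = scaled_min_bounds[OF finite_V subset_refl V_ne]
  and min_eq_0_iff = scaled_min_eq_0_iff[OF finite_V subset_refl V_ne]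

lemma min_div_le: "v \<in> V \<Longrightarrow> scaled_min V z / card V \<le> z v"
  using finite_V card_V by (auto simp: scaled_min_def)

lemma center_unique:
  assumes z: "z \<in> closed_simplex V" and 1: "scaled_min V z = 1" and v: "v \<in> V"
  shows "z v = 1 / card V"
proof -
  have "(\<Sum>v\<in>V. z v - 1 / card V) = 0"
    using z card_V by (simp add: sum_subtractf closed_simplex_def)
  then have "\<forall>v\<in>V. z v - 1 / card V = 0"
    using min_div_le[of _ z] 1 finite_V by (subst (asm) sum_nonneg_eq_0_iff) auto
  then show ?thesis using v by simp
qed

lemma
  assumes z: "z \<in> closed_simplex V" and ne: "scaled_min V z \<noteq> 1"
  shows radial_in_boundary: "radial V z \<in> simplex_boundary V"
    and radial_decomp: "v \<in> V \<Longrightarrow> z v = (1 - scaled_min V z) * radial V z v + scaled_min V z / card V"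
proof -
  have lt: "0 < 1 - scaled_min V z" using min_bounds(2)[OF z] ne by simp
  have nn: "0 \<le> radial V z v" for v
    using min_div_le[of v z] lt by (simp add: radial_def)
  have "sum (radial V z) V = (\<Sum>v\<in>V. (z v - scaled_min V z / card V) / (1 - scaled_min V z))"
    by (rule sum.cong) (auto simp: radial_def)
  also have "\<dots> = (\<Sum>v\<in>V. z v - scaled_min V z / card V) / (1 - scaled_min V z)"
    by (rule sum_divide_distrib[symmetric])
  also have "\<dots> = 1"
    using z card_V lt by (simp add: sum_subtractf closed_simplex_def)
  finally have "sum (radial V z) V = 1" .
  moreover have "\<exists>v\<in>V. radial V z v = 0"
  proof -
    have "Min (z ` V) \<in> z ` V" using finite_V V_ne by simp
    then obtain v where "v \<in> V" "z v = Min (z ` V)" by auto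
    then have "radial V z v = 0" using card_V by (simp add: radial_def scaled_min_def)
    then show ?thesis using \<open>v \<in> V\<close> by blast
  qed
  ultimately show "radial V z \<in> simplex_boundary V"
    using nn by (auto simp: simplex_boundary_iff closed_simplex_def radial_def)
  show "v \<in> V \<Longrightarrow> z v = (1 - scaled_min V z) * radial V z v + scaled_min V z / card V"
    using lt by (simp add: radial_def)
qed

lemma radial_boundary: "b \<in> simplex_boundary V \<Longrightarrow> radial V b = b"
  using min_eq_0_iff[of b] by (auto simp: simplex_boundary_iff radial_def closed_simplex_def)

lemma lid_boundary: "b \<in> simplex_boundary V \<Longrightarrow> lid b = \<gamma> b"
  using min_eq_0_iff[of b] by (simp add: lid_def radial_boundary) (simp add: simplex_boundary_iff)

lemma \<gamma>_radial: "z \<in> closed_simplex V \<Longrightarrow> scaled_min V z \<noteq> 1 \<Longrightarrow> \<gamma> (radial V z) \<in> round_sphere N"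
  using radial_in_boundary \<gamma>_onto by blast

lemma lid_in_ball: "z \<in> closed_simplex V \<Longrightarrow> lid z \<in> round_ball N"
  and nrm_lid: "z \<in> closed_simplex V \<Longrightarrow> nrm N (lid z) = 1 - scaled_min V z"
proof -
  assume z: "z \<in> closed_simplex V"
  note b = min_bounds[OF z]
  have "lid z \<in> round_ball N \<and> nrm N (lid z) = 1 - scaled_min V z"
  proof (cases "scaled_min V z = 1")
    case True
    then show ?thesis by (simp add: lid_def round_ball_def)
  next
    case False
    then show ?thesis
      using b scale_sphere_in_ball[OF \<gamma>_radial[OF z], of "1 - scaled_min V z"]
        nrm_scale_sphere[OF \<gamma>_radial[OF z], of "1 - scaled_min V z"] by (simp add: lid_def)
  qed
  then show "lid z \<in> round_ball N" "nrm N (lid z) = 1 - scaled_min V z" by auto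
qed

lemma nrm_lid_eq_1_iff: "z \<in> closed_simplex V \<Longrightarrow> nrm N (lid z) = 1 \<longleftrightarrow> (\<exists>v\<in>V. z v = 0)"
  using nrm_lid min_eq_0_iff by simp

lemma continuous_on_lid: "continuous_on (closed_simplex V) lid"
proof (rule continuous_on_scale_squeeze[where q="\<lambda>z. 1 - scaled_min V z" and N=N])
  show "continuous_on (closed_simplex V) (\<lambda>z. 1 - scaled_min V z)"
    by (intro continuous_on_diff continuous_on_const continuous_on_scaled_min finite_V V_ne)
  let ?X = "{z \<in> closed_simplex V. 1 - scaled_min V z \<noteq> 0}"
  have "continuous_on ?X (\<lambda>z. radial V z v)" for v
  proof (cases "v \<in> V")
    case True
    then show ?thesis
      unfolding radial_def if_P[OF True]
      by (intro continuous_on_divide continuous_on_diff continuous_on_const continuous_on_coordinate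
          continuous_on_scaled_min finite_V V_ne) (use card_V in auto)
  qed (simp add: radial_def)
  then have "continuous_on ?X (radial V)" by (rule continuous_on_coordinatewise_then_product)
  then have "continuous_on ?X (\<lambda>z. \<gamma> (radial V z))"
    by (rule continuous_on_compose2[OF \<gamma>_cont]) (use radial_in_boundary in auto)
  then show "continuous_on ?X lid"
    unfolding lid_def
    by (intro continuous_on_scale continuous_on_diff continuous_on_const
          continuous_on_scaled_min finite_V V_ne)
  show "nrm N (lid z) \<le> \<bar>1 - scaled_min V z\<bar>" if "z \<in> closed_simplex V" for z
    using nrm_lid[OF that] by simp
  show "lid z i = 0" if "z \<in> closed_simplex V" "N \<le> i" for z i
    using lid_in_ball[OF that(1)] that(2) by (simp add: round_ball_def)
qed

lemma inj_on_lid: "inj_on lid (closed_simplex V)"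
proof (rule inj_onI)
  fix y z assume y: "y \<in> closed_simplex V" and z: "z \<in> closed_simplex V" and eq: "lid y = lid z"
  have m: "scaled_min V y = scaled_min V z" using nrm_lid[OF y] nrm_lid[OF z] eq by simp
  show "y = z"
  proof (rule simplex_ext[OF y z])
    fix v assume v: "v \<in> V"
    show "y v = z v"
    proof (cases "scaled_min V z = 1")
      case True
      then show ?thesis using center_unique[OF y _ v] center_unique[OF z _ v] m by simp
    next
      case False
      then have "\<gamma> (radial V y) = \<gamma> (radial V z)"
        using scale_sphere_eq[OF \<gamma>_radial[OF y] \<gamma>_radial[OF z] _ _ eq[unfolded lid_def]] m
          min_bounds(2)[OF z] by simp
      then have "radial V y = radial V z"
        using inj_onD[OF \<gamma>_inj] radial_in_boundary y z False m by simp
      then show ?thesis using radial_decomp[OF y _ v] radial_decomp[OF z _ v] False m by simp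
    qed
  qed
qed

lemma lid_onto: "lid ` closed_simplex V = round_ball N"
proof
  show "lid ` closed_simplex V \<subseteq> round_ball N" using lid_in_ball by blast
  have hit: "scale r (\<gamma> b) \<in> lid ` closed_simplex V"
    if b: "b \<in> simplex_boundary V" and r: "0 \<le> r" "r \<le> 1" for r b
  proof -
    let ?z = "\<lambda>v. if v \<in> V then r * b v + (1 - r) / card V else 0"
    have bV: "b \<in> closed_simplex V" using b by (simp add: simplex_boundary_iff)
    have "sum ?z V = (\<Sum>v\<in>V. r * b v + (1 - r) / card V)" by (rule sum.cong) auto
    also have "\<dots> = 1" using bV card_V by (simp add: sum.distrib closed_simplex_def flip: sum_distrib_left)
    finally have z: "?z \<in> closed_simplex V"
      using bV r by (auto simp: closed_simplex_def)
    have m: "scaled_min V ?z = 1 - r"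
    proof -
      have "scaled_min V ?z = scaled_min V (\<lambda>v. r * b v) + card V * ((1 - r) / card V)"
        by (rule scaled_min_shift[OF finite_V V_ne]) simp
      moreover have "Min ((\<lambda>v. r * b v) ` V) = 0"
      proof -
        obtain v where "v \<in> V" "b v = 0" using b by (auto simp: simplex_boundary_iff)
        then show ?thesis using finite_V V_ne r bV by (subst Min_eq_iff) (auto simp: closed_simplex_def intro!: image_eqI[of _ _ v])
      qed
      ultimately show ?thesis using card_V by (simp add: scaled_min_def)
    qed
    have lid: "lid ?z = scale r (\<gamma> b)"
    proof (cases "r = 0")
      case False
      then have "radial V ?z = b"
        using bV by (auto simp: radial_def m closed_simplex_def)
      then show ?thesis by (simp add: lid_def m)
    qed (simp add: lid_def m)
    show ?thesis unfolding lid[symmetric] using z by (rule imageI)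
  qed
  obtain v where "v \<in> V" using V_ne by blast
  show "round_ball N \<subseteq> lid ` closed_simplex V"
  proof
    fix x assume "x \<in> round_ball N"
    then show "x \<in> lid ` closed_simplex V"
    proof (cases rule: round_ball_polar)
      case 1
      let ?c = "\<lambda>v. if v \<in> V then 1 / card V else (0::real)"
      have "?c \<in> closed_simplex V" using card_V by (auto simp: closed_simplex_def)
      moreover have "scaled_min V ?c = 1"
      proof -
        have "?c ` V = {1 / card V}" using V_ne by auto
        then show ?thesis using card_V by (simp add: scaled_min_def)
      qed
      then have "lid ?c = x" using 1 by (simp add: lid_def)
      ultimately show ?thesis by blast
    next
      case (2 r \<theta>)
      then obtain b where "b \<in> simplex_boundary V" "\<theta> = \<gamma> b" using \<gamma>_onto by blast
      then show ?thesis using hit[of b r] 2(1,2,4) by simp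
    qed
  qed
qed

end

text \<open>
  Subtracting the coordinate of one vertex from the others maps the boundary of the simplex into
  \<open>N\<close>-space so that every ray from the origin is met once; it remains to normalize.
\<close>

lemma exists_boundary_sphere:
  assumes fin: "finite V" and card: "card V = Suc N"
  obtains \<gamma> where "coned_simplex V N \<gamma>"
proof -
  obtain e where e: "bij_betw e {..N} V"
    using ex_bij_betw_nat_finite[OF fin] card by (metis atLeast0LessThan lessThan_Suc_atMost)
  have eV: "e i \<in> V" if "i \<le> N" for i using bij_betwE[OF e] that by auto
  have Ve: "\<exists>i\<le>N. v = e i" if "v \<in> V" for v using that e by (auto simp: bij_betw_def)
  define edge where "edge z = (\<lambda>i. if i < N then z (e i) - z (e N) else 0)" for z :: "'a \<Rightarrow> real"
  let ?\<gamma> = "\<lambda>b. scale (1 / nrm N (edge b)) (edge b)"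
  have V_ne: "V \<noteq> {}" using card by auto
  have cardV: "0 < card V" using card by simp
  have edge_nz: "0 < nrm N (edge b)" if b: "b \<in> simplex_boundary V" for b
  proof (rule ccontr)
    assume "\<not> 0 < nrm N (edge b)"
    then have "nrm N (edge b) = 0" using nrm_nonneg[of N "edge b"] by linarith
    then have eq: "b (e i) = b (e N)" if "i \<le> N" for i
      using that by (cases "i = N") (auto simp: nrm_eq_0_iff edge_def)
    obtain v where v: "v \<in> V" "b v = 0" using b by (auto simp: simplex_boundary_iff)
    then have "b (e N) = 0" using eq Ve by metis
    then have "b v = 0" if "v \<in> V" for v using eq Ve that by metis
    then have "sum b V = 0" by simp
    then show False using b by (simp add: simplex_boundary_iff closed_simplex_def)
  qed
  have "coned_simplex V N ?\<gamma>"
  proof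
    have "continuous_on X edge" for X
    proof (rule continuous_on_coordinatewise_then_product)
      show "continuous_on X (\<lambda>z. edge z i)" for i
        by (cases "i < N") (auto simp: edge_def intro!: continuous_intros)
    qed
    then show "continuous_on (simplex_boundary V) ?\<gamma>"
      using edge_nz by (intro continuous_on_scale continuous_on_divide continuous_on_nrm continuous_on_const) force+
    show "inj_on ?\<gamma> (simplex_boundary V)"
    proof (rule inj_onI)
      fix b c assume b: "b \<in> simplex_boundary V" and c: "c \<in> simplex_boundary V" and eq: "?\<gamma> b = ?\<gamma> c"
      define l where "l = nrm N (edge b) / nrm N (edge c)"
      have l: "0 < l" using edge_nz b c by (simp add: l_def)
      have "b (e i) - b (e N) = l * (c (e i) - c (e N))" if "i \<le> N" for i
        using fun_cong[OF eq, of i] that edge_nz[OF b] edge_nz[OF c]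
        by (cases "i = N") (auto simp: scale_def l_def edge_def field_simps)
      then have k: "b v - l * c v = b (e N) - l * c (e N)" if "v \<in> V" for v
        using Ve[OF that] by (auto simp: algebra_simps)
      have nn: "0 \<le> b v" "0 \<le> c v" for v using b c by (auto simp: simplex_boundary_iff closed_simplex_def)
      obtain v w where vw: "v \<in> V" "b v = 0" "w \<in> V" "c w = 0" using b c by (auto simp: simplex_boundary_iff)
      \<comment> \<open>\<open>b - l c\<close> is constant on \<open>V\<close>, not positive where \<open>b\<close> vanishes, and not negative where \<open>c\<close> vanishes.\<close>
      have "b (e N) - l * c (e N) = 0"
        using k[OF vw(1), unfolded vw(2)] k[OF vw(3), unfolded vw(4)] nn(1)[of w]
          mult_nonneg_nonneg[OF less_imp_le[OF l] nn(2)[of v]]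
        by simp
      then have bl: "b v = l * c v" if "v \<in> V" for v using k[OF that] by simp
      have "sum b V = l * sum c V" using bl by (simp add: sum_distrib_left)
      then have "l = 1" using b c by (simp add: simplex_boundary_iff closed_simplex_def)
      then show "b = c" using bl b c by (intro simplex_ext[of b V c]) (auto simp: simplex_boundary_iff)
    qed
    show "?\<gamma> ` simplex_boundary V = round_sphere N"
    proof
      show "?\<gamma> ` simplex_boundary V \<subseteq> round_sphere N"
      proof (rule image_subsetI)
        fix b assume "b \<in> simplex_boundary V"
        then have "nrm N (?\<gamma> b) = 1" using edge_nz by (force simp: nrm_scale)
        moreover have "?\<gamma> b i = 0" if "N \<le> i" for i using that by (simp add: scale_def edge_def)
        ultimately show "?\<gamma> b \<in> round_sphere N" by (simp add: round_sphere_def)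
      qed
      show "round_sphere N \<subseteq> ?\<gamma> ` simplex_boundary V"
      proof
        fix \<theta> assume \<theta>: "\<theta> \<in> round_sphere N"
        define y where "y v = \<theta> (the_inv_into {..N} e v)" for v
        have ye: "y (e i) = \<theta> i" if "i \<le> N" for i
          using that the_inv_into_f_f[of e "{..N}" i] e by (simp add: y_def bij_betw_def)
        define \<mu> where "\<mu> = Min (y ` V)"
        define T where "T = (\<Sum>v\<in>V. y v - \<mu>)"
        have \<mu>: "\<mu> \<le> y v" if "v \<in> V" for v using fin that by (simp add: \<mu>_def)
        have "\<mu> \<in> y ` V" unfolding \<mu>_def using fin V_ne by (intro Min_in) auto
        then obtain w where w: "w \<in> V" "y w = \<mu>" by auto
        have "T \<noteq> 0"
        proof
          assume "T = 0"
          then have "\<forall>v\<in>V. y v - \<mu> = 0"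
            unfolding T_def using fin \<mu> by (subst (asm) sum_nonneg_eq_0_iff) auto
          then have "\<theta> i = \<theta> N" if "i \<le> N" for i using ye[OF that] ye[of N] eV that by force
          then have "\<theta> i = 0" if "i \<le> N" for i using \<theta> that by (simp add: round_sphere_def)
          then have "nrm N \<theta> = 0" by (simp add: nrm_eq_0_iff)
          then show False using \<theta> by (simp add: round_sphere_def)
        qed
        moreover have "0 \<le> T" unfolding T_def using \<mu> by (intro sum_nonneg) simp
        ultimately have T: "0 < T" by simp
        define b where "b v = (if v \<in> V then (y v - \<mu>) / T else 0)" for v
        have "sum b V = (\<Sum>v\<in>V. y v - \<mu>) / T"
          unfolding sum_divide_distrib by (rule sum.cong) (auto simp: b_def)
        then have "sum b V = 1" using T by (simp add: T_def)
        then have b: "b \<in> simplex_boundary V"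
          using T \<mu> w by (auto simp: simplex_boundary_iff closed_simplex_def b_def)
        have "edge b = scale (1 / T) \<theta>"
        proof
          fix i
          show "edge b i = scale (1 / T) \<theta> i"
            using \<theta> eV[of i] eV[of N] ye[of i] ye[of N]
            by (cases "i < N") (auto simp: edge_def scale_def b_def round_sphere_def diff_divide_distrib)
        qed
        then have "?\<gamma> b = \<theta>" using T \<theta> by (simp add: nrm_scale round_sphere_def)
        then show "\<theta> \<in> ?\<gamma> ` simplex_boundary V" using b by blast
      qed
    qed
  qed (use fin V_ne in auto)
  then show thesis by (rule that)
qed

section \<open>Doubling a ball\<close>

definition hemisphere :: "nat \<Rightarrow> real \<Rightarrow> (nat \<Rightarrow> real) \<Rightarrow> nat \<Rightarrow> real" where
  "hemisphere N s x = x(N := s * sqrt (1 - (nrm N x)\<^sup>2))"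

lemma continuous_on_hemisphere:
  assumes "continuous_on X f"
  shows "continuous_on X (\<lambda>x. hemisphere N s (f x))"
proof (rule continuous_on_coordinatewise_then_product)
  fix i show "continuous_on X (\<lambda>x. hemisphere N s (f x) i)"
    by (cases "i = N")
      (auto simp: hemisphere_def intro!: continuous_intros assms continuous_on_product_then_coordinatewise[OF assms])
qed

lemma hemisphere_upd: "x \<in> round_ball N \<Longrightarrow> (hemisphere N s x)(N := 0) = x"
  by (auto simp: hemisphere_def round_ball_def)

lemma inj_on_hemisphere: "inj_on (hemisphere N s) (round_ball N)"
  by (rule inj_onI) (metis hemisphere_upd)

lemma nrm_upd: "nrm N (x(N := c)) = nrm N x"
  by (simp add: nrm_def)

lemma nrm_Suc: "(nrm (Suc N) x)\<^sup>2 = (nrm N x)\<^sup>2 + (x N)\<^sup>2"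
  by (simp add: nrm_def sum_nonneg)

lemma ball_square_le: "x \<in> round_ball N \<Longrightarrow> (nrm N x)\<^sup>2 \<le> 1"
  by (simp add: round_ball_def power_le_one)

lemma opposite_hemispheres_meet:
  assumes x: "x \<in> round_ball N" and y: "y \<in> round_ball N"
  shows "hemisphere N (-1) x = hemisphere N 1 y \<longleftrightarrow> x = y \<and> nrm N x = 1"
proof
  assume eq: "hemisphere N (-1) x = hemisphere N 1 y"
  have xy: "x = y" using hemisphere_upd[OF x] hemisphere_upd[OF y] eq by metis
  have "- sqrt (1 - (nrm N x)\<^sup>2) = sqrt (1 - (nrm N y)\<^sup>2)"
    using fun_cong[OF eq, of N] by (simp add: hemisphere_def)
  then have "(nrm N x)\<^sup>2 = 1" using xy by simp
  then show "x = y \<and> nrm N x = 1"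
    using xy nrm_nonneg[of N x] unfolding power2_eq_1_iff by linarith
next
  assume "x = y \<and> nrm N x = 1"
  then show "hemisphere N (-1) x = hemisphere N 1 y" by (auto simp: hemisphere_def)
qed

lemma hemispheres_cover:
  "hemisphere N (-1) ` round_ball N \<union> hemisphere N 1 ` round_ball N = round_sphere (Suc N)"
proof
  have "hemisphere N s x \<in> round_sphere (Suc N)" if x: "x \<in> round_ball N" and s: "s\<^sup>2 = 1" for s x
  proof -
    have "(nrm (Suc N) (hemisphere N s x))\<^sup>2 = 1"
      using ball_square_le[OF x] s
      by (simp add: nrm_Suc hemisphere_def nrm_upd power_mult_distrib)
    then have "nrm (Suc N) (hemisphere N s x) = 1"
      using nrm_nonneg[of "Suc N" "hemisphere N s x"] by (simp add: power2_eq_1_iff)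
    then show ?thesis using x by (auto simp: round_sphere_def hemisphere_def round_ball_def)
  qed
  then show "hemisphere N (-1) ` round_ball N \<union> hemisphere N 1 ` round_ball N \<subseteq> round_sphere (Suc N)"
    by auto
  show "round_sphere (Suc N) \<subseteq> hemisphere N (-1) ` round_ball N \<union> hemisphere N 1 ` round_ball N"
  proof
    fix y assume y: "y \<in> round_sphere (Suc N)"
    let ?x = "y(N := 0)"
    have 1: "(nrm N y)\<^sup>2 + (y N)\<^sup>2 = 1" using y nrm_Suc[of N y] by (simp add: round_sphere_def)
    then have "(nrm N y)\<^sup>2 \<le> 1" using zero_le_power2[of "y N"] by linarith
    then have "nrm N y \<le> 1" by (simp add: power2_le_iff_abs_le[of 1, simplified])
    then have x: "?x \<in> round_ball N"
      using y by (auto simp: round_ball_def round_sphere_def nrm_upd)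
    have yN: "\<bar>y N\<bar> = sqrt (1 - (nrm N ?x)\<^sup>2)"
    proof -
      have "(y N)\<^sup>2 = 1 - (nrm N ?x)\<^sup>2" using 1 by (simp add: nrm_upd)
      then show ?thesis using real_sqrt_abs[of "y N"] by simp
    qed
    show "y \<in> hemisphere N (-1) ` round_ball N \<union> hemisphere N 1 ` round_ball N"
    proof (cases "0 \<le> y N")
      case True
      then have "1 * sqrt (1 - (nrm N ?x)\<^sup>2) = y N" using yN by simp
      then have "hemisphere N 1 ?x = y"
        unfolding hemisphere_def fun_upd_upd by (intro fun_upd_idem) simp
      then show ?thesis using x by (metis UnI2 image_eqI)
    next
      case False
      then have "- 1 * sqrt (1 - (nrm N ?x)\<^sup>2) = y N" using yN by simp
      then have "hemisphere N (-1) ?x = y"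
        unfolding hemisphere_def fun_upd_upd by (intro fun_upd_idem) simp
      then show ?thesis using x by (metis UnI1 image_eqI)
    qed
  qed
qed

lemma closed_facet_at: "closed (facet_at V v)"
proof -
  have "closed {z::'a \<Rightarrow> real. u \<notin> V \<longrightarrow> z u = 0}" for u
    by (cases "u \<in> V") (auto intro!: closed_Collect_eq continuous_intros)
  then have "closed {z::'a \<Rightarrow> real. (\<forall>u. 0 \<le> z u) \<and> (\<forall>u. u \<notin> V \<longrightarrow> z u = 0) \<and> sum z V = 1 \<and> z v = 0}"
    by (intro closed_Collect_conj closed_Collect_all closed_Collect_le closed_Collect_eq continuous_intros)
  then show ?thesis by (simp add: facet_at_def closed_simplex_def conj_assoc)
qed

section \<open>Simplices glued in a shelling order\<close>

definition zeros :: "'v set \<Rightarrow> ('v \<Rightarrow> real) \<Rightarrow> 'v set" where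
  "zeros V z = {v\<in>V. z v = 0}"

lemma zeros_subset: "zeros V z \<subseteq> V"
  by (auto simp: zeros_def)

text \<open>
  Copies of the simplex with vertex set \<open>V\<close> are numbered by \<open>K\<close>. The same point \<open>z\<close> in the copies \<open>i\<close> and \<open>j\<close>
  is to be identified if \<open>cls Z i = cls Z j\<close>, where \<open>Z\<close> is the set of vanishing coordinates of \<open>z\<close>; by the
  last assumption with \<open>A = {}\<close> interior points of different copies stay distinct. The copy \<open>nb k v\<close> lies on
  the other side of the facet of copy \<open>k\<close> opposite to \<open>v\<close>. The last assumption says that the numbering is a
  shelling: whatever copy \<open>k\<close> shares with an earlier one is contained in a facet shared with an earlier one.
\<close>

locale simplicial_gluing =
  fixes V :: "'v set" and K :: "nat set" and cls :: "'v set \<Rightarrow> nat \<Rightarrow> 'c" and nb :: "nat \<Rightarrow> 'v \<Rightarrow> nat"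
  assumes finite_V: "finite V" and V_ne: "V \<noteq> {}"
    and K_0: "0 \<in> K" and K_down: "\<And>i k. k \<in> K \<Longrightarrow> i < k \<Longrightarrow> i \<in> K"
    and cls_mono: "\<And>A B i j. A \<subseteq> B \<Longrightarrow> B \<subseteq> V \<Longrightarrow> i \<in> K \<Longrightarrow> j \<in> K \<Longrightarrow> cls A i = cls A j \<Longrightarrow> cls B i = cls B j"
    and cls_V: "\<And>i j. i \<in> K \<Longrightarrow> j \<in> K \<Longrightarrow> cls V i = cls V j"
    and nb_K: "\<And>k v. k \<in> K \<Longrightarrow> v \<in> V \<Longrightarrow> nb k v \<in> K"
    and nb_neq: "\<And>k v. k \<in> K \<Longrightarrow> v \<in> V \<Longrightarrow> nb k v \<noteq> k"
    and nb_nb: "\<And>k v. k \<in> K \<Longrightarrow> v \<in> V \<Longrightarrow> nb (nb k v) v = k"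
    and cls_nb: "\<And>k v. k \<in> K \<Longrightarrow> v \<in> V \<Longrightarrow> cls {v} (nb k v) = cls {v} k"
    and earlier: "\<And>A i k. k \<in> K \<Longrightarrow> i < k \<Longrightarrow> A \<subseteq> V \<Longrightarrow> cls A i = cls A k \<Longrightarrow> \<exists>v\<in>A. nb k v < k"
begin

definition "down k = {v\<in>V. nb k v < k}"

lemma down_subset: "down k \<subseteq> V"
  by (auto simp: down_def)

abbreviation "same z i j \<equiv> cls (zeros V z) i = cls (zeros V z) j"

lemma same_nb: "k \<in> K \<Longrightarrow> v \<in> V \<Longrightarrow> z v = 0 \<Longrightarrow> same z (nb k v) k"
  using cls_mono[OF _ zeros_subset nb_K, of "{v}" z k v k] cls_nb by (auto simp: zeros_def)

lemma same_earlier: "k \<in> K \<Longrightarrow> i < k \<Longrightarrow> same z i k \<Longrightarrow> \<exists>d\<in>down k. z d = 0"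
  using earlier[OF _ _ zeros_subset, of k i z] by (auto simp: zeros_def down_def)

lemma down_ne: "k \<in> K \<Longrightarrow> 0 < k \<Longrightarrow> down k \<noteq> {}"
  using earlier[of k 0 V] cls_V[OF K_0] by (auto simp: down_def)

end

text \<open>
  The dual condition: if a face lies only in facets of copy \<open>k\<close> that are shared with earlier copies, then \<open>k\<close> is
  the last copy around this face. Such a face becomes interior as soon as copy \<open>k\<close> is attached.
\<close>

locale sphere_gluing = simplicial_gluing +
  assumes later: "\<And>A i k. k \<in> K \<Longrightarrow> i \<in> K \<Longrightarrow> A \<subseteq> down k \<Longrightarrow> cls A i = cls A k \<Longrightarrow> i \<le> k"
begin

text \<open>
  The point lies in a facet of one of the first \<open>k\<close> copies whose other side is not among them; these are the
  boundary points of their union.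
\<close>

definition exposed :: "nat \<Rightarrow> nat \<Rightarrow> ('a \<Rightarrow> real) \<Rightarrow> bool" where
  "exposed k i z \<longleftrightarrow> (\<exists>j<k. \<exists>v\<in>V. z v = 0 \<and> same z i j \<and> k \<le> nb j v)"

text \<open>
  The maps \<open>g i\<close> are the restrictions to the copies of a single homeomorphism from the union of the first \<open>k\<close>
  copies to the ball. Working with compatible families of maps avoids a topology on the intermediate spaces.
\<close>

definition ball_stage :: "nat \<Rightarrow> nat \<Rightarrow> (nat \<Rightarrow> ('a \<Rightarrow> real) \<Rightarrow> nat \<Rightarrow> real) \<Rightarrow> bool" where
  "ball_stage N k g \<longleftrightarrow>
     (\<forall>i<k. continuous_on (closed_simplex V) (g i)) \<and>
     (\<forall>i<k. \<forall>j<k. \<forall>y\<in>closed_simplex V. \<forall>z\<in>closed_simplex V. g i y = g j z \<longleftrightarrow> y = z \<and> same z i j) \<and>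
     (\<Union>i<k. g i ` closed_simplex V) = round_ball N \<and>
     (\<forall>i<k. \<forall>z\<in>closed_simplex V. nrm N (g i z) = 1 \<longleftrightarrow> exposed k i z)"

end

locale gluing_stage = sphere_gluing V K cls nb
  for V :: "'v set" and K and cls :: "'v set \<Rightarrow> nat \<Rightarrow> 'c" and nb +
  fixes N k :: nat and g :: "nat \<Rightarrow> ('v \<Rightarrow> real) \<Rightarrow> nat \<Rightarrow> real"
  assumes stage: "ball_stage N k g" and k_pos: "0 < k" and k_K: "k \<in> K"
begin

lemma g_cont: "i < k \<Longrightarrow> continuous_on (closed_simplex V) (g i)"
  and g_eq_iff: "i < k \<Longrightarrow> j < k \<Longrightarrow> y \<in> closed_simplex V \<Longrightarrow> z \<in> closed_simplex V \<Longrightarrow>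
    g i y = g j z \<longleftrightarrow> y = z \<and> same z i j"
  and g_cover: "(\<Union>i<k. g i ` closed_simplex V) = round_ball N"
  and nrm_g: "i < k \<Longrightarrow> z \<in> closed_simplex V \<Longrightarrow> nrm N (g i z) = 1 \<longleftrightarrow> exposed k i z"
  using stage by (simp_all add: ball_stage_def)

lemma g_ball: "i < k \<Longrightarrow> z \<in> closed_simplex V \<Longrightarrow> g i z \<in> round_ball N"
  using g_cover by blast

lemma g_sphere_iff: "i < k \<Longrightarrow> z \<in> closed_simplex V \<Longrightarrow> g i z \<in> round_sphere N \<longleftrightarrow> exposed k i z"
  using nrm_g g_ball by (auto simp: round_sphere_def round_ball_def)

text \<open>
  The attaching map of copy \<open>k\<close>. A point in a shared facet has already been mapped as a point of the copy on the
  other side, and all shared facets through the point give the same value.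
\<close>

definition "contact b = g (nb k (SOME d. d \<in> down k \<and> b d = 0)) b"

abbreviation "underside \<equiv> (\<Union>d\<in>down k. facet_at V d)"

lemma underside_iff: "b \<in> underside \<longleftrightarrow> b \<in> closed_simplex V \<and> (\<exists>d\<in>down k. b d = 0)"
  by (auto simp: facet_at_def)

lemma contact_eq:
  assumes b: "b \<in> closed_simplex V" and j: "j < k" "same b j k"
  shows "contact b = g j b"
proof -
  let ?d = "SOME d. d \<in> down k \<and> b d = 0"
  have "\<exists>d. d \<in> down k \<and> b d = 0" using same_earlier[OF k_K j] by blast
  then have d: "?d \<in> down k \<and> b ?d = 0" by (rule someI_ex)
  then have "nb k ?d < k" "same b (nb k ?d) k" using same_nb[OF k_K] by (auto simp: down_def)
  then show ?thesis using g_eq_iff[of "nb k ?d" j b b] b j by (simp add: contact_def)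
qed

lemma contact_nb: "b \<in> closed_simplex V \<Longrightarrow> d \<in> down k \<Longrightarrow> b d = 0 \<Longrightarrow> contact b = g (nb k d) b"
  by (rule contact_eq) (auto simp: down_def same_nb[OF k_K])

lemma contact_obtain:
  assumes "b \<in> underside"
  obtains j where "j < k" "same b j k" "contact b = g j b" "b \<in> closed_simplex V" "exposed k j b"
proof -
  obtain d where d: "b \<in> closed_simplex V" "d \<in> down k" "b d = 0" using assms underside_iff by blast
  then have "nb k d < k" "same b (nb k d) k" using same_nb[OF k_K] by (auto simp: down_def)
  moreover have "exposed k (nb k d) b"
    unfolding exposed_def using d nb_nb[OF k_K, of d] \<open>nb k d < k\<close> down_subset
    by (intro exI[of _ "nb k d"]) force
  ultimately show ?thesis using that[of "nb k d"] d contact_nb by simp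
qed

lemma contact_cont: "continuous_on underside contact"
proof (rule continuous_on_closed_Union)
  show "finite (down k)" using finite_subset[OF down_subset finite_V] .
  show "closed (facet_at V d)" for d by (rule closed_facet_at)
  show "continuous_on (facet_at V d) contact" if d: "d \<in> down k" for d
  proof -
    have "nb k d < k" using d by (simp add: down_def)
    then have "continuous_on (facet_at V d) (g (nb k d))"
      using g_cont continuous_on_subset by (metis (no_types, lifting) facet_at_def mem_Collect_eq subsetI)
    then show ?thesis
      by (rule continuous_on_eq) (use d contact_nb in \<open>auto simp: facet_at_def\<close>)
  qed
qed

lemma contact_eq_iff:
  assumes "b \<in> underside" "i < k" "z \<in> closed_simplex V"
  shows "g i z = contact b \<longleftrightarrow> z = b \<and> same z i k"
proof -
  obtain j where "j < k" "same b j k" "contact b = g j b" "b \<in> closed_simplex V"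
    using contact_obtain[OF assms(1)] by blast
  then show ?thesis using g_eq_iff[of i j z b] assms by auto
qed

lemma contact_inj: "inj_on contact underside"
proof (rule inj_onI)
  fix b c assume b: "b \<in> underside" and c: "c \<in> underside" and eq: "contact b = contact c"
  then obtain j where "j < k" "contact b = g j b" "b \<in> closed_simplex V" using contact_obtain by metis
  then show "b = c" using contact_eq_iff[OF c, of j b] eq by simp
qed

lemma contact_sphere: "b \<in> underside \<Longrightarrow> contact b \<in> round_sphere N"
  using contact_obtain g_sphere_iff by metis

text \<open>The part of the boundary that stays uncovered: it lies in facets whose other side comes after \<open>k\<close>.\<close>

definition "free = (\<Union>(i, v)\<in>{(i, v). i < k \<and> v \<in> V \<and> k < nb i v}. g i ` facet_at V v)"

lemma free_iff: "x \<in> free \<longleftrightarrow> (\<exists>i<k. \<exists>z\<in>closed_simplex V. x = g i z \<and> (\<exists>v\<in>V. z v = 0 \<and> k < nb i v))"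
  by (fastforce simp: free_def facet_at_def)

lemma closed_free: "closed free"
  unfolding free_def
proof (rule closed_UN)
  have "{(i, v). i < k \<and> v \<in> V \<and> k < nb i v} \<subseteq> {..<k} \<times> V" by auto
  then show "finite {(i, v). i < k \<and> v \<in> V \<and> k < nb i v}" using finite_V finite_subset by blast
  show "\<forall>x\<in>{(i, v). i < k \<and> v \<in> V \<and> k < nb i v}. closed (case x of (i, v) \<Rightarrow> g i ` facet_at V v)"
  proof clarify
    fix i v assume "i < k"
    then have "continuous_on (facet_at V v) (g i)"
      using g_cont continuous_on_subset by (metis (no_types, lifting) facet_at_def mem_Collect_eq subsetI)
    then show "closed (g i ` facet_at V v)"
      using compact_continuous_image compact_facet_at[OF finite_V] compact_imp_closed by blast
  qed
qed

lemma contact_free_cover: "contact ` underside \<union> free = round_sphere N"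
proof
  show "contact ` underside \<union> free \<subseteq> round_sphere N"
  proof (rule Un_least)
    show "contact ` underside \<subseteq> round_sphere N" using contact_sphere by blast
    show "free \<subseteq> round_sphere N"
    proof
      fix x assume "x \<in> free"
      then obtain i z v where i: "i < k" "z \<in> closed_simplex V" "x = g i z" "v \<in> V" "z v = 0" "k < nb i v"
        by (auto simp: free_iff)
      then have "exposed k i z" unfolding exposed_def by (intro exI[of _ i]) force
      then show "x \<in> round_sphere N" using g_sphere_iff i by simp
    qed
  qed
  show "round_sphere N \<subseteq> contact ` underside \<union> free"
  proof
    fix x assume x: "x \<in> round_sphere N"
    then have "x \<in> round_ball N" by (auto simp: round_sphere_def round_ball_def)
    then obtain i z where iz: "i < k" "z \<in> closed_simplex V" "x = g i z" using g_cover by blast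
    then have "exposed k i z" using g_sphere_iff x by simp
    then obtain j v where j: "j < k" "v \<in> V" "z v = 0" "same z i j" "k \<le> nb j v"
      by (auto simp: exposed_def)
    have xj: "x = g j z" using g_eq_iff[of i j z z] iz j by simp
    show "x \<in> contact ` underside \<union> free"
    proof (cases "nb j v = k")
      case True
      then have nbk: "nb k v = j" using nb_nb[of j v] j K_down[OF k_K] by metis
      then have v: "v \<in> down k" using j by (simp add: down_def)
      then have "contact z = x" using contact_nb[OF iz(2) v j(3)] nbk xj by simp
      then show ?thesis using v j iz by (metis UnI1 underside_iff image_eqI)
    next
      case False
      then show ?thesis using xj j iz by (force simp: free_iff)
    qed
  qed
qed

text \<open>
  A point of a facet whose second simplex comes after \<open>k\<close> cannot lie over the interior of the underside:
  all simplices around such a point would precede or equal \<open>k\<close>.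
\<close>

lemma not_exposed_interior:
  assumes z: "z \<in> closed_simplex V" and pos: "\<And>v. v \<in> V - down k \<Longrightarrow> z v \<noteq> 0"
    and j: "j \<in> K" "same z j k" and v: "v \<in> V" "z v = 0"
  shows "nb j v \<le> k"
proof -
  have "zeros V z \<subseteq> down k" using pos by (auto simp: zeros_def)
  moreover have "same z (nb j v) k" using same_nb[where z=z, OF j(1) v] j(2) by simp
  ultimately show ?thesis using later[OF k_K nb_K[OF j(1) v(1)]] by blast
qed

lemma contact_free:
  assumes b: "b \<in> underside" and "contact b \<in> free"
  shows "\<exists>v\<in>V - down k. b v = 0"
proof (rule ccontr)
  assume neg: "\<not> ?thesis"
  obtain i z v where i: "i < k" "z \<in> closed_simplex V" "contact b = g i z" "v \<in> V" "z v = 0" "k < nb i v"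
    using assms(2) by (auto simp: free_iff)
  then have zb: "z = b" "same z i k" using contact_eq_iff[OF b i(1,2)] i(3)[symmetric] by blast+
  have "nb i v \<le> k"
    using not_exposed_interior[OF i(2) _ K_down[OF k_K i(1)] zb(2) i(4,5)] neg zb(1) by blast
  then show False using i by simp
qed

text \<open>
  Attaching copy \<open>k\<close> keeps the ball. The boundary condition has to be followed through the step: a point of
  copy \<open>k\<close> is exposed afterwards if and only if one of its coordinates outside \<open>down k\<close> vanishes, and nothing
  changes for the other points.
\<close>

lemma next_stage:
  assumes proper: "down k \<noteq> V"
  shows "\<exists>g'. ball_stage N (Suc k) g'"
proof -
  interpret split_simplex V "down k"
    using finite_V down_subset proper down_ne[OF k_K k_pos] by unfold_locales auto
  interpret attach_simplex V "down k" N contact free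
    by unfold_locales (unfold base_def, use contact_cont contact_inj closed_free contact_free_cover contact_free in auto)
  have base: "base = underside" by (simp add: base_def)
  define g' where "g' i z = (if i < k then shrink (g i z) else collar z)" for i z
  have low_same: "z \<in> base \<and> g i z = contact z \<longleftrightarrow> same z i k" if "i < k" "z \<in> closed_simplex V" for i z
    unfolding base underside_iff
    using contact_eq[OF that(2,1)] contact_eq_iff[OF _ that, of z] same_earlier[OF k_K that(1), of z] that
    by (metis underside_iff)
  have "ball_stage N (Suc k) g'"
    unfolding ball_stage_def
  proof (intro conjI allI impI ballI)
    fix i assume i: "i < Suc k"
    show "continuous_on (closed_simplex V) (g' i)"
    proof (cases "i < k")
      case True
      have "continuous_on (closed_simplex V) (\<lambda>z. shrink (g i z))"
        by (rule continuous_on_compose2[OF continuous_on_shrink g_cont[OF True]]) (use g_ball[OF True] in auto)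
      then show ?thesis using True by (simp add: g'_def)
    qed (simp add: g'_def continuous_on_collar)
  next
    fix i j y z
    assume i: "i < Suc k" and j: "j < Suc k" and y: "y \<in> closed_simplex V" and z: "z \<in> closed_simplex V"
    have mixed: "shrink (g i y) = collar z \<longleftrightarrow> y = z \<and> same z i k" if "i < k" "y \<in> closed_simplex V" "z \<in> closed_simplex V" for i y z
    proof -
      have "shrink (g i y) = collar z \<longleftrightarrow> z \<in> base \<and> g i y = contact z"
        using shrink_eq_collar_iff g_ball that by simp
      also have "\<dots> \<longleftrightarrow> y = z \<and> same z i k"
        using contact_eq_iff[of z i y] low_same[of i z] that by (metis base)
      finally show ?thesis .
    qed
    consider "i < k" "j < k" | "i < k" "j = k" | "i = k" "j < k" | "i = k" "j = k" using i j by linarith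
    then show "g' i y = g' j z \<longleftrightarrow> y = z \<and> same z i j"
    proof cases
      case 1
      then show ?thesis
        using inj_on_eq_iff[OF inj_on_shrink g_ball g_ball, of i y j z] g_eq_iff y z by (simp add: g'_def)
    next
      case 2
      then show ?thesis using mixed[of i y z] y z by (simp add: g'_def)
    next
      case 3
      then show ?thesis using mixed[of j z y] y z by (auto simp: g'_def)
    next
      case 4
      then show ?thesis using inj_on_eq_iff[OF inj_on_collar y z] by (simp add: g'_def)
    qed
  next
    have "(\<Union>i<Suc k. g' i ` closed_simplex V) = (\<Union>i<k. shrink ` g i ` closed_simplex V) \<union> collar ` closed_simplex V"
      by (auto simp: g'_def lessThan_Suc image_image)
    also have "\<dots> = round_ball N"
      using shrink_collar_cover by (simp flip: g_cover image_UN)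
    finally show "(\<Union>i<Suc k. g' i ` closed_simplex V) = round_ball N" .
  next
    fix i z assume i: "i < Suc k" and z: "z \<in> closed_simplex V"
    have top: "k < nb k v \<longleftrightarrow> v \<in> V - down k" if "v \<in> V" for v
      using nb_neq[OF k_K that] that by (auto simp: down_def)
    show "nrm N (g' i z) = 1 \<longleftrightarrow> exposed (Suc k) i z"
    proof (cases "i < k")
      case True
      have low: "(\<forall>b\<in>base. g i z = contact b \<longrightarrow> (\<exists>v\<in>V - down k. b v = 0)) \<longleftrightarrow>
          (same z i k \<longrightarrow> (\<exists>v\<in>V - down k. z v = 0))"
        using contact_eq_iff[OF _ True z] low_same[OF True z] by (metis base)
      have "nrm N (g' i z) = 1 \<longleftrightarrow> exposed k i z \<and> (same z i k \<longrightarrow> (\<exists>v\<in>V - down k. z v = 0))"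
        unfolding low[symmetric]
        using nrm_shrink_eq_1_iff[OF g_ball[OF True z]] g_sphere_iff[OF True z] True by (simp add: g'_def)
      also have "\<dots> \<longleftrightarrow> exposed (Suc k) i z"
      proof (intro iffI conjI impI)
        assume a: "exposed k i z \<and> (same z i k \<longrightarrow> (\<exists>v\<in>V - down k. z v = 0))"
        then obtain j v where j: "j < k" "v \<in> V" "z v = 0" "same z i j" "k \<le> nb j v" by (auto simp: exposed_def)
        show "exposed (Suc k) i z"
        proof (cases "nb j v = k")
          case True
          then have "same z i k" using same_nb[of j v z] j K_down[OF k_K] by metis
          then obtain w where "w \<in> V - down k" "z w = 0" using a by blast
          then show ?thesis using top[of w] \<open>same z i k\<close> unfolding exposed_def
            by (intro exI[of _ k]) (auto simp: Suc_le_eq)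
        next
          case False
          then show ?thesis using j unfolding exposed_def by (intro exI[of _ j]) auto
        qed
      next
        assume "exposed (Suc k) i z"
        then obtain j v where j: "j < Suc k" "v \<in> V" "z v = 0" "same z i j" "k < nb j v"
          by (auto simp: exposed_def Suc_le_eq)
        show "exposed k i z"
        proof (cases "j = k")
          case False
          then show ?thesis using j unfolding exposed_def by (intro exI[of _ j]) auto
        next
          case jk: True
          then have "z \<in> underside" using low_same[OF True z] j base by simp
          then show ?thesis using low_same[OF True z] contact_sphere g_sphere_iff[OF True z] j jk by metis
        qed
        assume ik: "same z i k"
        show "\<exists>v\<in>V - down k. z v = 0"
        proof (rule ccontr)
          assume "\<not> ?thesis"
          then have "nb j v \<le> k"
            using not_exposed_interior[OF z, of j v] j ik K_down[OF k_K, of j] k_K by (auto simp: less_Suc_eq)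
          then show False using j by simp
        qed
      qed
      finally show ?thesis .
    next
      case False
      then have ik: "i = k" using i by simp
      have "nrm N (g' i z) = 1 \<longleftrightarrow> (\<exists>v\<in>V - down k. z v = 0)"
        using nrm_collar_eq_1_iff[OF z] ik by (simp add: g'_def)
      also have "\<dots> \<longleftrightarrow> exposed (Suc k) i z"
      proof
        assume "\<exists>v\<in>V - down k. z v = 0"
        then show "exposed (Suc k) i z" unfolding exposed_def ik
          using top by (intro exI[of _ k]) (auto simp: Suc_le_eq)
      next
        assume "exposed (Suc k) i z"
        then obtain j v where j: "j < Suc k" "v \<in> V" "z v = 0" "same z k j" "k < nb j v"
          by (auto simp: exposed_def Suc_le_eq ik)
        show "\<exists>v\<in>V - down k. z v = 0"
        proof (rule ccontr)
          assume "\<not> ?thesis"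
          then have "nb j v \<le> k"
            using not_exposed_interior[OF z, of j v] j K_down[OF k_K, of j] k_K by (auto simp: less_Suc_eq)
          then show False using j by simp
        qed
      qed
      finally show ?thesis .
    qed
  qed
  then show ?thesis by blast
qed

text \<open>
  A copy all of whose facets are shared with earlier copies covers the whole boundary of the ball, so that ball and
  copy become the two hemispheres of a sphere.
\<close>

lemma final_stage:
  assumes all: "down k = V"
  shows "\<exists>h. (\<forall>i\<le>k. continuous_on (closed_simplex V) (h i)) \<and>
     (\<forall>i\<le>k. \<forall>j\<le>k. \<forall>y\<in>closed_simplex V. \<forall>z\<in>closed_simplex V. h i y = h j z \<longleftrightarrow> y = z \<and> same z i j) \<and>
     (\<Union>i\<le>k. h i ` closed_simplex V) = round_sphere (Suc N)"
proof -
  have underside: "underside = simplex_boundary V" by (simp add: simplex_boundary_def all)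
  have "free = {}"
  proof (rule ccontr)
    assume "free \<noteq> {}"
    then obtain i z v where i: "i < k" "z \<in> closed_simplex V" "v \<in> V" "k < nb i v" by (force simp: free_iff)
    then have "nb i v \<le> k"
      using later[OF k_K nb_K, of i v V] cls_V[OF nb_K k_K] K_down[OF k_K] all by simp
    then show False using i by simp
  qed
  interpret coned_simplex V N contact
    using finite_V V_ne contact_cont contact_inj contact_free_cover
    by unfold_locales (auto simp: underside \<open>free = {}\<close>)
  define h where "h i z = (if i < k then hemisphere N (-1) (g i z) else hemisphere N 1 (lid z))" for i z
  have mixed: "hemisphere N (-1) (g i y) = hemisphere N 1 (lid z) \<longleftrightarrow> y = z \<and> same z i k"
    if i: "i < k" and y: "y \<in> closed_simplex V" and z: "z \<in> closed_simplex V" for i y z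
  proof -
    have "hemisphere N (-1) (g i y) = hemisphere N 1 (lid z) \<longleftrightarrow> g i y = lid z \<and> nrm N (lid z) = 1"
      using opposite_hemispheres_meet[OF g_ball[OF i y] lid_in_ball[OF z]] by auto
    also have "\<dots> \<longleftrightarrow> z \<in> underside \<and> g i y = contact z"
      using nrm_lid_eq_1_iff[OF z] lid_boundary[of z] z unfolding underside simplex_boundary_iff by metis
    also have "\<dots> \<longleftrightarrow> y = z \<and> same z i k"
      using contact_eq_iff[OF _ i y, of z] same_earlier[OF k_K i, of z] z unfolding underside_iff by metis
    finally show ?thesis .
  qed
  have "continuous_on (closed_simplex V) (h i)" for i
    using continuous_on_hemisphere[OF g_cont] continuous_on_hemisphere[OF continuous_on_lid]
    by (cases "i < k") (simp_all add: h_def)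
  moreover have "h i y = h j z \<longleftrightarrow> y = z \<and> same z i j"
    if ij: "i \<le> k" "j \<le> k" and yz: "y \<in> closed_simplex V" "z \<in> closed_simplex V" for i j y z
  proof -
    consider "i < k" "j < k" | "i < k" "j = k" | "i = k" "j < k" | "i = k" "j = k" using ij by linarith
    then show ?thesis
    proof cases
      case 1
      then show ?thesis
        using inj_on_eq_iff[OF inj_on_hemisphere g_ball g_ball, of i y j z "-1"] g_eq_iff yz by (simp add: h_def)
    next
      case 2
      then show ?thesis using mixed[of i y z] yz by (simp add: h_def)
    next
      case 3
      then show ?thesis using mixed[of j z y] yz by (auto simp: h_def)
    next
      case 4
      then show ?thesis
        using inj_on_eq_iff[OF inj_on_hemisphere lid_in_ball lid_in_ball, of y z 1] inj_on_eq_iff[OF inj_on_lid, of y z] yz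
        by (simp add: h_def)
    qed
  qed
  moreover have "(\<Union>i\<le>k. h i ` closed_simplex V) = round_sphere (Suc N)"
  proof -
    have "(\<Union>i\<le>k. h i ` closed_simplex V) = (\<Union>i<k. h i ` closed_simplex V) \<union> h k ` closed_simplex V"
    proof -
      have "{..k} = insert k {..<k}" by auto
      then show ?thesis by (simp only: UN_insert Un_commute)
    qed
    also have "(\<Union>i<k. h i ` closed_simplex V) = hemisphere N (-1) ` (\<Union>i<k. g i ` closed_simplex V)"
      by (auto simp: h_def image_UN image_image)
    also have "h k ` closed_simplex V = hemisphere N 1 ` lid ` closed_simplex V"
      by (simp add: h_def image_image)
    finally show ?thesis by (simp only: g_cover lid_onto hemispheres_cover)
  qed
  ultimately show ?thesis by blast
qed

end

context sphere_gluing
begin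

lemma first_stage:
  assumes "card V = Suc N"
  shows "\<exists>g. ball_stage N 1 g"
proof -
  obtain \<gamma> where "coned_simplex V N \<gamma>" using exists_boundary_sphere[OF finite_V assms] .
  then interpret coned_simplex V N \<gamma> .
  have "exposed 1 0 z \<longleftrightarrow> (\<exists>v\<in>V. z v = 0)" for z
    using nb_neq[OF K_0] by (auto simp: exposed_def Suc_le_eq)
  then have "ball_stage N 1 (\<lambda>_. lid)"
    using continuous_on_lid inj_on_eq_iff[OF inj_on_lid] lid_onto nrm_lid_eq_1_iff
    by (simp add: ball_stage_def lessThan_Suc)
  then show ?thesis by blast
qed

text \<open>
  The two conditions on the numbering single out the last copy, so the induction by attaching stops exactly there.
\<close>

lemma down_eq_V_iff:
  assumes "finite K" "k \<in> K"
  shows "down k = V \<longleftrightarrow> k = Max K"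
proof
  assume "down k = V"
  then have "i \<le> k" if "i \<in> K" for i using later[OF assms(2) that, of V] cls_V[OF that assms(2)] by simp
  then show "k = Max K" using assms by (intro Max_eqI[symmetric]) auto
next
  assume k: "k = Max K"
  have "nb k v < k" if "v \<in> V" for v
    using nb_K[OF assms(2) that] nb_neq[OF assms(2) that] Max_ge[OF assms(1), of "nb k v"] k by simp
  then show "down k = V" by (auto simp: down_def)
qed

theorem glued_sphere:
  assumes fin: "finite K" and N: "card V = Suc N"
  shows "\<exists>h. (\<forall>i\<in>K. continuous_on (closed_simplex V) (h i)) \<and>
     (\<forall>i\<in>K. \<forall>j\<in>K. \<forall>y\<in>closed_simplex V. \<forall>z\<in>closed_simplex V. h i y = h j z \<longleftrightarrow> y = z \<and> same z i j) \<and>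
     (\<Union>i\<in>K. h i ` closed_simplex V) = round_sphere (Suc N)"
proof -
  define k where "k = Max K"
  have kK: "k \<in> K" unfolding k_def using fin K_0 by (intro Max_in) auto
  have max: "i \<le> k" if "i \<in> K" for i using fin that by (simp add: k_def)
  have K_iff: "i \<in> K \<longleftrightarrow> i \<le> k" for i using K_down[OF kK] kK max by (auto simp: le_less)
  note all_iff = down_eq_V_iff[OF fin, folded k_def]
  obtain v where v: "v \<in> V" using V_ne by blast
  have pos: "0 < k" using nb_neq[OF K_0 v] max[OF nb_K[OF K_0 v]] by linarith
  have stages: "Suc m \<le> k \<Longrightarrow> \<exists>g. ball_stage N (Suc m) g" for m
  proof (induction m)
    case 0
    then show ?case using first_stage[OF N] by simp
  next
    case (Suc m)
    then have mK: "Suc m \<in> K" and less: "Suc m \<noteq> k" by (simp_all add: K_iff)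
    from Suc obtain g where "ball_stage N (Suc m) g" by auto
    then interpret gluing_stage V K cls nb N "Suc m" g using mK by unfold_locales simp_all
    show ?case using next_stage all_iff[OF mK] less by blast
  qed
  then obtain g where "ball_stage N k g" using pos by (cases k) auto
  then interpret gluing_stage V K cls nb N k g using kK pos by unfold_locales
  have "K = {..k}" using K_iff by auto
  then show ?thesis using final_stage all_iff[OF kK] unfolding Ball_def by (simp only: atMost_iff)
qed

end

section \<open>Spaces glued from simplices\<close>

lemma openin_discrete_prod:
  "openin (prod_topology (discrete_topology K) Y) U \<longleftrightarrow>
    U \<subseteq> K \<times> topspace Y \<and> (\<forall>k\<in>K. openin Y {y. (k, y) \<in> U})"
proof (intro iffI conjI ballI)
  assume U: "openin (prod_topology (discrete_topology K) Y) U"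
  then show sub: "U \<subseteq> K \<times> topspace Y" using openin_subset by fastforce
  fix k assume "k \<in> K"
  then have "continuous_map Y (prod_topology (discrete_topology K) Y) (\<lambda>y. (k, y))"
    by (intro continuous_map_pairedI) (auto simp: id_def[symmetric])
  from openin_continuous_map_preimage[OF this U] show "openin Y {y. (k, y) \<in> U}"
    using sub by (auto elim!: back_subst[where P="openin Y"])
next
  assume a: "U \<subseteq> K \<times> topspace Y \<and> (\<forall>k\<in>K. openin Y {y. (k, y) \<in> U})"
  have "U = (\<Union>k\<in>K. {k} \<times> {y. (k, y) \<in> U})" using a by auto
  moreover have "openin (prod_topology (discrete_topology K) Y) ({k} \<times> {y. (k, y) \<in> U})" if "k \<in> K" for k
    using a that by (simp add: openin_prod_Times_iff)
  ultimately show "openin (prod_topology (discrete_topology K) Y) U" by (metis (no_types, lifting) openin_Union imageE)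
qed

lemma continuous_map_discrete_prod:
  assumes "\<And>k. k \<in> K \<Longrightarrow> continuous_map Y Z (\<lambda>y. f (k, y))"
  shows "continuous_map (prod_topology (discrete_topology K) Y) Z f"
  unfolding continuous_map_alt
proof (intro conjI allI impI)
  show "f \<in> topspace (prod_topology (discrete_topology K) Y) \<rightarrow> topspace Z"
    using assms by (auto simp: continuous_map_def)
  fix U assume U: "openin Z U"
  have "openin Y {y. (k, y) \<in> f -` U \<inter> topspace (prod_topology (discrete_topology K) Y)}" if "k \<in> K" for k
    using openin_continuous_map_preimage[OF assms[OF that] U] that
    by (auto elim!: back_subst[where P="openin Y"])
  then show "openin (prod_topology (discrete_topology K) Y) (f -` U \<inter> topspace (prod_topology (discrete_topology K) Y))"
    by (auto simp: openin_discrete_prod)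
qed

text \<open>
  A space that carries the quotient topology of the glued copies.
\<close>

locale glued_space = simplicial_gluing V K cls nb
  for V :: "'v set" and K and cls :: "'v set \<Rightarrow> nat \<Rightarrow> 'c" and nb +
  fixes X :: "'p topology" and q :: "nat \<Rightarrow> ('v \<Rightarrow> real) \<Rightarrow> 'p"
  assumes topspace_X: "topspace X = (\<Union>k\<in>K. q k ` closed_simplex V)"
    and openin_X: "\<And>U. U \<subseteq> topspace X \<Longrightarrow>
      openin X U \<longleftrightarrow> (\<forall>k\<in>K. openin (top_of_set (closed_simplex V)) {z \<in> closed_simplex V. q k z \<in> U})"
    and q_eq_iff: "\<And>j k y z. j \<in> K \<Longrightarrow> k \<in> K \<Longrightarrow> y \<in> closed_simplex V \<Longrightarrow> z \<in> closed_simplex V \<Longrightarrow>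
      q j y = q k z \<longleftrightarrow> y = z \<and> same z j k"
begin

abbreviation "simplices \<equiv> prod_topology (discrete_topology K) (top_of_set (closed_simplex V))"

lemma quotient_map_q: "quotient_map simplices X (\<lambda>(k, z). q k z)"
  unfolding quotient_map_def
proof (intro conjI allI impI)
  show "(\<lambda>(k, z). q k z) ` topspace simplices = topspace X" by (auto simp: topspace_X)
  fix U assume U: "U \<subseteq> topspace X"
  show "openin simplices {x \<in> topspace simplices. (case x of (k, z) \<Rightarrow> q k z) \<in> U} = openin X U"
    unfolding openin_X[OF U] openin_discrete_prod
    by (auto cong: conj_cong)
qed

lemma continuous_map_from:
  assumes "\<And>k. k \<in> K \<Longrightarrow> continuous_map (top_of_set (closed_simplex V)) Y (\<lambda>z. f (q k z))"
  shows "continuous_map X Y f"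
  by (rule continuous_compose_quotient_map[OF quotient_map_q])
    (auto intro!: continuous_map_discrete_prod assms)

lemma continuous_map_q: "k \<in> K \<Longrightarrow> continuous_map (top_of_set (closed_simplex V)) X (q k)"
proof -
  assume k: "k \<in> K"
  then have "continuous_map (top_of_set (closed_simplex V)) simplices (\<lambda>y. (k, y))"
    by (intro continuous_map_pairedI) (auto simp: id_def[symmetric])
  from continuous_map_compose[OF this quotient_imp_continuous_map[OF quotient_map_q]]
  show ?thesis by (simp add: o_def)
qed

text \<open>
  The product of a quotient map with the compact interval is again a quotient map. So a homotopy may be checked on
  one copy at a time even if infinitely many copies meet in a point.
\<close>

lemma continuous_map_time_from:
  assumes "\<And>k. k \<in> K \<Longrightarrow> continuous_map (prod_topology (top_of_set {0..1::real}) (top_of_set (closed_simplex V))) Y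
    (\<lambda>(s, z). f (s, q k z))"
  shows "continuous_map (prod_topology (top_of_set {0..1}) X) Y f"
proof -
  let ?I = "top_of_set {0..1::real}" and ?S = "top_of_set (closed_simplex V)"
  have quo: "quotient_map (prod_topology ?I simplices) (prod_topology ?I X) (\<lambda>(s, x). (s, case x of (k, z) \<Rightarrow> q k z))"
    by (rule quotient_map_prod_right[OF _ _ quotient_map_q])
      (auto intro!: compact_imp_locally_compact_space simp: compact_space_def compactin_subtopology Hausdorff_space_subtopology)
  have swap: "continuous_map (prod_topology ?I simplices) (prod_topology (discrete_topology K) (prod_topology ?I ?S))
      (\<lambda>(s, x). (fst x, (s, snd x)))"
    unfolding case_prod_unfold
    using continuous_map_fst_of[OF continuous_map_snd, of "?I" "discrete_topology K" ?S]
      continuous_map_snd_of[OF continuous_map_snd, of "?I" "discrete_topology K" ?S]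
    by (intro continuous_map_pairedI) (simp_all add: o_def continuous_map_fst)
  have "continuous_map (prod_topology (discrete_topology K) (prod_topology ?I ?S)) Y (\<lambda>(k, s, z). f (s, q k z))"
    by (rule continuous_map_discrete_prod) (use assms in \<open>auto simp: case_prod_unfold\<close>)
  from continuous_map_compose[OF swap this]
  have "continuous_map (prod_topology ?I simplices) Y (f \<circ> (\<lambda>(s, x). (s, case x of (k, z) \<Rightarrow> q k z)))"
    by (simp add: o_def case_prod_unfold)
  then show ?thesis by (rule continuous_compose_quotient_map[OF quo])
qed

definition rep :: "'p \<Rightarrow> nat \<times> ('v \<Rightarrow> real)" where
  "rep p = (SOME (k, z). k \<in> K \<and> z \<in> closed_simplex V \<and> q k z = p)"

lemma rep_q:
  assumes "k \<in> K" "z \<in> closed_simplex V"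
  shows "\<exists>j. rep (q k z) = (j, z) \<and> j \<in> K \<and> same z j k"
proof -
  have "case rep (q k z) of (j, y) \<Rightarrow> j \<in> K \<and> y \<in> closed_simplex V \<and> q j y = q k z"
    unfolding rep_def by (rule someI[of _ "(k, z)"]) (use assms in simp)
  then show ?thesis using q_eq_iff[of _ k _ z] assms by (auto split: prod.splits)
qed

end

lemma Hausdorff_space_function: "Hausdorff_space (powertop_real UNIV)"
  by (simp add: Hausdorff_space_product_topology)

lemma unit_sphere_eq: "unit_sphere d = subtopology (powertop_real UNIV) (round_sphere d)"
proof -
  have "{x. \<forall>i\<ge>d. x i = 0} \<inter> {x. (\<Sum>i<d. (x i)\<^sup>2) = 1} = round_sphere d"
    unfolding round_sphere_def nrm_def set_eq_iff by simp
  then show ?thesis by (simp only: unit_sphere_def Euclidean_space_def subtopology_subtopology)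
qed

text \<open>
  The compatible maps of all copies induce a continuous bijection from a compact space to a Hausdorff space.
\<close>

theorem glued_space_sphere:
  assumes "glued_space V K cls nb X q" "sphere_gluing V K cls nb" and fin: "finite K" and N: "card V = Suc N"
  shows "X homeomorphic_space unit_sphere (Suc N)"
proof -
  interpret glued_space V K cls nb X q by fact
  interpret sphere_gluing V K cls nb by fact
  obtain h where h: "(\<forall>i\<in>K. continuous_on (closed_simplex V) (h i)) \<and>
     (\<forall>i\<in>K. \<forall>j\<in>K. \<forall>y\<in>closed_simplex V. \<forall>z\<in>closed_simplex V. h i y = h j z \<longleftrightarrow> y = z \<and> same z i j) \<and>
     (\<Union>i\<in>K. h i ` closed_simplex V) = round_sphere (Suc N)"
    using glued_sphere[OF fin N] by (rule exE)
  note h_cont = h[THEN conjunct1, rule_format] and h_eq = h[THEN conjunct2, THEN conjunct1, rule_format]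
    and h_cover = h[THEN conjunct2, THEN conjunct2]
  define G where "G p = (case rep p of (k, z) \<Rightarrow> h k z)" for p
  have Gq: "G (q k z) = h k z" if "k \<in> K" "z \<in> closed_simplex V" for k z
    using rep_q[OF that] h_eq that by (auto simp: G_def)
  have "homeomorphic_map X (unit_sphere (Suc N)) G"
  proof (rule continuous_imp_homeomorphic_map)
    show "continuous_map X (unit_sphere (Suc N)) G"
    proof (rule continuous_map_from)
      fix k assume k: "k \<in> K"
      have "continuous_map (top_of_set (closed_simplex V)) (unit_sphere (Suc N)) (h k)"
        unfolding unit_sphere_eq euclidean_product_topology
        using h_cont[OF k] h_cover k by auto
      then show "continuous_map (top_of_set (closed_simplex V)) (unit_sphere (Suc N)) (\<lambda>z. G (q k z))"
        by (rule continuous_map_eq) (simp add: Gq k)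
    qed
    have "compact_space (top_of_set (closed_simplex V))"
      using compact_closed_simplex[OF finite_V] by (simp add: compact_space_subtopology)
    then have "compact_space simplices"
      using fin by (simp add: compact_space_prod_topology compact_space_discrete_topology)
    then show "compact_space X"
      unfolding compact_space_def
      using image_compactin[OF _ quotient_imp_continuous_map[OF quotient_map_q]]
        quotient_imp_surjective_map[OF quotient_map_q] by metis
    show "Hausdorff_space (unit_sphere (Suc N))"
      unfolding unit_sphere_eq by (intro Hausdorff_space_subtopology Hausdorff_space_function)
    show "G ` topspace X = topspace (unit_sphere (Suc N))"
      unfolding unit_sphere_eq topspace_X using Gq h_cover by (simp add: image_UN image_image)
    show "inj_on G (topspace X)"
      unfolding topspace_X
    proof (rule inj_onI, clarify)
      fix i y j z
      assume "i \<in> K" "y \<in> closed_simplex V" "j \<in> K" "z \<in> closed_simplex V" "G (q i y) = G (q j z)"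
      then show "q i y = q j z" using Gq h_eq q_eq_iff by simp
    qed
  qed
  then show ?thesis by (rule homeomorphic_map_imp_homeomorphic_space)
qed

section \<open>Contracting an infinite gluing\<close>

lemma contractible_closed_simplex:
  assumes "finite V"
  shows "contractible_space (top_of_set (closed_simplex V))"
proof (cases "closed_simplex V = {}")
  case False
  then obtain c where c: "c \<in> closed_simplex V" by blast
  let ?h = "\<lambda>(t, z). \<lambda>v. (1 - t) * z v + t * c v"
  have "homotopic_with (\<lambda>x. True) (top_of_set (closed_simplex V)) (top_of_set (closed_simplex V)) id (\<lambda>x. c)"
    unfolding homotopic_with_def
  proof (intro exI[of _ ?h] conjI allI ballI)
    have "continuous_on ({0..1} \<times> closed_simplex V) ?h"
      unfolding case_prod_unfold
      by (intro continuous_on_coordinatewise_then_product continuous_intros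
          continuous_on_product_then_coordinatewise[OF continuous_on_snd[OF continuous_on_id]])
    moreover have "?h (t, z) \<in> closed_simplex V" if "t \<in> {0..1}" "z \<in> closed_simplex V" for t z
      using that c by (simp add: closed_simplex_def sum.distrib flip: sum_distrib_left)
    ultimately show "continuous_map (prod_topology (top_of_set {0..1}) (top_of_set (closed_simplex V)))
        (top_of_set (closed_simplex V)) ?h"
      by auto
  qed auto
  then show ?thesis unfolding contractible_space_def by blast
next
  case True
  then show ?thesis by (simp add: contractible_space_empty)
qed

text \<open>
  No copy has all its facets shared with earlier ones, so every copy after the first has a direction in which
  it can be pushed into earlier ones.
\<close>

locale noncompact_gluing = glued_space V K cls nb X q
  for V :: "'v set" and K and cls :: "'v set \<Rightarrow> nat \<Rightarrow> 'c" and nb and X :: "'p topology" and q +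
  assumes down_proper: "\<And>k. k \<in> K \<Longrightarrow> down k \<noteq> V"
begin

abbreviation "exit_time k \<equiv> scaled_min (down k)"

abbreviation "exit_point k \<equiv> retract V (down k)"

definition "next_cell k z = nb k (SOME d. d \<in> down k \<and> exit_point k z d = 0)"

text \<open>
  A point of copy \<open>k\<close> is pushed until it reaches a facet shared with an earlier copy and then continues its way
  there. The motion comes to rest in copy \<open>0\<close> since the numbers of the copies decrease. The condition on
  \<open>next_cell\<close> holds for all points of the simplex; it makes the recursion terminate for other arguments.
\<close>

function flow :: "nat \<Rightarrow> ('v \<Rightarrow> real) \<Rightarrow> real \<Rightarrow> 'p" where
  "flow k z t =
     (if k = 0 then q 0 z
      else if t \<le> exit_time k z \<or> \<not> next_cell k z < k then q k (push V (down k) t z)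
      else flow (next_cell k z) (exit_point k z) (t - exit_time k z))"
  by pat_completeness auto
termination by (relation "Wellfounded.measure (\<lambda>(k, z, t). k)") auto

declare flow.simps [simp del]

lemma flow_0 [simp]: "flow 0 z t = q 0 z"
  by (simp add: flow.simps)

lemma split_down: "k \<in> K \<Longrightarrow> 0 < k \<Longrightarrow> split_simplex V (down k)"
  using finite_V down_subset down_proper down_ne by unfold_locales auto

lemma exit_time_bounds:
  assumes "k \<in> K" "0 < k" "z \<in> closed_simplex V"
  shows "0 \<le> exit_time k z" "exit_time k z \<le> 1"
  using scaled_min_bounds[OF finite_V down_subset down_ne[OF assms(1,2)] assms(3)] by auto

lemma exit_facet:
  assumes k: "k \<in> K" "0 < k" and z: "z \<in> closed_simplex V" and d: "d \<in> down k" "exit_point k z d = 0"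
  shows "nb k d < k" "nb k d \<in> K" "same (exit_point k z) (nb k d) k"
    "q (nb k d) (exit_point k z) = q k (exit_point k z)"
proof -
  interpret split_simplex V "down k" using split_down k .
  show lt: "nb k d < k" using d by (simp add: down_def)
  then show K: "nb k d \<in> K" using K_down k by blast
  show "same (exit_point k z) (nb k d) k" using same_nb[of k d] k d down_subset by blast
  then show "q (nb k d) (exit_point k z) = q k (exit_point k z)"
    using q_eq_iff[OF K k(1)] retract_in_simplex[OF z] by simp
qed

lemma next_cell:
  assumes k: "k \<in> K" "0 < k" and z: "z \<in> closed_simplex V"
  shows "\<exists>d\<in>down k. exit_point k z d = 0 \<and> next_cell k z = nb k d"
proof -
  interpret split_simplex V "down k" using split_down k .
  have "\<exists>d. d \<in> down k \<and> exit_point k z d = 0" using retract_zero[OF z] by blast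
  then have "(SOME d. d \<in> down k \<and> exit_point k z d = 0) \<in> down k \<and>
      exit_point k z (SOME d. d \<in> down k \<and> exit_point k z d = 0) = 0" by (rule someI_ex)
  then show ?thesis by (auto simp: next_cell_def)
qed

lemma exit_in_simplex: "k \<in> K \<Longrightarrow> 0 < k \<Longrightarrow> z \<in> closed_simplex V \<Longrightarrow> exit_point k z \<in> closed_simplex V"
  using split_simplex.retract_in_simplex split_down by blast

lemma flow_early:
  assumes "k \<in> K" "0 < k" "t \<le> exit_time k z"
  shows "flow k z t = q k (push V (down k) t z)"
  using assms by (simp add: flow.simps)

lemma flow_start: "k \<in> K \<Longrightarrow> z \<in> closed_simplex V \<Longrightarrow> flow k z 0 = q k z"
  using flow_early[of k 0 z] exit_time_bounds(1)[of k z] by (cases "k = 0") auto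

lemma flow_late:
  assumes k: "k \<in> K" "0 < k" and z: "z \<in> closed_simplex V" and t: "exit_time k z < t"
  shows "flow k z t = flow (next_cell k z) (exit_point k z) (t - exit_time k z)"
proof -
  have "next_cell k z < k" using next_cell[OF k z] exit_facet(1)[OF k z] by auto
  then show ?thesis using k t by (subst flow.simps) simp
qed

text \<open>
  A point of copy \<open>k\<close> that also lies in an earlier copy has exit time \<open>0\<close> and is handed on at once, until the earliest
  copy containing it is reached. So the flow does not depend on the copy in which the point is given.
\<close>

lemma flow_same_less:
  "k \<in> K \<Longrightarrow> i < k \<Longrightarrow> z \<in> closed_simplex V \<Longrightarrow> same z i k \<Longrightarrow> 0 \<le> t \<Longrightarrow> flow i z t = flow k z t"
proof (induction k arbitrary: i rule: less_induct)
  case (less k)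
  have k: "0 < k" using less.prems by simp
  have iK: "i \<in> K" using less.prems K_down by blast
  interpret split_simplex V "down k" using split_down less.prems k by blast
  obtain d where d: "d \<in> down k" "z d = 0" using same_earlier less.prems by blast
  have m0: "exit_time k z = 0" and r: "exit_point k z = z"
    using scaled_min_eq_0_iff[OF finite_V down_subset D_ne] retract_eq_self[of z d] d less.prems by auto
  show ?case
  proof (cases "t = 0")
    case True
    then show ?thesis using flow_start less.prems iK q_eq_iff by simp
  next
    case False
    then have fl: "flow k z t = flow (next_cell k z) z t"
      using flow_late[OF less.prems(1) k less.prems(3), of t] m0 r less.prems(5) by simp
    obtain e where e: "e \<in> down k" "z e = 0" "next_cell k z = nb k e"
      using next_cell[OF less.prems(1) k less.prems(3)] r by auto
    let ?j = "next_cell k z"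
    have j: "?j < k" "?j \<in> K" "same z ?j k"
      using exit_facet[OF less.prems(1) k less.prems(3) e(1)] e r by auto
    consider "i < ?j" | "i = ?j" | "?j < i" by linarith
    then have "flow i z t = flow ?j z t"
    proof cases
      case 1
      then show ?thesis using less.IH[OF j(1,2) 1] j less.prems by simp
    next
      case 3
      then show ?thesis using less.IH[OF less.prems(2) iK 3] j less.prems by simp
    qed simp
    then show ?thesis using fl by simp
  qed
qed

lemma flow_same:
  assumes "i \<in> K" "k \<in> K" "z \<in> closed_simplex V" "same z i k" "0 \<le> t"
  shows "flow i z t = flow k z t"
proof (cases i k rule: linorder_cases)
  case less
  then show ?thesis using flow_same_less assms by blast
next
  case greater
  then show ?thesis using flow_same_less[OF assms(1) _ assms(3) assms(4)[symmetric] assms(5)] by simp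
qed simp

lemma flow_after:
  assumes k: "k \<in> K" "0 < k" and z: "z \<in> closed_simplex V" and t: "exit_time k z \<le> t"
    and d: "d \<in> down k" "exit_point k z d = 0"
  shows "flow k z t = flow (nb k d) (exit_point k z) (t - exit_time k z)"
proof (cases "t = exit_time k z")
  case True
  note f = exit_facet[OF k z d] and r = exit_in_simplex[OF k z]
  have "flow k z t = q k (exit_point k z)"
    unfolding retract_def True by (rule flow_early[OF k order_refl])
  also have "\<dots> = flow (nb k d) (exit_point k z) 0"
    unfolding flow_start[OF f(2) r] by (rule f(4)[symmetric])
  finally show ?thesis unfolding True by (simp only: diff_self)
next
  case False
  obtain e where e: "e \<in> down k" "exit_point k z e = 0" "next_cell k z = nb k e"
    using next_cell[OF k z] by blast
  have "flow k z t = flow (nb k e) (exit_point k z) (t - exit_time k z)"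
    using flow_late[OF k z, of t] False t e by simp
  also have "\<dots> = flow (nb k d) (exit_point k z) (t - exit_time k z)"
    using exit_facet[OF k z d] exit_facet[OF k z e(1,2)] exit_in_simplex[OF k z] t
    by (intro flow_same) auto
  finally show ?thesis .
qed

text \<open>
  Every passage through a copy takes time at most \<open>1\<close> and leads to a smaller number.
\<close>

lemma flow_stops:
  "k \<in> K \<Longrightarrow> z \<in> closed_simplex V \<Longrightarrow> real k \<le> t \<Longrightarrow>
    flow k z t = flow k z (real k) \<and> flow k z t \<in> q 0 ` closed_simplex V"
proof (induction k arbitrary: z t rule: less_induct)
  case (less k)
  show ?case
  proof (cases "k = 0")
    case True
    show ?thesis unfolding True flow_0 using less.prems(2) by simp
  next
    case False
    then have k: "k \<in> K" "0 < k" using less.prems by auto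
    obtain d where d: "d \<in> down k" "exit_point k z d = 0" using next_cell[OF k less.prems(2)] by blast
    note f = exit_facet[OF k less.prems(2) d] and r = exit_in_simplex[OF k less.prems(2)]
    have m: "exit_time k z \<le> 1" using exit_time_bounds[OF k less.prems(2)] by simp
    have jk: "real (nb k d) + 1 \<le> real k" using f(1) by linarith
    have after: "flow k z t' = flow (nb k d) (exit_point k z) (real (nb k d)) \<and> flow k z t' \<in> q 0 ` closed_simplex V"
      if "real k \<le> t'" for t'
    proof -
      have "flow k z t' = flow (nb k d) (exit_point k z) (t' - exit_time k z)"
        using flow_after[OF k less.prems(2) _ d, of t'] m jk that by simp
      moreover have "real (nb k d) \<le> t' - exit_time k z" using m jk that by linarith
      ultimately show ?thesis using less.IH[OF f(1,2) r] by metis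
    qed
    show ?thesis using after[OF less.prems(3)] after[of "real k"] by (metis order_refl)
  qed
qed

lemma continuous_on_exit_time: "k \<in> K \<Longrightarrow> 0 < k \<Longrightarrow> continuous_on A (exit_time k)"
  by (intro continuous_on_scaled_min finite_subset[OF down_subset finite_V] down_ne)

text \<open>
  Over copy \<open>k\<close>, the pairs of a time and a point form finitely many closed pieces: the times up to the exit, and
  for each shared facet the times after an exit through that facet, where the induction hypothesis applies.
\<close>

lemma continuous_map_flow:
  "k \<in> K \<Longrightarrow> continuous_map (top_of_set ({0..} \<times> closed_simplex V)) X (\<lambda>(t, z). flow k z t)"
proof (induction k rule: less_induct)
  case (less k)
  let ?P = "{0..} \<times> closed_simplex V :: (real \<times> ('v \<Rightarrow> real)) set"
  show ?case
  proof (cases "k = 0")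
    case True
    have "continuous_map (top_of_set ?P) X (q 0 \<circ> snd)"
      by (rule continuous_map_compose[OF _ continuous_map_q[OF K_0]]) (auto intro: continuous_intros)
    then show ?thesis using True by (simp add: o_def case_prod_unfold)
  next
    case False
    then have k: "k \<in> K" "0 < k" using less.prems by auto
    interpret split_simplex V "down k" using split_down k .
    have time_cont: "continuous_on Q (\<lambda>p. exit_time k (snd p))"
      and point_cont: "continuous_on Q (\<lambda>p. exit_point k (snd p))" for Q :: "(real \<times> ('v \<Rightarrow> real)) set"
      by (rule continuous_on_compose2[OF continuous_on_exit_time[OF k, of UNIV]]
          continuous_on_compose2[OF continuous_on_retract[of UNIV]];
          simp add: continuous_on_snd[OF continuous_on_id])+
    define A where "A c = (case c of None \<Rightarrow> {p \<in> ?P. fst p \<le> exit_time k (snd p)}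
      | Some d \<Rightarrow> {p \<in> ?P. exit_time k (snd p) \<le> fst p \<and> exit_point k (snd p) d = 0})" for c
    define f where "f c = (\<lambda>p. case c of None \<Rightarrow> q k (push V (down k) (fst p) (snd p))
      | Some d \<Rightarrow> flow (nb k d) (exit_point k (snd p)) (fst p - exit_time k (snd p)))" for c
    have f_flow: "f c p = flow k (snd p) (fst p)" if "c \<in> insert None (Some ` down k)" "p \<in> A c" for c p
      using that flow_early[OF k, of "fst p" "snd p"] flow_after[OF k, of "snd p" "fst p"]
      by (auto simp: f_def A_def split: option.splits)
    show ?thesis
    proof (rule pasting_lemma_closed[where I="insert None (Some ` down k)" and T=A and f=f])
      show "finite (insert None (Some ` down k))" using finite_D by simp
      show "closedin (top_of_set ?P) (A c)" if c: "c \<in> insert None (Some ` down k)" for c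
      proof (cases c)
        case None
        have "A c = ?P \<inter> {p. fst p \<le> exit_time k (snd p)}" using None by (auto simp: A_def)
        moreover have "closed {p. fst p \<le> exit_time k (snd p)}"
          by (intro closed_Collect_le continuous_on_fst continuous_on_id time_cont)
        ultimately show ?thesis by (simp add: closedin_closed_Int)
      next
        case (Some d)
        have "A c = ?P \<inter> {p. exit_time k (snd p) \<le> fst p \<and> exit_point k (snd p) d = 0}" using Some by (auto simp: A_def)
        moreover have "continuous_on UNIV (\<lambda>p::real \<times> ('v \<Rightarrow> real). exit_point k (snd p) d)"
          by (rule continuous_on_product_then_coordinatewise[OF point_cont])
        then have "closed {p. exit_time k (snd p) \<le> fst p \<and> exit_point k (snd p) d = 0}"
          by (intro closed_Collect_conj closed_Collect_le closed_Collect_eq continuous_on_fst continuous_on_id time_cont continuous_on_const)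
        ultimately show ?thesis by (simp add: closedin_closed_Int)
      qed
      show "continuous_map (subtopology (top_of_set ?P) (A c)) X (f c)" if c: "c \<in> insert None (Some ` down k)" for c
      proof (cases c)
        case None
        have "continuous_on (?P \<inter> A c) (\<lambda>p. push V (down k) (fst p) (snd p))"
          by (intro continuous_on_push continuous_intros)
        moreover have "push V (down k) (fst p) (snd p) \<in> closed_simplex V" if "p \<in> ?P \<inter> A c" for p
        proof (rule push_in_simplex)
          have "0 \<le> scaled_min (V - down k) (snd p)"
            using scaled_min_bounds(1)[OF finite_V Diff_subset co_ne, of "snd p"] that by auto
          then show "- fst p \<le> scaled_min (V - down k) (snd p)" using that by auto
        qed (use that None in \<open>auto simp: A_def\<close>)
        ultimately have "continuous_map (top_of_set (?P \<inter> A c)) (top_of_set (closed_simplex V)) (\<lambda>p. push V (down k) (fst p) (snd p))"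
          by auto
        from continuous_map_compose[OF this continuous_map_q[OF k(1)]]
        show ?thesis using None by (simp add: f_def o_def subtopology_subtopology)
      next
        case (Some d)
        have d: "d \<in> down k" using c Some by auto
        then have j: "nb k d < k" "nb k d \<in> K" using K_down[OF k(1)] by (auto simp: down_def)
        have "continuous_on (?P \<inter> A c) (\<lambda>p. (fst p - exit_time k (snd p), exit_point k (snd p)))"
          by (intro continuous_on_Pair continuous_on_diff continuous_on_fst continuous_on_id
              time_cont point_cont)
        then have "continuous_map (top_of_set (?P \<inter> A c)) (top_of_set ?P) (\<lambda>p. (fst p - exit_time k (snd p), exit_point k (snd p)))"
          using Some retract_in_simplex by (auto simp: A_def)
        from continuous_map_compose[OF this less.IH[OF j]]
        show ?thesis using Some by (simp add: f_def o_def subtopology_subtopology)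
      qed
      show "f c p = f c' p" if "c \<in> insert None (Some ` down k)" "c' \<in> insert None (Some ` down k)"
        "p \<in> topspace (top_of_set ?P) \<inter> A c \<inter> A c'" for c c' p
        using f_flow[of c p] f_flow[of c' p] that by simp
      show "\<exists>c. c \<in> insert None (Some ` down k) \<and> p \<in> A c \<and> (case p of (t, z) \<Rightarrow> flow k z t) = f c p"
        if "p \<in> topspace (top_of_set ?P)" for p
      proof (cases "fst p \<le> exit_time k (snd p)")
        case True
        then have "p \<in> A None" using that by (auto simp: A_def)
        then show ?thesis using f_flow[of None p] by (auto simp: case_prod_unfold)
      next
        case False
        moreover have "snd p \<in> closed_simplex V" using that by auto
        ultimately obtain d where "d \<in> down k" "exit_point k (snd p) d = 0" using retract_zero by blast
        then have "p \<in> A (Some d)" "Some d \<in> insert None (Some ` down k)" using that False by (auto simp: A_def)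
        then show ?thesis using f_flow[of "Some d" p] by (auto simp: case_prod_unfold)
      qed
    qed
  qed
qed

text \<open>
  The parameter change \<open>s / (1 - s)\<close> from \<open>[0, 1]\<close> to \<open>[0, \<infinity>]\<close>, cut off at the value \<open>k + 1\<close> to be continuous at
  \<open>s = 1\<close>. The flow in copy \<open>k\<close> rests from time \<open>k\<close> on, so the cut has no influence on it.
\<close>

definition clock :: "nat \<Rightarrow> real \<Rightarrow> real" where
  "clock k s = s / max (1 - s) (s / real (Suc k))"

lemma clock_denom: "s \<in> {0..1} \<Longrightarrow> 0 < max (1 - s) (s / real (Suc k))"
  by (cases "s = 1") auto

lemma clock_bounds: "s \<in> {0..1} \<Longrightarrow> 0 \<le> clock k s \<and> clock k s \<le> real (Suc k)"
proof -
  assume s: "s \<in> {0..1}"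
  have "s = real (Suc k) * (s / real (Suc k))" by simp
  also have "\<dots> \<le> real (Suc k) * max (1 - s) (s / real (Suc k))" by (intro mult_left_mono) auto
  finally show ?thesis
    using clock_denom[OF s, of k] s unfolding clock_def by (simp add: pos_divide_le_eq)
qed

lemma clock_mono_cases:
  assumes "s \<in> {0..1}" "k \<le> j"
  shows "clock k s = clock j s \<or> (clock k s = real (Suc k) \<and> clock k s \<le> clock j s)"
proof (cases "s / real (Suc k) \<le> 1 - s")
  case True
  moreover have "s / real (Suc j) \<le> s / real (Suc k)" using assms by (intro divide_left_mono) auto
  ultimately have "max (1 - s) (s / real (Suc k)) = 1 - s" "max (1 - s) (s / real (Suc j)) = 1 - s"
    by linarith+
  then show ?thesis unfolding clock_def by simp
next
  case False
  then have s: "0 < s" using assms by (cases "s = 0") auto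
  have le: "s / real (Suc j) \<le> s / real (Suc k)" using assms by (intro divide_left_mono) auto
  have "clock k s = real (Suc k)" using False s by (simp add: clock_def max_def)
  moreover have "clock k s \<le> clock j s"
    unfolding clock_def using s le clock_denom[OF assms(1), of j] clock_denom[OF assms(1), of k]
    by (intro divide_left_mono) auto
  ultimately show ?thesis by simp
qed

lemma flow_clock_same:
  assumes s: "s \<in> {0..1}" and K: "j \<in> K" "k \<in> K" and z: "z \<in> closed_simplex V" and same: "same z j k"
  shows "flow j z (clock j s) = flow k z (clock k s)"
proof -
  have le: "flow j z (clock j s) = flow k z (clock k s)"
    if "k \<le> j" "j \<in> K" "k \<in> K" "same z j k" for j k
  proof -
    have "flow k z (clock k s) = flow k z (clock j s)"
      using clock_mono_cases[OF s that(1)]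
    proof
      assume "clock k s = real (Suc k) \<and> clock k s \<le> clock j s"
      then show ?thesis using flow_stops[OF that(3) z, of "clock k s"] flow_stops[OF that(3) z, of "clock j s"] by simp
    qed simp
    then show ?thesis using flow_same[OF that(2,3) z that(4)] clock_bounds[OF s] by simp
  qed
  show ?thesis using le[of k j] le[of j k] K same by (cases "k \<le> j") auto
qed

text \<open>
  The flow deforms the identity to a map into copy \<open>0\<close>. As barycentric coordinates are well defined on the whole
  space, this map factors through a simplex.
\<close>

theorem contractible: "contractible_space X"
proof -
  define h where "h = (\<lambda>(s, p). case rep p of (k, z) \<Rightarrow> flow k z (clock k s))"
  have h_q: "h (s, q k z) = flow k z (clock k s)" if "k \<in> K" "z \<in> closed_simplex V" "s \<in> {0..1}" for k z s
    using rep_q[OF that(1,2)] flow_clock_same[OF that(3) _ that(1,2)] by (auto simp: h_def)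
  have h_cont: "continuous_map (prod_topology (top_of_set {0..1}) X) X h"
  proof (rule continuous_map_time_from)
    fix k assume k: "k \<in> K"
    have "continuous_on ({0..1} \<times> closed_simplex V) (\<lambda>p. (clock k (fst p), snd p))"
    proof -
      have "max (1 - fst p) (fst p / real (Suc k)) \<noteq> 0" if "p \<in> {0..1} \<times> closed_simplex V" for p :: "real \<times> ('v \<Rightarrow> real)"
        using clock_denom[of "fst p" k] that by auto
      then show ?thesis unfolding clock_def by (intro continuous_intros) auto
    qed
    then have "continuous_map (top_of_set ({0..1} \<times> closed_simplex V)) (top_of_set ({0..} \<times> closed_simplex V))
        (\<lambda>p. (clock k (fst p), snd p))"
      using clock_bounds by auto
    from continuous_map_compose[OF this continuous_map_flow[OF k]]
    have "continuous_map (prod_topology (top_of_set {0..1}) (top_of_set (closed_simplex V))) X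
        (\<lambda>p. flow k (snd p) (clock k (fst p)))"
      by (simp add: o_def)
    then show "continuous_map (prod_topology (top_of_set {0..1}) (top_of_set (closed_simplex V))) X (\<lambda>(s, z). h (s, q k z))"
      by (rule continuous_map_eq) (use h_q k in auto)
  qed
  define R where "R p = h (1, p)" for p
  have hom: "homotopic_with (\<lambda>_. True) X X id R"
  proof (subst homotopic_with, simp, intro exI[of _ h] conjI ballI TrueI)
    fix p assume "p \<in> topspace X"
    then obtain k z where "k \<in> K" "z \<in> closed_simplex V" "p = q k z" unfolding topspace_X by blast
    then show "h (0, p) = id p" using h_q[of k z 0] flow_start by (simp add: clock_def)
  qed (simp_all add: R_def h_cont)
  define coord where "coord p = snd (rep p)" for p
  have coord_q: "coord (q k z) = z" if "k \<in> K" "z \<in> closed_simplex V" for k z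
    using rep_q[OF that] by (auto simp: coord_def)
  have coord_cont: "continuous_map X (top_of_set (closed_simplex V)) coord"
    by (rule continuous_map_from, rule continuous_map_eq[OF continuous_map_id[unfolded id_def]])
      (simp add: coord_q)
  have R: "q 0 (coord (R p)) = R p" if "p \<in> topspace X" for p
  proof -
    obtain k z where p: "k \<in> K" "z \<in> closed_simplex V" "p = q k z" using \<open>p \<in> topspace X\<close> unfolding topspace_X by blast
    have "R p = flow k z (real (Suc k))" using h_q[OF p(1,2), of 1] p(3) by (simp add: R_def clock_def)
    then obtain y where "y \<in> closed_simplex V" "R p = q 0 y" using flow_stops[OF p(1,2), of "real (Suc k)"] by auto
    then show ?thesis using coord_q[OF K_0] by simp
  qed
  have "continuous_map X (top_of_set (closed_simplex V)) (coord \<circ> R)"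
    using continuous_map_compose[OF _ coord_cont] homotopic_with_imp_continuous_maps[OF hom] by blast
  then obtain c where "homotopic_with (\<lambda>_. True) X X (q 0 \<circ> (coord \<circ> R)) (\<lambda>_. c)"
    using nullhomotopic_through_contractible_space[OF _ continuous_map_q[OF K_0] contractible_closed_simplex[OF finite_V]]
    by blast
  then have "homotopic_with (\<lambda>_. True) X X R (\<lambda>_. c)"
    by (rule homotopic_with_eq) (simp_all add: R)
  with hom show ?thesis unfolding contractible_space_def using homotopic_with_trans by blast
qed

end

section \<open>Words and reflections\<close>

locale coxeter = group W for W :: "('a, 'b) monoid_scheme" (structure) +
  fixes S :: "'a set" and m :: "'a \<Rightarrow> 'a \<Rightarrow> enat"
  assumes S_carrier: "S \<subseteq> carrier W" and gen_S: "generate W S = carrier W"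
    and matrix: "coxeter_matrix S m"
    and presentation: "\<And>u v. u \<in> lists S \<Longrightarrow> v \<in> lists S \<Longrightarrow> word_prod W u = word_prod W v \<longleftrightarrow> coxeter_cong S m u v"
begin

abbreviation "wp \<equiv> word_prod W"
abbreviation "lg \<equiv> len W S"

lemma S_in [simp]: "s \<in> S \<Longrightarrow> s \<in> carrier W"
  using S_carrier by blast

lemma wp_Nil [simp]: "wp [] = \<one>" and wp_Cons [simp]: "wp (s # u) = s \<otimes> wp u"
  by (simp_all add: word_prod_def)

lemma wp_closed [simp]: "u \<in> lists S \<Longrightarrow> wp u \<in> carrier W"
  by (induction u) auto

lemma wp_append: "u \<in> lists S \<Longrightarrow> v \<in> lists S \<Longrightarrow> wp (u @ v) = wp u \<otimes> wp v"
  by (induction u) (auto simp: m_assoc)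

lemma lists_mono_S: "I \<subseteq> S \<Longrightarrow> u \<in> lists I \<Longrightarrow> u \<in> lists S"
  using lists_mono by blast

lemma cong_lists: "coxeter_cong S m u v \<Longrightarrow> u \<in> lists S \<longleftrightarrow> v \<in> lists S"
  by (induction rule: coxeter_cong.induct) (auto simp: in_lists_conv_set)

lemma cong_parity: "coxeter_cong S m u v \<Longrightarrow> even (length u) = even (length v)"
  by (induction rule: coxeter_cong.induct) (auto simp: length_concat sum_list_replicate)

lemma wp_parity: "u \<in> lists S \<Longrightarrow> v \<in> lists S \<Longrightarrow> wp u = wp v \<Longrightarrow> even (length u) = even (length v)"
  using presentation cong_parity by blast

lemma square [simp]: "s \<in> S \<Longrightarrow> s \<otimes> s = \<one>"
proof -
  assume s: "s \<in> S"
  then have "m s s = enat 1" using matrix by (simp add: coxeter_matrix_def one_enat_def)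
  from coxeter_cong.relator[where u="[]" and v="[]" and m=m, OF s s this]
  have "wp [s, s] = wp []" using presentation[of "[s, s]" "[]"] s by simp
  then show ?thesis using s by simp
qed

lemma inv_S [simp]: "s \<in> S \<Longrightarrow> inv s = s"
  by (simp add: inv_equality)

lemma cancel_S [simp]: "s \<in> S \<Longrightarrow> x \<in> carrier W \<Longrightarrow> s \<otimes> (s \<otimes> x) = x"
  by (simp flip: m_assoc)

lemma cancel_S_right [simp]: "s \<in> S \<Longrightarrow> x \<in> carrier W \<Longrightarrow> x \<otimes> s \<otimes> s = x"
  by (simp add: m_assoc)

lemma wp_rev: "u \<in> lists S \<Longrightarrow> wp (rev u) = inv (wp u)"
proof (induction u)
  case (Cons s u)
  then have "rev u \<in> lists S" "[s] \<in> lists S" by (auto simp: in_lists_conv_set)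
  then show ?case using Cons by (simp add: wp_append inv_mult_group)
qed simp

lemma generate_eq_words:
  assumes "I \<subseteq> S"
  shows "generate W I = wp ` lists I"
proof
  show "generate W I \<subseteq> wp ` lists I"
  proof
    fix x assume "x \<in> generate W I"
    then show "x \<in> wp ` lists I"
    proof (induction rule: generate.induct)
      case one
      show ?case by (rule image_eqI[of _ _ "[]"]) auto
    next
      case (incl h)
      then show ?case using assms by (intro image_eqI[of _ _ "[h]"]) auto
    next
      case (inv h)
      then show ?case using assms by (intro image_eqI[of _ _ "[h]"]) auto
    next
      case (eng h1 h2)
      then obtain u v where "u \<in> lists I" "v \<in> lists I" "h1 = wp u" "h2 = wp v" by blast
      then show ?case
        using wp_append lists_mono_S[OF assms] by (intro image_eqI[of _ _ "u @ v"]) auto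
    qed
  qed
  have "wp u \<in> generate W I" if "u \<in> lists I" for u
    using that by (induction u) (auto intro: generate.intros)
  then show "wp ` lists I \<subseteq> generate W I" by blast
qed

lemma carrier_words: "carrier W = wp ` lists S"
  using generate_eq_words[of S] gen_S by simp

text \<open>
  For the word \<open>s\<^sub>1 \<dots> s\<^sub>k\<close> these are the elements \<open>s\<^sub>1 \<dots> s\<^sub>i \<dots> s\<^sub>1\<close> for \<open>i = 1, \<dots>, k\<close>.
\<close>

primrec reflections :: "'a list \<Rightarrow> 'a list" where
  "reflections [] = []"
| "reflections (s # u) = s # map (\<lambda>t. s \<otimes> t \<otimes> s) (reflections u)"

lemma reflections_carrier: "u \<in> lists S \<Longrightarrow> t \<in> set (reflections u) \<Longrightarrow> t \<in> carrier W"
  by (induction u arbitrary: t) auto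

lemma reflections_append:
  assumes "u \<in> lists S" "v \<in> lists S"
  shows "reflections (u @ v) = reflections u @ map (\<lambda>t. wp u \<otimes> t \<otimes> inv (wp u)) (reflections v)"
  using assms(1)
proof (induction u)
  case Nil
  then show ?case using reflections_carrier[OF assms(2)] by (auto intro!: map_idI[symmetric])
next
  case (Cons s u)
  then show ?case
    using reflections_carrier[OF assms(2)] by (auto simp: inv_mult_group m_assoc)
qed

lemma relator_power:
  "s \<in> S \<Longrightarrow> t \<in> S \<Longrightarrow> wp (concat (replicate k [s, t])) = (s \<otimes> t) [^] k"
proof (induction k)
  case (Suc k)
  then have "wp (concat (replicate (Suc k) [s, t])) = (s \<otimes> t) \<otimes> (s \<otimes> t) [^] k" by (simp add: m_assoc)
  then show ?case using nat_pow_Suc2[of "s \<otimes> t" k] Suc by simp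
qed simp

text \<open>
  If \<open>(s t)\<^sup>k = 1\<close>, the right-hand side repeats with period \<open>k\<close> and every reflection occurs an even number of
  times. So relators do not affect the parities.
\<close>

lemma reflections_relator:
  assumes s: "s \<in> S" and t: "t \<in> S"
  shows "reflections (concat (replicate k [s, t])) = map (\<lambda>j. (s \<otimes> t) [^] j \<otimes> s) [0..<2 * k]"
proof (induction k)
  case (Suc k)
  let ?f = "\<lambda>j. (s \<otimes> t) [^] (j::nat) \<otimes> s"
  have st: "s \<in> carrier W" "t \<in> carrier W" using s t by auto
  have conj: "s \<otimes> (t \<otimes> ?f j \<otimes> t) \<otimes> s = ?f (j + 2)" for j
  proof -
    have "s \<otimes> (t \<otimes> ?f j \<otimes> t) \<otimes> s = (s \<otimes> t) \<otimes> (s \<otimes> t) [^] j \<otimes> (s \<otimes> t) \<otimes> s"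
      using st by (simp add: m_assoc)
    also have "\<dots> = ?f (j + 2)" using st nat_pow_Suc2[of "s \<otimes> t" j] by (simp add: numeral_2_eq_2)
    finally show ?thesis .
  qed
  have "reflections (concat (replicate (Suc k) [s, t])) = ?f 0 # ?f 1 # map (\<lambda>j. ?f (j + 2)) [0..<2 * k]"
    using st s t by (simp add: Suc conj o_def)
  also have "map (\<lambda>j. ?f (j + 2)) [0..<2 * k] = map ?f (map (\<lambda>j. j + 2) [0..<2 * k])"
    by (simp only: map_map o_def)
  also have "map (\<lambda>j. j + 2) [0..<2 * k] = [2..<2 * Suc k]"
    by (simp only: map_add_upt) simp
  also have "?f 0 # ?f 1 # map ?f [2..<2 * Suc k] = map ?f (0 # 1 # [2..<2 * Suc k])"
    by (simp only: list.map)
  also have "0 # 1 # [2..<2 * Suc k] = [0..<2 * Suc k]"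
    using upt_conv_Cons[of 0 "2 * Suc k"] upt_conv_Cons[of 1 "2 * Suc k"] by (simp add: numeral_2_eq_2)
  finally show ?case .
qed simp

lemma count_map_double: "even (count_list (map g (L @ L)) x)"
  by (simp add: count_list_append)

lemma reflections_relator_even:
  assumes s: "s \<in> S" and t: "t \<in> S" and k: "(s \<otimes> t) [^] k = \<one>"
  shows "even (count_list (map g (reflections (concat (replicate k [s, t])))) x)"
proof -
  let ?f = "\<lambda>j. (s \<otimes> t) [^] (j::nat) \<otimes> s"
  have st: "s \<in> carrier W" "t \<in> carrier W" using s t by auto
  have "map ?f [k..<2 * k] = map ?f [0..<k]"
  proof -
    have "[k..<2 * k] = map (\<lambda>j. j + k) [0..<k]" by (simp add: map_add_upt mult_2)
    moreover have "?f (j + k) = ?f j" for j using st k by (simp flip: nat_pow_mult)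
    ultimately show ?thesis by simp
  qed
  moreover have "[0..<2 * k] = [0..<k] @ [k..<2 * k]" using upt_add_eq_append[of 0 k k] by (simp add: mult_2)
  ultimately have "reflections (concat (replicate k [s, t])) = map ?f [0..<k] @ map ?f [0..<k]"
    by (simp add: reflections_relator[OF s t])
  then show ?thesis by (simp only: count_map_double)
qed

text \<open>
  A relator contributes each of its reflections, conjugated by the preceding part \<open>u\<close> of the word, an even number of
  times; and since its product is \<open>1\<close>, the reflections of the part \<open>v\<close> after it do not change.
\<close>

lemma cong_reflections:
  "coxeter_cong S m u v \<Longrightarrow> u \<in> lists S \<Longrightarrow> even (count_list (reflections u) x) = even (count_list (reflections v) x)"
proof (induction rule: coxeter_cong.induct)
  case (relator s t k u v)
  let ?r = "concat (replicate k [s, t])"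
  have r: "?r \<in> lists S" using relator by (auto simp: in_lists_conv_set)
  have uv: "u \<in> lists S" "v \<in> lists S" using relator by auto
  have "coxeter_cong S m ?r []" using coxeter_cong.relator[where u="[]" and v="[]" and m=m, OF relator(1-3)] by simp
  then have one: "wp ?r = \<one>" using presentation[OF r, of "[]"] by simp
  then have "even (count_list (map (\<lambda>t. wp u \<otimes> t \<otimes> inv (wp u)) (reflections ?r)) x)"
    using reflections_relator_even relator relator_power by metis
  moreover have "reflections (u @ ?r @ v) = reflections u @ map (\<lambda>t. wp u \<otimes> t \<otimes> inv (wp u)) (reflections ?r)
      @ map (\<lambda>t. wp u \<otimes> t \<otimes> inv (wp u)) (reflections v)"
  proof -
    have "map (\<lambda>t. wp ?r \<otimes> t \<otimes> inv (wp ?r)) (reflections v) = reflections v"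
      using reflections_carrier[OF uv(2)] by (intro map_idI) (simp add: one)
    then have "reflections (?r @ v) = reflections ?r @ reflections v"
      using reflections_append[OF r uv(2)] by simp
    then show ?thesis using reflections_append[OF uv(1), of "?r @ v"] r uv(2) by simp
  qed
  ultimately show ?case using reflections_append[OF uv] by (simp add: count_list_append)
qed (use cong_lists in auto)

lemma wp_reflections:
  "u \<in> lists S \<Longrightarrow> v \<in> lists S \<Longrightarrow> wp u = wp v \<Longrightarrow> even (count_list (reflections u) x) = even (count_list (reflections v) x)"
  using presentation cong_reflections by blast

text \<open>
  The reflection \<open>s\<^sub>1 \<dots> s\<^sub>i \<dots> s\<^sub>1\<close> cancels the letter \<open>s\<^sub>i\<close>.
\<close>

lemma reflection_deletes_letter:
  "u \<in> lists S \<Longrightarrow> t \<in> set (reflections u) \<Longrightarrow> \<exists>a c b. u = a @ c # b \<and> t \<otimes> wp u = wp (a @ b)"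
proof (induction u arbitrary: t)
  case (Cons s u)
  show ?case
  proof (cases "t = s")
    case True
    then show ?thesis using Cons.prems by (intro exI[of _ "[]"] exI[of _ s] exI[of _ u]) auto
  next
    case False
    then obtain r where r: "r \<in> set (reflections u)" "t = s \<otimes> r \<otimes> s" using Cons.prems by auto
    have "u \<in> lists S" using Cons.prems by simp
    from Cons.IH[OF this r(1)] obtain a c b where abc: "u = a @ c # b" "r \<otimes> wp u = wp (a @ b)" by blast
    have "r \<in> carrier W" using reflections_carrier r Cons.prems by auto
    then have "t \<otimes> wp (s # u) = s \<otimes> (r \<otimes> wp u)" using r Cons.prems by (simp add: m_assoc)
    then show ?thesis using abc by (intro exI[of _ "s # a"] exI[of _ c] exI[of _ b]) simp
  qed
qed simp

section \<open>The exchange and deletion conditions\<close>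

lemma len_le: "u \<in> lists S \<Longrightarrow> lg (wp u) \<le> length u"
  unfolding len_def by (rule Least_le) blast

lemma reduced_word:
  assumes "w \<in> carrier W"
  obtains u where "u \<in> lists S" "wp u = w" "length u = lg w"
proof -
  have "\<exists>k. \<exists>u\<in>lists S. length u = k \<and> wp u = w" using assms carrier_words by auto
  from LeastI_ex[OF this] show ?thesis using that unfolding len_def by blast
qed

lemma len_parity: "u \<in> lists S \<Longrightarrow> even (lg (wp u)) = even (length u)"
  using reduced_word[of "wp u"] wp_parity wp_closed by metis

lemma len_one [simp]: "lg \<one> = 0"
  using len_le[of "[]"] by simp

lemma len_0: "w \<in> carrier W \<Longrightarrow> lg w = 0 \<Longrightarrow> w = \<one>"
  by (metis length_0_conv reduced_word wp_Nil)

lemma len_mult_le: "x \<in> carrier W \<Longrightarrow> y \<in> carrier W \<Longrightarrow> lg (x \<otimes> y) \<le> lg x + lg y"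
proof -
  assume "x \<in> carrier W" "y \<in> carrier W"
  moreover obtain u where "u \<in> lists S" "wp u = x" "length u = lg x"
    using reduced_word[OF \<open>x \<in> carrier W\<close>] .
  moreover obtain v where "v \<in> lists S" "wp v = y" "length v = lg y"
    using reduced_word[OF \<open>y \<in> carrier W\<close>] .
  ultimately show ?thesis using len_le[of "u @ v"] wp_append[of u v] by simp
qed

lemma len_inv [simp]: "w \<in> carrier W \<Longrightarrow> lg (inv w) = lg w"
proof -
  have le: "lg (inv w) \<le> lg w" if w: "w \<in> carrier W" for w
  proof -
    obtain u where "u \<in> lists S" "wp u = w" "length u = lg w" using reduced_word[OF w] .
    then show ?thesis using len_le[of "rev u"] wp_rev[of u] by (simp add: in_lists_conv_set)
  qed
  show "w \<in> carrier W \<Longrightarrow> lg (inv w) = lg w" using le[of w] le[of "inv w"] by simp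
qed

lemma len_S: "s \<in> S \<Longrightarrow> lg s = 1"
  using len_le[of "[s]"] len_parity[of "[s]"] by (cases "lg s") auto

lemma len_left:
  assumes "s \<in> S" "w \<in> carrier W"
  shows "lg (s \<otimes> w) = lg w + 1 \<or> lg w = lg (s \<otimes> w) + 1"
proof -
  obtain u where u: "u \<in> lists S" "wp u = w" "length u = lg w" using reduced_word[OF assms(2)] .
  have "even (lg (s \<otimes> w)) \<noteq> even (lg w)" using len_parity[of "s # u"] u assms by simp
  then have "lg (s \<otimes> w) \<noteq> lg w" by metis
  moreover have "lg (s \<otimes> w) \<le> lg w + 1" using len_mult_le[of s w] assms len_S by simp
  moreover have "lg w \<le> lg (s \<otimes> w) + 1" using len_mult_le[of s "s \<otimes> w"] assms len_S by simp
  ultimately show ?thesis by linarith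
qed

lemma len_right_eq: "s \<in> S \<Longrightarrow> w \<in> carrier W \<Longrightarrow> lg (w \<otimes> s) = lg (s \<otimes> inv w)"
  using len_inv[of "w \<otimes> s"] by (simp add: inv_mult_group)

lemma len_right:
  assumes "s \<in> S" "w \<in> carrier W"
  shows "lg (w \<otimes> s) = lg w + 1 \<or> lg w = lg (w \<otimes> s) + 1"
  using len_left[OF assms(1), of "inv w"] assms by (simp add: len_right_eq)

lemma len_1: "w \<in> carrier W \<Longrightarrow> lg w = 1 \<Longrightarrow> w \<in> S"
proof -
  assume "w \<in> carrier W" "lg w = 1"
  then obtain u where "u \<in> lists S" "wp u = w" "length u = 1" using reduced_word by metis
  then show "w \<in> S" by (auto simp: length_Suc_conv)
qed

text \<open>
  If \<open>v\<close> is a reduced word of \<open>s w\<close>, then \<open>s # v\<close> is a reduced word of \<open>w\<close>, and \<open>s\<close> occurs in its list of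
  reflections only at the head. By parity \<open>s\<close> also occurs among the reflections of \<open>u\<close>.
\<close>

lemma exchange:
  assumes s: "s \<in> S" and u: "u \<in> lists S" and less: "lg (s \<otimes> wp u) < lg (wp u)"
  shows "\<exists>a c b. u = a @ c # b \<and> s \<otimes> wp u = wp (a @ b)"
proof -
  obtain v where v: "v \<in> lists S" "wp v = s \<otimes> wp u" "length v = lg (s \<otimes> wp u)"
    using reduced_word[of "s \<otimes> wp u"] s u by auto
  have sv: "wp (s # v) = wp u" using v s u by simp
  have "s \<notin> set (reflections v)"
  proof
    assume "s \<in> set (reflections v)"
    then obtain a c b where ab: "v = a @ c # b" "s \<otimes> wp v = wp (a @ b)"
      using reflection_deletes_letter[OF v(1)] by blast
    then have "lg (wp u) \<le> length (a @ b)" using len_le[of "a @ b"] v sv by simp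
    then show False using less v(3) ab(1) by simp
  qed
  moreover have "r = s" if "r \<in> set (reflections v)" "s = s \<otimes> r \<otimes> s" for r
  proof -
    have r: "r \<in> carrier W" using reflections_carrier[OF v(1)] that by simp
    then have "s \<otimes> s \<otimes> s = r" using s by (subst (2) that(2)) (simp add: m_assoc)
    then show ?thesis using s by simp
  qed
  ultimately have "s \<notin> set (map (\<lambda>t. s \<otimes> t \<otimes> s) (reflections v))" by auto
  then have "count_list (reflections (s # v)) s = 1" by (simp add: count_notin)
  then have "odd (count_list (reflections u) s)"
    using wp_reflections[of "s # v" u s] v(1) s u sv by simp
  then have "s \<in> set (reflections u)" by (metis count_notin even_zero)
  then show ?thesis using reflection_deletes_letter[OF u] by blast
qed

text \<open>
  The exchange condition applied to the longest reduced suffix and the letter before it.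
\<close>

lemma deletion:
  "u \<in> lists S \<Longrightarrow> lg (wp u) < length u \<Longrightarrow> \<exists>v. subseq v u \<and> length v + 2 = length u \<and> wp v = wp u"
proof (induction u)
  case (Cons s u)
  then have s: "s \<in> S" and u: "u \<in> lists S" by auto
  show ?case
  proof (cases "lg (wp u) < length u")
    case True
    then obtain v where "subseq v u" "length v + 2 = length u" "wp v = wp u" using Cons u by blast
    then show ?thesis by (intro exI[of _ "s # v"]) auto
  next
    case False
    then have "lg (wp u) = length u" using len_le[OF u] by simp
    then have "lg (s \<otimes> wp u) < lg (wp u)" using len_left[OF s, of "wp u"] Cons.prems u by auto
    then obtain a c b where abc: "u = a @ c # b" "s \<otimes> wp u = wp (a @ b)" using exchange[OF s u] by blast
    have "subseq (a @ b) u" unfolding abc(1) by (rule list_emb_append_mono) auto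
    then show ?thesis using abc by (intro exI[of _ "a @ b"]) auto
  qed
qed simp

lemma subseq_lists: "subseq v u \<Longrightarrow> u \<in> lists I \<Longrightarrow> v \<in> lists I"
  by (induction rule: list_emb.induct) auto

lemma reduced_subword:
  assumes "I \<subseteq> S" "u \<in> lists I"
  shows "\<exists>v\<in>lists I. wp v = wp u \<and> length v = lg (wp u)"
  using assms(2)
proof (induction "length u" arbitrary: u rule: less_induct)
  case less
  show ?case
  proof (cases "lg (wp u) < length u")
    case True
    then obtain v where "subseq v u" "length v + 2 = length u" "wp v = wp u"
      using deletion[OF lists_mono_S[OF assms(1) less.prems]] by blast
    then show ?thesis using less.hyps[of v] subseq_lists[OF _ less.prems] by simp
  next
    case False
    then have "length u = lg (wp u)" using len_le[OF lists_mono_S[OF assms(1) less.prems]] by simp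
    then show ?thesis using less.prems by blast
  qed
qed

lemma generate_Int_S:
  assumes "I \<subseteq> S" "s \<in> S" "s \<in> generate W I"
  shows "s \<in> I"
proof -
  obtain u where "u \<in> lists I" "s = wp u" using assms generate_eq_words by blast
  then obtain v where "v \<in> lists I" "wp v = s" "length v = 1"
    using reduced_subword[OF assms(1)] len_S[OF assms(2)] by metis
  then show ?thesis using assms S_in by (auto simp: length_Suc_conv)
qed

lemma generate_subset_iff: "I \<subseteq> S \<Longrightarrow> J \<subseteq> S \<Longrightarrow> generate W I \<subseteq> generate W J \<longleftrightarrow> I \<subseteq> J"
  using generate_Int_S[of J] generate.incl[of _ I W] mono_generate[of I J] by blast

text \<open>
  The exchange condition moves one letter after the other to the front of \<open>w\<close>. The deleted letter never lies in the part
  already split off, as that part together with the new letter is reduced.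
\<close>

lemma descent_prefix:
  assumes w: "w \<in> carrier W" and desc: "\<And>s. s \<in> I \<Longrightarrow> lg (s \<otimes> w) < lg w" and I: "I \<subseteq> S"
  shows "a \<in> lists I \<Longrightarrow> length a = lg (wp a) \<Longrightarrow> \<exists>y\<in>carrier W. w = wp a \<otimes> y \<and> lg w = length a + lg y"
proof (induction a)
  case Nil
  then show ?case using w by auto
next
  case (Cons s a)
  then have s: "s \<in> S" "s \<in> I" and a: "a \<in> lists S" "a \<in> lists I" using I by auto
  have "lg (wp a) = length a"
    using len_le[OF a(1)] len_mult_le[of s "wp a"] Cons.prems(2) len_S[OF s(1)] s a by simp
  then obtain y where y: "y \<in> carrier W" "w = wp a \<otimes> y" "lg w = length a + lg y" using Cons.IH a by auto
  obtain v where v: "v \<in> lists S" "wp v = y" "length v = lg y" using reduced_word[OF y(1)] .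
  have wu: "wp (a @ v) = w" using wp_append[OF a(1) v(1)] v y by simp
  then obtain p c r where pr: "a @ v = p @ c # r" "s \<otimes> w = wp (p @ r)"
    using exchange[OF s(1), of "a @ v"] desc[OF s(2)] a v by auto
  from pr(1) consider z where "a = p @ c # z" "r = z @ v" | z where "p = a @ z" "v = z @ c # r"
    by (auto simp: append_eq_append_conv2 Cons_eq_append_conv append_eq_Cons_conv)
  then show ?case
  proof cases
    case 1
    have pz: "p @ z \<in> lists S" using a 1 by auto
    have "s \<otimes> wp a \<otimes> y = wp (p @ z) \<otimes> y"
      using pr(2) y 1 wp_append[OF pz v(1)] v s a by (simp add: m_assoc)
    then have "s \<otimes> wp a = wp (p @ z)" using right_cancel[of y "s \<otimes> wp a" "wp (p @ z)"] y(1) pz s a by simp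
    then have "lg (wp (s # a)) \<le> length (p @ z)" using len_le[OF pz] by simp
    then show ?thesis using Cons.prems(2) 1 by simp
  next
    case 2
    have zr: "z @ r \<in> lists S" using v 2 by auto
    have "s \<otimes> w = wp a \<otimes> wp (z @ r)" using pr(2) 2 wp_append[OF a(1) zr] by simp
    then have "s \<otimes> (s \<otimes> w) = s \<otimes> (wp a \<otimes> wp (z @ r))" by simp
    then have weq: "w = wp (s # a) \<otimes> wp (z @ r)" using w s a zr by (simp add: m_assoc)
    have "lg (wp (z @ r)) \<le> length v - 1" using len_le[OF zr] 2 by simp
    moreover have "lg w \<le> length (s # a) + lg (wp (z @ r))"
      using len_mult_le[of "wp (s # a)" "wp (z @ r)"] Cons.prems(2) s a zr weq by simp
    moreover have "0 < length v" using 2 by simp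
    ultimately have "lg w = length (s # a) + lg (wp (z @ r))" using y(3) v(3) by simp
    then show ?thesis using weq zr wp_closed by blast
  qed
qed

text \<open>
  Every element then splits off from \<open>w\<close>, so that lengths are bounded.
\<close>

lemma finite_if_all_descents:
  assumes "finite S" "w \<in> carrier W" "\<And>s. s \<in> S \<Longrightarrow> lg (s \<otimes> w) < lg w"
  shows "finite (carrier W)"
proof (rule finite_subset)
  show "carrier W \<subseteq> wp ` {u. set u \<subseteq> S \<and> length u \<le> lg w}"
  proof
    fix x assume "x \<in> carrier W"
    then obtain u where u: "u \<in> lists S" "wp u = x" "length u = lg x" using reduced_word by metis
    then have "length u \<le> lg w" using descent_prefix[OF assms(2,3) subset_refl u(1)] by auto
    then show "x \<in> wp ` {u. set u \<subseteq> S \<and> length u \<le> lg w}" using u by auto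
  qed
  show "finite (wp ` {u. set u \<subseteq> S \<and> length u \<le> lg w})"
    using finite_lists_length_le[OF assms(1)] by blast
qed

section \<open>Double cosets\<close>

abbreviation "dc \<equiv> double_coset W"

lemma dc_iff:
  assumes "I \<subseteq> S" "J \<subseteq> S" "w \<in> carrier W"
  shows "x \<in> dc I w J \<longleftrightarrow> (\<exists>a\<in>lists I. \<exists>b\<in>lists J. x = wp a \<otimes> w \<otimes> wp b)"
proof -
  have "x \<in> dc I w J \<longleftrightarrow> (\<exists>a\<in>lists I. \<exists>b\<in>lists J. x = wp a \<otimes> (w \<otimes> wp b))"
    unfolding double_coset_def set_mult_def l_coset_def generate_eq_words[OF assms(1)] generate_eq_words[OF assms(2)]
    by blast
  also have "\<dots> \<longleftrightarrow> (\<exists>a\<in>lists I. \<exists>b\<in>lists J. x = wp a \<otimes> w \<otimes> wp b)"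
    using assms lists_mono_S by (intro bex_cong HOL.refl) (simp add: m_assoc)
  finally show ?thesis .
qed

context
  fixes I J assumes I: "I \<subseteq> S" and J: "J \<subseteq> S"
begin

lemma dc_self: "w \<in> carrier W \<Longrightarrow> w \<in> dc I w J"
  unfolding dc_iff[OF I J] by (intro bexI[of _ "[]"]) auto

lemma dc_carrier: "w \<in> carrier W \<Longrightarrow> x \<in> dc I w J \<Longrightarrow> x \<in> carrier W"
proof -
  assume w: "w \<in> carrier W" and "x \<in> dc I w J"
  then obtain a b where "a \<in> lists I" "b \<in> lists J" "x = wp a \<otimes> w \<otimes> wp b" using dc_iff[OF I J] by blast
  then show "x \<in> carrier W" using w wp_closed[OF lists_mono_S[OF I]] wp_closed[OF lists_mono_S[OF J]] by (metis m_closed)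
qed

lemma dc_mult:
  assumes "w \<in> carrier W" "x \<in> dc I w J" "a \<in> lists I" "b \<in> lists J"
  shows "wp a \<otimes> x \<otimes> wp b \<in> dc I w J"
proof -
  obtain c d where cd: "c \<in> lists I" "d \<in> lists J" "x = wp c \<otimes> w \<otimes> wp d"
    using assms(1,2) dc_iff[OF I J] by blast
  have "wp a \<otimes> x \<otimes> wp b = wp (a @ c) \<otimes> w \<otimes> wp (d @ b)"
    using cd assms lists_mono_S[OF I] lists_mono_S[OF J] by (simp add: wp_append m_assoc)
  moreover have "a @ c \<in> lists I" "d @ b \<in> lists J" using cd assms by auto
  ultimately show ?thesis using dc_iff[OF I J assms(1)] by blast
qed

lemma dc_sym:
  assumes "w \<in> carrier W" "x \<in> dc I w J"
  shows "w \<in> dc I x J"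
proof -
  obtain c d where cd: "c \<in> lists I" "d \<in> lists J" "x = wp c \<otimes> w \<otimes> wp d"
    using assms(1,2) dc_iff[OF I J] by blast
  have "wp (rev c) \<otimes> x \<otimes> wp (rev d) = w"
    using cd assms lists_mono_S[OF I cd(1)] lists_mono_S[OF J cd(2)]
    by (simp add: wp_rev m_assoc) (simp flip: m_assoc)
  moreover have "rev c \<in> lists I" "rev d \<in> lists J" using cd by auto
  ultimately show ?thesis using dc_iff[OF I J dc_carrier[OF assms]] by metis
qed

lemma dc_subset:
  assumes "w \<in> carrier W" "x \<in> dc I w J"
  shows "dc I x J \<subseteq> dc I w J"
proof
  fix y assume "y \<in> dc I x J"
  then obtain a b where "a \<in> lists I" "b \<in> lists J" "y = wp a \<otimes> x \<otimes> wp b"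
    unfolding dc_iff[OF I J dc_carrier[OF assms]] by blast
  then show "y \<in> dc I w J" using dc_mult[OF assms] by metis
qed

lemma dc_eq_iff:
  assumes "w \<in> carrier W" "x \<in> carrier W"
  shows "dc I x J = dc I w J \<longleftrightarrow> x \<in> dc I w J"
  using dc_self assms dc_subset dc_sym by blast

lemma dc_left: "w \<in> carrier W \<Longrightarrow> x \<in> dc I w J \<Longrightarrow> s \<in> I \<Longrightarrow> s \<otimes> x \<in> dc I w J"
  using dc_mult[of w x "[s]" "[]"] dc_carrier I by auto

lemma dc_right: "w \<in> carrier W \<Longrightarrow> x \<in> dc I w J \<Longrightarrow> s \<in> J \<Longrightarrow> x \<otimes> s \<in> dc I w J"
  using dc_mult[of w x "[]" "[s]"] dc_carrier J by auto

lemma mdr_iff: "w \<in> min_double_reps W S I J \<longleftrightarrow>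
    w \<in> carrier W \<and> (\<forall>s\<in>I. lg w < lg (s \<otimes> w)) \<and> (\<forall>s\<in>J. lg w < lg (w \<otimes> s))"
proof -
  have "I \<subseteq> Asc_L W S w \<longleftrightarrow> (\<forall>s\<in>I. lg w < lg (s \<otimes> w))" if "w \<in> carrier W"
    using len_left[OF _ that] I by (force simp: Asc_L_def Des_L_def)
  moreover have "J \<subseteq> Asc_R W S w \<longleftrightarrow> (\<forall>s\<in>J. lg w < lg (w \<otimes> s))" if "w \<in> carrier W"
    using len_right[OF _ that] J by (force simp: Asc_R_def Des_R_def)
  ultimately show ?thesis by (auto simp: min_double_reps_def)
qed

text \<open>
  An element of minimal length in its double coset splits off from every other element with lengths adding up:
  by the deletion condition, cancellations happen only in the outer factors.
\<close>

lemma shortest_splits_off: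
  assumes d: "d \<in> carrier W" and shortest: "\<And>y. y \<in> dc I d J \<Longrightarrow> lg d \<le> lg y" and x: "x \<in> dc I d J"
  shows "\<exists>a\<in>lists I. \<exists>b\<in>lists J. x = wp a \<otimes> d \<otimes> wp b \<and> length a + lg d + length b = lg x"
proof -
  \<comment> \<open>Outer factors of minimal total length: a deletion cannot shorten them, and it cannot shorten \<open>d\<close> either.\<close>
  define P where "P k \<longleftrightarrow> (\<exists>a\<in>lists I. \<exists>b\<in>lists J. x = wp a \<otimes> d \<otimes> wp b \<and> length a + length b = k)" for k
  have "\<exists>k. P k" using x by (auto simp: P_def dc_iff[OF I J d])
  from LeastI_ex[OF this] obtain a b where ab: "a \<in> lists I" "b \<in> lists J" "x = wp a \<otimes> d \<otimes> wp b"
    "length a + length b = (LEAST k. P k)" unfolding P_def by blast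
  obtain c where c: "c \<in> lists S" "wp c = d" "length c = lg d" using reduced_word[OF d] .
  have abS: "a \<in> lists S" "b \<in> lists S" using ab lists_mono_S I J by auto
  have wx: "wp (a @ c @ b) = x" using wp_append abS c ab(3) d by (simp add: m_assoc)
  have "\<not> lg x < length (a @ c @ b)"
  proof
    assume "lg x < length (a @ c @ b)"
    then obtain v where v: "subseq v (a @ c @ b)" "length v + 2 = length (a @ c @ b)" "wp v = x"
      using deletion[of "a @ c @ b"] wx abS c by auto
    obtain a' r where r: "v = a' @ r" "subseq a' a" "subseq r (c @ b)"
      using v(1) by (auto simp: subseq_append_iff)
    then obtain c' b' where v': "r = c' @ b'" "subseq c' c" "subseq b' b"
      by (auto simp: subseq_append_iff)
    have l: "a' \<in> lists I" "b' \<in> lists J" "c' \<in> lists S" using subseq_lists r v' ab c by metis+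
    then have lS: "a' \<in> lists S" "b' \<in> lists S" using lists_mono_S I J by auto
    have xeq: "x = wp a' \<otimes> wp c' \<otimes> wp b'" using v(3) r v' wp_append l lS by (simp add: m_assoc)
    show False
    proof (cases "length c' = length c")
      case True
      then have "c' = c" using v'(2) by (simp add: subseq_same_length)
      then have "P (length a' + length b')" unfolding P_def using xeq c l by auto
      then have "length a + length b \<le> length a' + length b'" unfolding ab(4) by (rule Least_le)
      then show False using v(2) r v' True by simp
    next
      case False
      then have "length c' < lg d" using list_emb_length[OF v'(2)] c by simp
      then have less: "lg (wp c') < lg d" using len_le[OF l(3)] by simp
      have "x \<in> dc I (wp c') J" using xeq l dc_iff[OF I J wp_closed[OF l(3)]] by blast
      then have "wp c' \<in> dc I d J" using dc_sym dc_subset l(3) x d dc_carrier by (meson subsetD wp_closed)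
      then show False using shortest less by fastforce
    qed
  qed
  then have "length a + lg d + length b = lg x"
    using len_le[of "a @ c @ b"] wx abS c by auto
  then show ?thesis using ab by blast
qed

text \<open>
  The first letter of the left factor and the last letter of the right factor would be descents.
\<close>

lemma shortest_unique:
  assumes d: "d \<in> carrier W" and shortest: "\<And>y. y \<in> dc I d J \<Longrightarrow> lg d \<le> lg y" and x: "x \<in> dc I d J"
    and mdr: "x \<in> min_double_reps W S I J"
  shows "x = d"
proof -
  obtain a b where ab: "a \<in> lists I" "b \<in> lists J" "x = wp a \<otimes> d \<otimes> wp b" "length a + lg d + length b = lg x"
    using shortest_splits_off[OF d shortest x] by blast
  have abS: "a \<in> lists S" "b \<in> lists S" using ab lists_mono_S I J by auto
  have "a = []"
  proof (cases a)
    case (Cons s a')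
    have s: "s \<in> I" "s \<in> S" "a' \<in> lists S" using Cons ab abS by auto
    have "s \<otimes> x = wp a' \<otimes> d \<otimes> wp b" using ab(3) Cons s abS d by (simp add: m_assoc)
    then have "lg (s \<otimes> x) \<le> length a' + lg d + length b"
      using len_mult_le[of "wp a' \<otimes> d" "wp b"] len_mult_le[of "wp a'" d] len_le[OF s(3)] len_le[OF abS(2)] s d abS by simp
    then have "lg (s \<otimes> x) < lg x" using ab(4) Cons by simp
    moreover have "lg x < lg (s \<otimes> x)" using mdr s by (simp add: mdr_iff)
    ultimately show ?thesis by simp
  qed
  have "b = []"
  proof (cases b rule: rev_cases)
    case (snoc b' s)
    have s: "s \<in> J" "s \<in> S" "b' \<in> lists S" using snoc ab abS by auto
    have "x \<otimes> s = wp a \<otimes> d \<otimes> wp b'" using ab(3) snoc s abS d by (simp add: m_assoc wp_append)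
    then have "lg (x \<otimes> s) \<le> length a + lg d + length b'"
      using len_mult_le[of "wp a \<otimes> d" "wp b'"] len_mult_le[of "wp a" d] len_le[OF s(3)] len_le[OF abS(1)] s d abS by simp
    then have "lg (x \<otimes> s) < lg x" using ab(4) snoc by simp
    moreover have "lg x < lg (x \<otimes> s)" using mdr s by (simp add: mdr_iff)
    ultimately show ?thesis by simp
  qed
  then show "x = d" using ab(3) \<open>a = []\<close> d by simp
qed

lemma min_rep_exists:
  assumes w: "w \<in> carrier W"
  shows "\<exists>d\<in>dc I w J. d \<in> min_double_reps W S I J \<and> (\<forall>x\<in>dc I w J. x \<in> min_double_reps W S I J \<longrightarrow> x = d)"
proof -
  obtain d where d: "d \<in> dc I w J" "\<And>y. y \<in> dc I w J \<Longrightarrow> lg d \<le> lg y"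
    using arg_min_nat_lemma[of "\<lambda>x. x \<in> dc I w J" w lg] dc_self[OF w] by metis
  have dW: "d \<in> carrier W" using dc_carrier w d by blast
  have eq: "dc I d J = dc I w J" using dc_eq_iff w dW d by blast
  have "d \<in> min_double_reps W S I J"
    unfolding mdr_iff
  proof (intro conjI ballI dW)
    fix s assume s: "s \<in> I"
    then show "lg d < lg (s \<otimes> d)" using d(2)[OF dc_left[OF w d(1) s]] len_left[of s d] I dW by auto
  next
    fix s assume s: "s \<in> J"
    then show "lg d < lg (d \<otimes> s)" using d(2)[OF dc_right[OF w d(1) s]] len_right[of s d] J dW by auto
  qed
  then show ?thesis using shortest_unique[OF dW] d eq by metis
qed

lemma min_rep_unique:
  assumes "x \<in> min_double_reps W S I J" "y \<in> min_double_reps W S I J" "x \<in> dc I y J"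
  shows "x = y"
  using min_rep_exists[of y] dc_self[of y] assms by (metis mdr_iff)

text \<open>
  Removing descents in \<open>I\<close> and \<open>J\<close> as long as possible leads from any element down to the minimal one.
\<close>

lemma min_rep_weak_le:
  assumes u: "u \<in> min_double_reps W S I J"
  shows "v \<in> dc I u J \<Longrightarrow> weak_LR W S u v"
proof (induction "lg v" arbitrary: v rule: less_induct)
  case less
  have uW: "u \<in> carrier W" using u by (simp add: mdr_iff)
  have vW: "v \<in> carrier W" using dc_carrier[OF uW less.prems] .
  show ?case
  proof (cases "v = u")
    case True
    then show ?thesis by (simp add: weak_LR_def)
  next
    case False
    then have "v \<notin> min_double_reps W S I J" using min_rep_unique[OF _ u less.prems] by blast
    then consider s where "s \<in> I" "\<not> lg v < lg (s \<otimes> v)" | s where "s \<in> J" "\<not> lg v < lg (v \<otimes> s)"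
      using vW by (auto simp: mdr_iff)
    then obtain v' where v': "v' \<in> dc I u J" "weak_LR_cover W S v' v"
    proof cases
      case 1
      have s: "s \<in> S" using 1 I by blast
      have "lg v = lg (s \<otimes> v) + 1" using len_left[OF s vW] 1 by auto
      moreover have "v \<otimes> inv (s \<otimes> v) = s" using s vW by (simp add: inv_mult_group) (simp flip: m_assoc)
      ultimately have "weak_LR_cover W S (s \<otimes> v) v" using s vW by (simp add: weak_LR_cover_def)
      then show thesis using that dc_left[OF uW less.prems 1(1)] by blast
    next
      case 2
      have s: "s \<in> S" using 2 J by blast
      have "lg v = lg (v \<otimes> s) + 1" using len_right[OF s vW] 2 by auto
      moreover have "inv (v \<otimes> s) \<otimes> v = s" using s vW by (simp add: inv_mult_group m_assoc)
      ultimately have "weak_LR_cover W S (v \<otimes> s) v" using s vW by (simp add: weak_LR_cover_def)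
      then show thesis using that dc_right[OF uW less.prems 2(1)] by blast
    qed
    then have "weak_LR W S u v'" using less.hyps by (simp add: weak_LR_cover_def)
    then show ?thesis using v'(2) unfolding weak_LR_def by simp
  qed
qed

end

lemma weak_LR_len: "weak_LR W S u v \<Longrightarrow> u = v \<or> lg u < lg v"
  unfolding weak_LR_def by (induction rule: rtranclp_induct) (auto simp: weak_LR_cover_def)

lemma weak_LR_left: "s \<in> S \<Longrightarrow> w \<in> carrier W \<Longrightarrow> lg w < lg (s \<otimes> w) \<Longrightarrow> weak_LR W S w (s \<otimes> w)"
  using len_left[of s w] unfolding weak_LR_def
  by (intro r_into_rtranclp) (auto simp: weak_LR_cover_def m_assoc)

lemma weak_LR_right: "s \<in> S \<Longrightarrow> w \<in> carrier W \<Longrightarrow> lg w < lg (w \<otimes> s) \<Longrightarrow> weak_LR W S w (w \<otimes> s)"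
  using len_right[of s w] unfolding weak_LR_def
  by (intro r_into_rtranclp) (auto simp: weak_LR_cover_def simp flip: m_assoc)

lemma dc_mono:
  assumes "I \<subseteq> I'" "J \<subseteq> J'" "I' \<subseteq> S" "J' \<subseteq> S" "w \<in> carrier W"
  shows "dc I w J \<subseteq> dc I' w J'"
proof
  fix x assume "x \<in> dc I w J"
  then obtain a b where "a \<in> lists I" "b \<in> lists J" "x = wp a \<otimes> w \<otimes> wp b"
    using dc_iff[of I J w] assms by blast
  then show "x \<in> dc I' w J'"
    using dc_iff[OF assms(3-5)] lists_mono[OF assms(1)] lists_mono[OF assms(2)] by blast
qed

section \<open>The longest element of a finite Coxeter group\<close>

text \<open>
  All generators are descents of an element of maximal length, hence the inverse of every element splits off from
  it.
\<close>

lemma longest_element: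
  assumes "finite (carrier W)"
  shows "\<exists>w0\<in>carrier W. w0 \<otimes> w0 = \<one> \<and> (\<forall>x\<in>carrier W. lg x + lg (x \<otimes> w0) = lg w0)"
proof -
  have "Max (lg ` carrier W) \<in> lg ` carrier W" using assms one_closed by (intro Max_in) auto
  then obtain w0 where w0: "w0 \<in> carrier W" "lg w0 = Max (lg ` carrier W)" by auto
  have max: "lg x \<le> lg w0" if "x \<in> carrier W" for x using assms that w0(2) by simp
  have desc: "lg (s \<otimes> w0) < lg w0" if "s \<in> S" for s
    using len_left[OF that w0(1)] max[of "s \<otimes> w0"] that w0(1) by auto
  have add: "lg x + lg (x \<otimes> w0) = lg w0" if x: "x \<in> carrier W" for x
  proof -
    obtain a where a: "a \<in> lists S" "wp a = inv x" "length a = lg (inv x)" using reduced_word[of "inv x"] x by auto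
    obtain y where y: "y \<in> carrier W" "w0 = wp a \<otimes> y" "lg w0 = length a + lg y"
      using descent_prefix[OF w0(1) desc subset_refl a(1)] a by auto
    then have "x \<otimes> w0 = y" using a x by (simp flip: m_assoc)
    then show ?thesis using y a x by simp
  qed
  have "lg (w0 \<otimes> w0) = 0" using add[OF w0(1)] by linarith
  then have "w0 \<otimes> w0 = \<one>" using len_0 w0(1) by simp
  then show ?thesis using add w0(1) by blast
qed

text \<open>
  Right multiplication by the longest element \<open>w0\<close> reverses the two-sided weak order. It takes double cosets of type
  \<open>(I, J)\<close> to those of type \<open>(I, w0 J w0)\<close>, where \<open>w0 J w0\<close> again consists of generators, and maximal elements to
  minimal ones.
\<close>

lemma max_rep_weak_ge:
  assumes fin: "finite (carrier W)" and I: "I \<subseteq> S" and J: "J \<subseteq> S" and w: "w \<in> carrier W"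
    and desc: "\<And>s. s \<in> I \<Longrightarrow> lg (s \<otimes> w) < lg w" "\<And>s. s \<in> J \<Longrightarrow> lg (w \<otimes> s) < lg w"
    and x: "x \<in> dc I w J"
  shows "weak_LR W S x w"
proof -
  obtain w0 where w0: "w0 \<in> carrier W" "w0 \<otimes> w0 = \<one>"
    and add: "\<And>x. x \<in> carrier W \<Longrightarrow> lg x + lg (x \<otimes> w0) = lg w0"
    using longest_element[OF fin] by blast
  have inv_w0: "inv w0 = w0" using w0 by (simp add: inv_equality)
  have w0w0: "w0 \<otimes> (w0 \<otimes> y) = y" "y \<otimes> w0 \<otimes> w0 = y" if "y \<in> carrier W" for y
    using w0 that by (simp_all add: m_assoc) (simp flip: m_assoc)
  define star where "star s = w0 \<otimes> s \<otimes> w0" for s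
  have star: "star s \<in> S" if s: "s \<in> S" for s
  proof (rule len_1)
    have sW: "s \<in> carrier W" using s by simp
    have *: "lg y + lg (w0 \<otimes> y) = lg w0" if "y \<in> carrier W" for y
    proof -
      have "inv (w0 \<otimes> y) = inv y \<otimes> w0" using that w0(1) inv_w0 by (simp add: inv_mult_group)
      then have "lg (w0 \<otimes> y) = lg (inv y \<otimes> w0)" using len_inv[of "w0 \<otimes> y"] that w0(1) by simp
      then show ?thesis using add[of "inv y"] that by simp
    qed
    show "star s \<in> carrier W" using sW w0 by (simp add: star_def)
    have "lg (star s) + lg (s \<otimes> w0) = lg w0"
      using *[of "star s"] sW w0(1) w0w0 by (simp add: star_def m_assoc)
    then show "lg (star s) = 1" using add[OF sW] len_S[OF s] by simp
  qed
  have star_move: "w0 \<otimes> star s = s \<otimes> w0" if "s \<in> S" for s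
    using that w0(1) w0w0 by (simp add: star_def m_assoc)
  have J': "star ` J \<subseteq> S" using star J by blast
  have word_move: "b \<in> lists J \<Longrightarrow> wp b \<otimes> w0 = w0 \<otimes> wp (map star b)" for b
  proof (induction b)
    case (Cons s b)
    then have s: "s \<in> S" "b \<in> lists S" "map star b \<in> lists S" using J star by (auto simp: in_lists_conv_set)
    have "wp (s # b) \<otimes> w0 = s \<otimes> (w0 \<otimes> wp (map star b))" using Cons s w0(1) by (simp add: m_assoc)
    also have "\<dots> = w0 \<otimes> star s \<otimes> wp (map star b)" using s star w0(1) by (simp add: star_move m_assoc)
    finally show ?case using s star w0(1) by (simp add: m_assoc)
  qed (use w0 in simp)
  have min: "w \<otimes> w0 \<in> min_double_reps W S I (star ` J)"
    unfolding mdr_iff[OF I J']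
  proof (intro conjI ballI)
    fix s assume s: "s \<in> I"
    then have "lg (s \<otimes> w) < lg w" "s \<in> carrier W" using desc I by auto
    then show "lg (w \<otimes> w0) < lg (s \<otimes> (w \<otimes> w0))"
      using add[of w] add[of "s \<otimes> w"] w w0(1) by (simp add: m_assoc)
  next
    fix t assume "t \<in> star ` J"
    then obtain s where s: "s \<in> J" "t = star s" by blast
    then have "lg (w \<otimes> s) < lg w" "s \<in> S" using desc J by auto
    moreover have "w \<otimes> w0 \<otimes> t = w \<otimes> s \<otimes> w0"
      using s star \<open>s \<in> S\<close> w w0(1) by (simp add: m_assoc star_move)
    ultimately show "lg (w \<otimes> w0) < lg (w \<otimes> w0 \<otimes> t)"
      using add[of w] add[of "w \<otimes> s"] w w0(1) by simp
  qed (use w w0 in simp)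
  obtain a b where ab: "a \<in> lists I" "b \<in> lists J" "x = wp a \<otimes> w \<otimes> wp b" using x dc_iff[OF I J w] by blast
  then have abS: "a \<in> lists S" "b \<in> lists S" "map star b \<in> lists (star ` J)" "map star b \<in> lists S"
    using lists_mono_S I J star by (auto simp: in_lists_conv_set)
  have "x \<otimes> w0 = wp a \<otimes> (w \<otimes> w0) \<otimes> wp (map star b)"
    using ab abS w w0(1) word_move[OF ab(2)] by (simp add: m_assoc)
  then have "x \<otimes> w0 \<in> dc I (w \<otimes> w0) (star ` J)" using dc_iff[OF I J'] ab(1) abS(3) w w0(1) by blast
  then have "weak_LR W S (w \<otimes> w0) (x \<otimes> w0)" by (rule min_rep_weak_le[OF I J' min])
  moreover have "weak_LR W S (v \<otimes> w0) (u \<otimes> w0)" if "weak_LR W S u v" for u v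
    using that unfolding weak_LR_def
  proof (induction rule: rtranclp_induct)
    case (step y z)
    then have yz: "y \<in> carrier W" "z \<in> carrier W" "lg z = lg y + 1" by (auto simp: weak_LR_cover_def)
    have "weak_LR_cover W S (z \<otimes> w0) (y \<otimes> w0)"
      unfolding weak_LR_cover_def
    proof (intro conjI)
      show "lg (y \<otimes> w0) = lg (z \<otimes> w0) + 1" using add[of y] add[of z] yz by simp
      have "(y \<otimes> w0) \<otimes> inv (z \<otimes> w0) = inv (z \<otimes> inv y)"
        using yz w0(1) w0w0 inv_w0 by (simp add: inv_mult_group m_assoc)
      moreover have "inv (z \<otimes> w0) \<otimes> (y \<otimes> w0) = star (inv (inv y \<otimes> z))"
        using yz w0(1) inv_w0 by (simp add: inv_mult_group m_assoc star_def)
      moreover have "z \<otimes> inv y \<in> S \<or> inv y \<otimes> z \<in> S" using step by (simp add: weak_LR_cover_def)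
      ultimately show "(y \<otimes> w0) \<otimes> inv (z \<otimes> w0) \<in> S \<or> inv (z \<otimes> w0) \<otimes> (y \<otimes> w0) \<in> S"
        using star inv_S by metis
    qed (use yz w0 in auto)
    then show ?case using step.IH by (meson converse_rtranclp_into_rtranclp)
  qed simp
  ultimately have "weak_LR W S (x \<otimes> w0 \<otimes> w0) (w \<otimes> w0 \<otimes> w0)" by blast
  then show ?thesis using w0w0 w dc_carrier[OF I J w x] by simp
qed

end

section \<open>Faces of the two-sided Coxeter complex\<close>

locale finite_rank_coxeter = coxeter +
  assumes finite_S: "finite S"
begin

abbreviation "P \<equiv> Xi W S"
abbreviation "fle \<equiv> Xi_le W"
abbreviation "mdr \<equiv> min_double_reps W S"

lemma Xi_iff: "(I, w, J) \<in> P \<longleftrightarrow> I \<subseteq> S \<and> J \<subseteq> S \<and> w \<in> mdr I J"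
  by (simp add: Xi_def)

lemma mdr_carrier: "w \<in> mdr I J \<Longrightarrow> w \<in> carrier W"
  by (simp add: min_double_reps_def)

text \<open>
  The type \<open>(I, J)\<close> and any element of the double coset determine a face. In this form faces can be compared without
  choosing minimal representatives.
\<close>

definition "minrep I w J = (THE d. d \<in> dc I w J \<and> d \<in> mdr I J)"

definition "face I w J = (I, minrep I w J, J)"

lemma minrep:
  assumes "I \<subseteq> S" "J \<subseteq> S" "w \<in> carrier W"
  shows "minrep I w J \<in> dc I w J" "minrep I w J \<in> mdr I J"
proof -
  have "\<exists>!d. d \<in> dc I w J \<and> d \<in> mdr I J" using min_rep_exists[OF assms] by blast
  from theI'[OF this] show "minrep I w J \<in> dc I w J" "minrep I w J \<in> mdr I J"
    unfolding minrep_def by auto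
qed

lemma minrep_carrier [simp]: "I \<subseteq> S \<Longrightarrow> J \<subseteq> S \<Longrightarrow> w \<in> carrier W \<Longrightarrow> minrep I w J \<in> carrier W"
  using minrep(2) mdr_carrier by blast

lemma face_in_Xi: "I \<subseteq> S \<Longrightarrow> J \<subseteq> S \<Longrightarrow> w \<in> carrier W \<Longrightarrow> face I w J \<in> P"
  by (simp add: face_def Xi_iff minrep)

lemma minrep_eq: "I \<subseteq> S \<Longrightarrow> J \<subseteq> S \<Longrightarrow> w \<in> carrier W \<Longrightarrow> d \<in> dc I w J \<Longrightarrow> d \<in> mdr I J \<Longrightarrow> minrep I w J = d"
  using min_rep_exists[of I J w] minrep by metis

lemma face_of: "(I, w, J) \<in> P \<Longrightarrow> face I w J = (I, w, J)"
  using minrep_eq[of I J w w] dc_self[of I J w] mdr_carrier by (simp add: face_def Xi_iff)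

lemma face_cases:
  assumes "F \<in> P"
  obtains I w J where "F = face I w J" "I \<subseteq> S" "J \<subseteq> S" "w \<in> carrier W" "F = (I, w, J)"
proof -
  obtain I w J where F: "F = (I, w, J)" by (cases F)
  then show thesis using that[of I w J] face_of[of I w J] assms mdr_carrier by (auto simp: Xi_iff)
qed

lemma dc_minrep:
  assumes "I \<subseteq> S" "J \<subseteq> S" "w \<in> carrier W"
  shows "dc I (minrep I w J) J = dc I w J"
  by (simp only: dc_eq_iff[OF assms minrep_carrier[OF assms]] minrep(1)[OF assms])

lemma dc_subset_iff:
  assumes "I' \<subseteq> I" "J' \<subseteq> J" "I \<subseteq> S" "J \<subseteq> S" "w \<in> carrier W" "w' \<in> carrier W"
  shows "dc I' w' J' \<subseteq> dc I w J \<longleftrightarrow> w' \<in> dc I w J"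
proof
  assume "dc I' w' J' \<subseteq> dc I w J"
  moreover have "w' \<in> dc I' w' J'" by (rule dc_self) (use assms in auto)
  ultimately show "w' \<in> dc I w J" by blast
next
  assume "w' \<in> dc I w J"
  then have "dc I w' J = dc I w J" by (simp only: dc_eq_iff[OF assms(3-6)])
  then show "dc I' w' J' \<subseteq> dc I w J" using dc_mono[of I' I J' J w'] assms by blast
qed

lemma face_le_iff:
  assumes "I \<subseteq> S" "J \<subseteq> S" "I' \<subseteq> S" "J' \<subseteq> S" "w \<in> carrier W" "w' \<in> carrier W"
  shows "fle (face I w J) (face I' w' J') \<longleftrightarrow> I' \<subseteq> I \<and> J' \<subseteq> J \<and> w' \<in> dc I w J"
  using assms dc_subset_iff[of I' I J' J w w'] by (auto simp: face_def Xi_le_def dc_minrep)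

lemma face_eq_iff:
  assumes "I \<subseteq> S" "J \<subseteq> S" "w \<in> carrier W" "w' \<in> carrier W"
  shows "face I w J = face I' w' J' \<longleftrightarrow> I = I' \<and> J = J' \<and> dc I w J = dc I w' J"
proof
  assume "face I w J = face I' w' J'"
  then show "I = I' \<and> J = J' \<and> dc I w J = dc I w' J" using dc_minrep assms by (auto simp: face_def) metis+
qed (auto simp: face_def minrep_def)

lemma Xi_le_refl: "F \<in> P \<Longrightarrow> fle F F"
  by (cases F) (simp add: Xi_le_def)

lemma Xi_le_trans: "fle F G \<Longrightarrow> fle G H \<Longrightarrow> fle F H"
  by (cases F; cases G; cases H) (auto simp: Xi_le_def)

lemma Xi_le_antisym:
  assumes "F \<in> P" "G \<in> P" "fle F G" "fle G F"
  shows "F = G"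
proof -
  obtain I w J where F: "F = face I w J" "I \<subseteq> S" "J \<subseteq> S" "w \<in> carrier W" using face_cases[OF assms(1)] by blast
  obtain I' w' J' where G: "G = face I' w' J'" "I' \<subseteq> S" "J' \<subseteq> S" "w' \<in> carrier W" using face_cases[OF assms(2)] by blast
  have "I = I'" "J = J'" "w' \<in> dc I w J" using assms(3,4) F G face_le_iff by auto
  moreover then have "dc I w J = dc I w' J" using dc_eq_iff[OF F(2-4) G(4)] by simp
  ultimately show ?thesis using F(1) G(1) face_eq_iff[OF F(2-4) G(4)] by simp
qed

lemma is_poset_Xi: "is_poset P fle"
  unfolding is_poset_def
  using Xi_le_refl Xi_le_trans Xi_le_antisym by (blast intro: reflp_onI antisymp_onI transp_onI)

lemma dc_full_left: "J \<subseteq> S \<Longrightarrow> w \<in> carrier W \<Longrightarrow> dc S w J = carrier W"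
  and dc_full_right: "J \<subseteq> S \<Longrightarrow> w \<in> carrier W \<Longrightarrow> dc J w S = carrier W"
proof -
  assume J: "J \<subseteq> S" and w: "w \<in> carrier W"
  have "x \<in> dc S w J" if x: "x \<in> carrier W" for x
  proof -
    obtain a where "a \<in> lists S" "wp a = x \<otimes> inv w" using x w carrier_words by (metis imageE inv_closed m_closed)
    then show ?thesis using dc_iff[OF subset_refl J w] x w
      by (intro iffD2[OF dc_iff[OF subset_refl J w]] bexI[of _ a] bexI[of _ "[]"]) (auto simp: m_assoc)
  qed
  then show "dc S w J = carrier W" using dc_carrier[OF subset_refl J w] by blast
  have "x \<in> dc J w S" if x: "x \<in> carrier W" for x
  proof -
    obtain a where "a \<in> lists S" "wp a = inv w \<otimes> x" using x w carrier_words by (metis imageE inv_closed m_closed)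
    then show ?thesis using x w
      by (intro iffD2[OF dc_iff[OF J subset_refl w]] bexI[of _ a] bexI[of _ "[]"]) (auto simp flip: m_assoc)
  qed
  then show "dc J w S = carrier W" using dc_carrier[OF J subset_refl w] by blast
qed

lemma one_mdr: "I \<subseteq> S \<Longrightarrow> J \<subseteq> S \<Longrightarrow> \<one> \<in> mdr I J"
  using len_S by (auto simp: mdr_iff subset_iff)

lemma face_full: "J \<subseteq> S \<Longrightarrow> w \<in> carrier W \<Longrightarrow> face S w J = (S, \<one>, J)" "J \<subseteq> S \<Longrightarrow> w \<in> carrier W \<Longrightarrow> face J w S = (J, \<one>, S)"
  using minrep_eq[of S J w \<one>] minrep_eq[of J S w \<one>] dc_full_left dc_full_right one_mdr by (auto simp: face_def)

lemma dc_empty: "w \<in> carrier W \<Longrightarrow> dc {} w {} = {w}"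
  using dc_iff[of "{}" "{}" w] by auto

lemma face_empty: "w \<in> carrier W \<Longrightarrow> face {} w {} = ({}, w, {})"
  using face_of[of "{}" w "{}"] by (simp add: Xi_iff mdr_iff)

lemma is_minimum_iff: "is_minimum P fle F \<longleftrightarrow> F = (S, \<one>, S)"
proof -
  have "is_minimum P fle (S, \<one>, S)"
    unfolding is_minimum_def
  proof (intro conjI ballI)
    show "(S, \<one>, S) \<in> P" by (simp add: Xi_iff one_mdr)
    fix F assume "F \<in> P"
    then obtain I w J where F: "F = face I w J" "I \<subseteq> S" "J \<subseteq> S" "w \<in> carrier W" using face_cases by blast
    then show "fle (S, \<one>, S) F"
      using face_le_iff[of S S I J \<one> w] face_full[of S \<one>] dc_full_left[of S \<one>] by simp
  qed
  moreover from this have "is_minimum P fle F \<Longrightarrow> F = (S, \<one>, S)"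
    using Xi_le_antisym[of F "(S, \<one>, S)"] by (auto simp: is_minimum_def)
  ultimately show ?thesis by blast
qed

lemma Plus_subset_iff: "A <+> B \<subseteq> C <+> D \<longleftrightarrow> A \<subseteq> C \<and> B \<subseteq> D"
  by (auto simp: subset_iff split_sum_all Plus_def)

text \<open>
  Below a face the double coset is determined by the types, as it has to contain that of the face. The types themselves may be
  any larger subsets of \<open>S\<close>.
\<close>

lemma lower_interval_iso:
  assumes "F \<in> P" "F = (I, w, J)"
  shows "poset_iso {G\<in>P. fle G F} fle (Pow ((S - I) <+> (S - J))) (\<subseteq>) (\<lambda>(A, u, B). (S - A) <+> (S - B))"
proof -
  have F: "F = face I w J" "I \<subseteq> S" "J \<subseteq> S" "w \<in> carrier W"
    using assms face_of mdr_carrier by (auto simp: Xi_iff)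
  have below: "\<exists>A B. G = face A w B \<and> I \<subseteq> A \<and> A \<subseteq> S \<and> J \<subseteq> B \<and> B \<subseteq> S" if G: "G \<in> P" "fle G F" for G
  proof -
    obtain A u B where g: "G = face A u B" "A \<subseteq> S" "B \<subseteq> S" "u \<in> carrier W" using face_cases[OF G(1)] by blast
    then have "I \<subseteq> A" "J \<subseteq> B" "w \<in> dc A u B" using G(2) face_le_iff F by auto
    moreover from this have "face A u B = face A w B"
      using face_eq_iff[OF g(2-4) F(4)] dc_eq_iff[OF g(2-4) F(4)] by simp
    ultimately show ?thesis using g by blast
  qed
  have face_below: "face A w B \<in> P \<and> fle (face A w B) F" if "I \<subseteq> A" "A \<subseteq> S" "J \<subseteq> B" "B \<subseteq> S" for A B
    using that F face_in_Xi face_le_iff[of A B I J w w] dc_self by simp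
  let ?f = "\<lambda>(A, u::'a, B). (S - A) <+> (S - B)"
  have f: "?f (face A u B) = (S - A) <+> (S - B)" for A u B by (simp add: face_def)
  have order: "fle (face A w B) (face A' w B') \<longleftrightarrow> (S - A) <+> (S - B) \<subseteq> (S - A') <+> (S - B')"
    if "A \<subseteq> S" "B \<subseteq> S" "A' \<subseteq> S" "B' \<subseteq> S" for A B A' B'
  proof -
    have "fle (face A w B) (face A' w B') \<longleftrightarrow> A' \<subseteq> A \<and> B' \<subseteq> B"
      using face_le_iff[of A B A' B' w w] dc_self[of A B w] that F by simp
    also have "\<dots> \<longleftrightarrow> (S - A) <+> (S - B) \<subseteq> (S - A') <+> (S - B')"
      using that unfolding Plus_subset_iff by blast
    finally show ?thesis .
  qed
  have bij: "bij_betw ?f {G\<in>P. fle G F} (Pow ((S - I) <+> (S - J)))"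
    unfolding bij_betw_def
  proof
    show "inj_on ?f {G\<in>P. fle G F}"
    proof (rule inj_onI)
      fix G H assume G: "G \<in> {G\<in>P. fle G F}" and H: "H \<in> {G\<in>P. fle G F}" and eq: "?f G = ?f H"
      obtain A B where g: "G = face A w B" "A \<subseteq> S" "B \<subseteq> S" using below G by blast
      obtain A' B' where h: "H = face A' w B'" "A' \<subseteq> S" "B' \<subseteq> S" using below H by blast
      have "fle G H" "fle H G" using order g h eq f by auto
      then show "G = H" using Xi_le_antisym G H by blast
    qed
    show "?f ` {G\<in>P. fle G F} = Pow ((S - I) <+> (S - J))"
    proof
      show "?f ` {G\<in>P. fle G F} \<subseteq> Pow ((S - I) <+> (S - J))"
      proof clarify
        fix A u B x assume G: "(A, u, B) \<in> P" "fle (A, u, B) F" and x: "x \<in> (S - A) <+> (S - B)"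
        have "I \<subseteq> A" "J \<subseteq> B" using G(2) assms(2) by (auto simp: Xi_le_def)
        then show "x \<in> (S - I) <+> (S - J)" using x by auto
      qed
      show "Pow ((S - I) <+> (S - J)) \<subseteq> ?f ` {G\<in>P. fle G F}"
      proof
        fix X assume X: "X \<in> Pow ((S - I) <+> (S - J))"
        let ?A = "S - {s. Inl s \<in> X}" and ?B = "S - {s. Inr s \<in> X}"
        have "?f (face ?A w ?B) = X" using X unfolding f by (auto simp: Plus_def)
        moreover have "I \<subseteq> ?A" "J \<subseteq> ?B" using X F by auto
        then have "face ?A w ?B \<in> {G\<in>P. fle G F}" using face_below by blast
        ultimately show "X \<in> ?f ` {G\<in>P. fle G F}" by (metis (no_types, lifting) image_eqI)
      qed
    qed
  qed
  have ord: "fle G H \<longleftrightarrow> ?f G \<subseteq> ?f H" if G: "G \<in> {G\<in>P. fle G F}" and H: "H \<in> {G\<in>P. fle G F}" for G H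
  proof -
    obtain A B where g: "G = face A w B" "A \<subseteq> S" "B \<subseteq> S" using below G by blast
    obtain A' B' where h: "H = face A' w B'" "A' \<subseteq> S" "B' \<subseteq> S" using below H by blast
    show ?thesis unfolding g(1) h(1) f by (rule order[OF g(2,3) h(2,3)])
  qed
  show ?thesis unfolding poset_iso_def by (intro conjI ballI bij ord)
qed

lemma poset_iso_Pow_nat:
  assumes "finite T" "poset_iso Q leq (Pow T) (\<subseteq>) f"
  shows "\<exists>(k::nat) g. poset_iso Q leq (Pow {..<k}) (\<subseteq>) g"
proof -
  obtain b where b: "bij_betw b T {..<card T}"
    using ex_bij_betw_finite_nat[OF assms(1)] by (metis atLeast0LessThan)
  have "bij_betw (\<lambda>x. b ` f x) Q (Pow {..<card T})"
    using bij_betw_trans[OF _ bij_betw_Pow[OF b], of f Q] assms(2) by (simp add: poset_iso_def o_def)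
  moreover have "b ` f x \<subseteq> b ` f y \<longleftrightarrow> f x \<subseteq> f y" if "x \<in> Q" "y \<in> Q" for x y
  proof -
    have "f x \<subseteq> T" "f y \<subseteq> T" using that assms(2) bij_betwE by (fastforce simp: poset_iso_def)+
    then show ?thesis using b inj_on_image_subset_iff unfolding bij_betw_def by metis
  qed
  ultimately show ?thesis using assms(2) unfolding poset_iso_def by metis
qed

lemma boolean_complex_Xi: "boolean_complex P fle"
  unfolding boolean_complex_def
proof (intro conjI ballI)
  show "is_poset P fle" by (rule is_poset_Xi)
  show "\<exists>!m. is_minimum P fle m" by (simp add: is_minimum_iff)
  fix F assume "F \<in> P"
  obtain I w J where "F = (I, w, J)" by (cases F)
  then show "\<exists>(k::nat) f. poset_iso {G\<in>P. fle G F} fle (Pow {..<k}) (\<subseteq>) f"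
    by (intro poset_iso_Pow_nat[OF _ lower_interval_iso[OF \<open>F \<in> P\<close>]] finite_Plus finite_Diff finite_S)
qed

section \<open>Vertices, facets and the Coxeter complex\<close>

text \<open>
  If one of the two types is \<open>S\<close>, the whole group is a single double coset. So the vertices form two copies of \<open>S\<close>,
  one for each side.
\<close>

definition "vl s = (S - {s}, \<one>, S)"
definition "vr s = (S, \<one>, S - {s})"

lemma vl_face: "w \<in> carrier W \<Longrightarrow> face (S - {s}) w S = vl s"
  and vr_face: "w \<in> carrier W \<Longrightarrow> face S w (S - {s}) = vr s"
  using face_full by (auto simp: vl_def vr_def)

lemma vl_inj: "s \<in> S \<Longrightarrow> t \<in> S \<Longrightarrow> vl s = vl t \<longleftrightarrow> s = t"
  and vr_inj: "s \<in> S \<Longrightarrow> t \<in> S \<Longrightarrow> vr s = vr t \<longleftrightarrow> s = t"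
  and vl_vr: "s \<in> S \<Longrightarrow> vl s \<noteq> vr t" "s \<in> S \<Longrightarrow> vr t \<noteq> vl s"
  by (auto simp: vl_def vr_def)

lemma vertices_Xi: "vertices P fle = vl ` S \<union> vr ` S"
proof
  show "vertices P fle \<subseteq> vl ` S \<union> vr ` S"
  proof
    fix v assume v: "v \<in> vertices P fle"
    then have "v \<in> P" by (simp add: vertices_def)
    then obtain I w J where F: "v = face I w J" "I \<subseteq> S" "J \<subseteq> S" "w \<in> carrier W"
      by (rule face_cases)
    have atom: "face A w B = v" if "A \<subseteq> S" "B \<subseteq> S" "I \<subseteq> A" "J \<subseteq> B" "A \<noteq> S \<or> B \<noteq> S" for A B
    proof -
      have "fle (face A w B) v" using face_le_iff[of A B I J w w] that F dc_self by simp
      moreover have "\<not> is_minimum P fle (face A w B)" using that by (simp add: is_minimum_iff face_def)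
      ultimately show ?thesis using v face_in_Xi[OF that(1,2) F(4)] by (auto simp: vertices_def)
    qed
    have "I \<noteq> S \<or> J \<noteq> S"
      using v face_full(1)[of S w] F by (auto simp: vertices_def is_minimum_iff)
    then consider s where "s \<in> S - I" | s where "s \<in> S - J" using F by blast
    then show "v \<in> vl ` S \<union> vr ` S"
    proof cases
      case 1
      then have "vl s = v" using atom[of "S - {s}" S] vl_face[OF F(4)] F by auto
      then show ?thesis using 1 by blast
    next
      case 2
      then have "vr s = v" using atom[of S "S - {s}"] vr_face[OF F(4)] F by auto
      then show ?thesis using 2 by blast
    qed
  qed
  have vert: "face A \<one> B \<in> vertices P fle"
    if AB: "A \<subseteq> S" "B \<subseteq> S" "A \<noteq> S \<or> B \<noteq> S" "\<And>A' B'. A \<subseteq> A' \<Longrightarrow> B \<subseteq> B' \<Longrightarrow> A' \<subseteq> S \<Longrightarrow> B' \<subseteq> S \<Longrightarrow> (A' = A \<and> B' = B) \<or> (A' = S \<and> B' = S)" for A B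
    unfolding vertices_def mem_Collect_eq
  proof (intro conjI ballI impI)
    show "face A \<one> B \<in> P" using AB face_in_Xi by simp
    show "\<not> is_minimum P fle (face A \<one> B)" using AB by (simp add: is_minimum_iff face_def)
    fix u assume "u \<in> P" and ule: "fle u (face A \<one> B)"
    then obtain A' w B' where u: "u = face A' w B'" "A' \<subseteq> S" "B' \<subseteq> S" "w \<in> carrier W" using face_cases by blast
    then have "A \<subseteq> A'" "B \<subseteq> B'" "\<one> \<in> dc A' w B'" using ule face_le_iff[of A' B' A B w \<one>] AB by auto
    then consider "A' = A \<and> B' = B" | "A' = S \<and> B' = S" using AB(4) u by blast
    then show "u = face A \<one> B \<or> is_minimum P fle u"
    proof cases
      case 1
      then have "dc A w B = dc A \<one> B"
        using dc_eq_iff[OF AB(1,2) u(4) one_closed] \<open>\<one> \<in> dc A' w B'\<close> by simp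
      then show ?thesis using face_eq_iff[OF AB(1,2) u(4) one_closed] 1 u(1) by simp
    next
      case 2
      then show ?thesis using u face_full(1)[of S w] by (simp add: is_minimum_iff)
    qed
  qed
  show "vl ` S \<union> vr ` S \<subseteq> vertices P fle"
  proof (intro Un_least image_subsetI)
    fix s assume s: "s \<in> S"
    have between: "A = S - {s} \<or> A = S" if "S - {s} \<subseteq> A" "A \<subseteq> S" for A using that by blast
    have full: "A = S" if "S \<subseteq> A" "A \<subseteq> S" for A using that by blast
    show "vl s \<in> vertices P fle"
      unfolding vl_face[OF one_closed, symmetric] by (rule vert) (use s between full in auto)
    show "vr s \<in> vertices P fle"
      unfolding vr_face[OF one_closed, symmetric] by (rule vert) (use s between full in auto)
  qed
qed

lemma verts_of_Xi:
  assumes "F \<in> P" "F = (I, w, J)"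
  shows "verts_of P fle F = vl ` (S - I) \<union> vr ` (S - J)"
proof -
  have F: "F = face I w J" "I \<subseteq> S" "J \<subseteq> S" "w \<in> carrier W"
    using assms face_of mdr_carrier by (auto simp: Xi_iff)
  have "fle (vl s) F \<longleftrightarrow> s \<notin> I" if "s \<in> S" for s
    using face_le_iff[of "S - {s}" S I J \<one> w] vl_face[OF one_closed] dc_full_right[of "S - {s}" \<one>] F that by auto
  moreover have "fle (vr s) F \<longleftrightarrow> s \<notin> J" if "s \<in> S" for s
    using face_le_iff[of S "S - {s}" I J \<one> w] vr_face[OF one_closed] dc_full_left[of "S - {s}" \<one>] F that by auto
  ultimately show ?thesis unfolding verts_of_def vertices_Xi by blast
qed

lemma card_vl_vr: "A \<subseteq> S \<Longrightarrow> B \<subseteq> S \<Longrightarrow> card (vl ` A \<union> vr ` B) = card A + card B"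
proof -
  assume A: "A \<subseteq> S" and B: "B \<subseteq> S"
  have "finite A" "finite B" using A B finite_S finite_subset by auto
  moreover have "inj_on vl A" "inj_on vr B" using A B vl_inj vr_inj by (auto simp: inj_on_def subset_iff)
  moreover have "vl ` A \<inter> vr ` B = {}" using A vl_vr by blast
  ultimately show ?thesis by (simp add: card_Un_disjoint card_image)
qed

lemma face_dim_Xi: "(I, w, J) \<in> P \<Longrightarrow> face_dim P fle (I, w, J) = int (card (S - I)) + int (card (S - J)) - 1"
  using verts_of_Xi[of "(I, w, J)"] card_vl_vr[of "S - I" "S - J"] by (simp add: face_dim_def)

lemma has_complex_dim_Xi: "has_complex_dim P fle (2 * int (card S) - 1)"
  unfolding has_complex_dim_def
proof
  show "\<forall>F\<in>P. face_dim P fle F \<le> 2 * int (card S) - 1"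
  proof
    fix F assume "F \<in> P"
    moreover obtain I w J where "F = (I, w, J)" by (cases F)
    moreover have "card (S - I) \<le> card S" "card (S - J) \<le> card S"
      using finite_S by (auto intro: card_mono)
    ultimately show "face_dim P fle F \<le> 2 * int (card S) - 1" using face_dim_Xi by simp
  qed
  have "({}, \<one>, {}) \<in> P" by (simp add: Xi_iff one_mdr)
  then show "\<exists>F\<in>P. face_dim P fle F = 2 * int (card S) - 1"
    using face_dim_Xi by (intro bexI[of _ "({}, \<one>, {})"]) auto
qed

lemma finite_vertices: "finite (vertices P fle)"
  and card_vertices: "card (vertices P fle) = 2 * card S"
  using finite_S card_vl_vr[of S S] by (auto simp: vertices_Xi)

lemma balanced_Xi: "balanced P fle"
proof -
  obtain c where c: "bij_betw c (vertices P fle) {..<2 * card S}"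
    using ex_bij_betw_finite_nat[OF finite_vertices] card_vertices by (metis atLeast0LessThan)
  have "inj_on c (verts_of P fle F)" for F
    using c by (auto simp: verts_of_def bij_betw_def intro: inj_on_subset)
  then show ?thesis unfolding balanced_def
    using c has_complex_dim_Xi by (intro exI[of _ "2 * card S"] exI[of _ c]) (auto simp: bij_betw_def)
qed

lemma facets_Xi: "facets P fle = (\<lambda>w. ({}, w, {})) ` carrier W"
proof
  show "facets P fle \<subseteq> (\<lambda>w. ({}, w, {})) ` carrier W"
  proof
    fix F assume F: "F \<in> facets P fle"
    then have "F \<in> P" by (simp add: maximal_elems_def)
    then obtain I w J where f: "F = face I w J" "I \<subseteq> S" "J \<subseteq> S" "w \<in> carrier W"
      by (rule face_cases)
    have "fle F (face {} w {})" using face_le_iff[of I J "{}" "{}" w w] f dc_self by simp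
    then have "face {} w {} = F" using F face_in_Xi f by (auto simp: maximal_elems_def)
    then have "F = ({}, w, {})" using face_empty[OF f(4)] by metis
    then show "F \<in> (\<lambda>w. ({}, w, {})) ` carrier W" using f(4) by blast
  qed
  show "(\<lambda>w. ({}, w, {})) ` carrier W \<subseteq> facets P fle"
  proof (rule image_subsetI)
    fix w assume w: "w \<in> carrier W"
    show "({}, w, {}) \<in> facets P fle"
      unfolding maximal_elems_def mem_Collect_eq
    proof (intro conjI ballI impI)
      show "({}, w, {}) \<in> P" using face_in_Xi[of "{}" "{}" w] face_empty w by simp
      fix G assume "G \<in> P" and below: "fle ({}, w, {}) G"
      then obtain I v J where g: "G = face I v J" "I \<subseteq> S" "J \<subseteq> S" "v \<in> carrier W" using face_cases by blast
      then have "I = {}" "J = {}" "v \<in> dc {} w {}"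
        using below face_le_iff[of "{}" "{}" I J w v] face_empty[OF w] w by auto
      then show "G = ({}, w, {})" using g dc_empty w face_empty by simp
    qed
  qed
qed

lemma facets_bij: "bij_betw (\<lambda>w. ({}, w, {})) (carrier W) (facets P fle)"
  unfolding facets_Xi by (rule inj_on_imp_bij_betw) (auto simp: inj_on_def)

lemma dc_left_trivial:
  assumes "J \<subseteq> S" "w \<in> carrier W"
  shows "dc {} w J = w <#\<^bsub>W\<^esub> generate W J"
proof -
  have "dc {} w J = {x. \<exists>b\<in>lists J. x = \<one> \<otimes> w \<otimes> wp b}"
    using dc_iff[OF empty_subsetI assms] by auto
  then show ?thesis using assms by (auto simp: l_coset_def generate_eq_words)
qed

text \<open>
  A coset determines its type, since a generator lies in a standard parabolic subgroup only if it is one of its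
  letters.
\<close>

lemma coset_subset_type:
  assumes "J \<subseteq> S" "J' \<subseteq> S" "w \<in> carrier W" "dc {} w J' \<subseteq> dc {} w J"
  shows "J' \<subseteq> J"
proof -
  have "generate W J' \<subseteq> generate W J"
  proof
    fix x assume x: "x \<in> generate W J'"
    have gen: "generate W J \<subseteq> carrier W" "generate W J' \<subseteq> carrier W"
      using generate_incl assms S_carrier by blast+
    have "w \<otimes> x \<in> w <#\<^bsub>W\<^esub> generate W J'" using x by (auto simp: l_coset_def)
    then have "w \<otimes> x \<in> w <#\<^bsub>W\<^esub> generate W J" using assms dc_left_trivial by auto
    then obtain y where y: "y \<in> generate W J" "w \<otimes> x = w \<otimes> y" by (auto simp: l_coset_def)
    moreover have "x \<in> carrier W" "y \<in> carrier W" using gen x y(1) by blast+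
    ultimately have "x = y" using assms(3) by simp
    then show "x \<in> generate W J" using y(1) by simp
  qed
  then show ?thesis using generate_subset_iff assms by blast
qed

text \<open>
  The faces above \<open>({}, \<one>, S)\<close> are those with trivial left type, whose double cosets are the left cosets of standard
  parabolic subgroups.
\<close>

lemma Sigma_iso:
  "\<exists>f. poset_iso (Sigma_cox W S) Sigma_le {F \<in> P. fle ({}, \<one>, S) F} fle f"
proof -
  let ?Q = "{F \<in> P. fle ({}, \<one>, S) F}"
  define g where "g = (\<lambda>(I::'a set, w, J). w <#\<^bsub>W\<^esub> generate W J)"
  have Q: "?Q = {face {} w J |w J. w \<in> carrier W \<and> J \<subseteq> S}"
  proof -
    have "({}, \<one>, S) = face {} \<one> S" using face_full(2)[of "{}" \<one>] by simp
    then have below: "fle ({}, \<one>, S) (face I w J) \<longleftrightarrow> I = {}" if "I \<subseteq> S" "J \<subseteq> S" "w \<in> carrier W" for I w J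
      using face_le_iff[of "{}" S I J \<one> w] dc_full_right[of "{}" \<one>] that by simp
    show ?thesis
    proof (intro equalityI subsetI)
      fix F assume F: "F \<in> ?Q"
      then have "F \<in> P" by simp
      then obtain I w J where f: "F = face I w J" "I \<subseteq> S" "J \<subseteq> S" "w \<in> carrier W"
        by (rule face_cases)
      then show "F \<in> {face {} w J |w J. w \<in> carrier W \<and> J \<subseteq> S}" using below[OF f(2-4)] F by auto
    next
      fix F assume "F \<in> {face {} w J |w J. w \<in> carrier W \<and> J \<subseteq> S}"
      then obtain w J where "F = face {} w J" "w \<in> carrier W" "J \<subseteq> S" by blast
      then show "F \<in> ?Q" using below[of "{}" J w] face_in_Xi[of "{}" J w] by simp
    qed
  qed
  have g_face: "g (face {} w J) = dc {} w J" if "w \<in> carrier W" "J \<subseteq> S" for w J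
    using dc_left_trivial[of J "minrep {} w J"] dc_minrep[of "{}" J w] that by (simp add: g_def face_def)
  have order: "fle (face {} w J) (face {} w' J') \<longleftrightarrow> dc {} w' J' \<subseteq> dc {} w J"
    if "w \<in> carrier W" "J \<subseteq> S" "w' \<in> carrier W" "J' \<subseteq> S" for w J w' J'
  proof
    assume "fle (face {} w J) (face {} w' J')"
    then show "dc {} w' J' \<subseteq> dc {} w J" using face_le_iff[of "{}" J "{}" J' w w'] dc_subset_iff[of "{}" "{}" J' J w w'] that by simp
  next
    assume sub: "dc {} w' J' \<subseteq> dc {} w J"
    then have w': "w' \<in> dc {} w J" using dc_self[of "{}" J' w'] that by blast
    then have "dc {} w' J' \<subseteq> dc {} w' J" using sub dc_eq_iff[of "{}" J w w'] that by blast
    then have "J' \<subseteq> J" using coset_subset_type that by blast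
    then show "fle (face {} w J) (face {} w' J')" using face_le_iff[of "{}" J "{}" J' w w'] w' that by simp
  qed
  have g_order: "fle F G \<longleftrightarrow> g G \<subseteq> g F" if F: "F \<in> ?Q" and G: "G \<in> ?Q" for F G
  proof -
    obtain w J where "F = face {} w J" "w \<in> carrier W" "J \<subseteq> S" using F unfolding Q by blast
    moreover obtain w' J' where "G = face {} w' J'" "w' \<in> carrier W" "J' \<subseteq> S" using G unfolding Q by blast
    ultimately show ?thesis using order g_face by simp
  qed
  have "inj_on g ?Q"
  proof (rule inj_onI)
    fix F G assume F: "F \<in> ?Q" and G: "G \<in> ?Q" and eq: "g F = g G"
    then have "fle F G" "fle G F" using g_order[OF F G] g_order[OF G F] by auto
    then show "F = G" using Xi_le_antisym F G by blast
  qed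
  moreover have "g ` ?Q = Sigma_cox W S"
  proof -
    have "g ` ?Q = {g (face {} w J) |w J. w \<in> carrier W \<and> J \<subseteq> S}" unfolding Q by blast
    also have "\<dots> = Sigma_cox W S"
      unfolding Sigma_cox_def
      by (intro Collect_cong ex_cong1 rev_conj_cong HOL.refl) (simp add: g_face dc_left_trivial)
    finally show ?thesis .
  qed
  ultimately have bij: "bij_betw g ?Q (Sigma_cox W S)" by (simp add: bij_betw_def)
  have "poset_iso (Sigma_cox W S) Sigma_le ?Q fle (inv_into ?Q g)"
    unfolding poset_iso_def
  proof (intro conjI ballI)
    show "bij_betw (inv_into ?Q g) (Sigma_cox W S) ?Q" using bij by (rule bij_betw_inv_into)
    fix A B assume A: "A \<in> Sigma_cox W S" and B: "B \<in> Sigma_cox W S"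
    have inv: "inv_into ?Q g A \<in> ?Q" "inv_into ?Q g B \<in> ?Q" "g (inv_into ?Q g A) = A" "g (inv_into ?Q g B) = B"
      using bij_betw_inv_into[OF bij] bij A B
      by (blast dest: bij_betwE, blast dest: bij_betwE, simp_all add: bij_betw_inv_into_right)
    show "Sigma_le A B \<longleftrightarrow> fle (inv_into ?Q g A) (inv_into ?Q g B)"
      unfolding g_order[OF inv(1,2)] inv(3,4) Sigma_le_def by (rule HOL.refl)
  qed
  then show ?thesis by blast
qed

section \<open>Linear extensions of the two-sided weak order are shellings\<close>

lemma enum_index_bij:
  assumes "bij_betw f A B"
  shows "enum_index A = enum_index B"
  using bij_betw_finite[OF assms] bij_betw_same_card[OF assms] by (simp add: enum_index_def)

lemma enum_index_down: "k \<in> enum_index A \<Longrightarrow> i < k \<Longrightarrow> i \<in> enum_index A"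
  by (auto simp: enum_index_def split: if_splits)

context
  fixes e :: "nat \<Rightarrow> 'a"
  assumes ext: "linear_extension W S e"
begin

lemma e_bij: "bij_betw e (enum_index (carrier W)) (carrier W)"
  and e_mono: "i \<in> enum_index (carrier W) \<Longrightarrow> j \<in> enum_index (carrier W) \<Longrightarrow> weak_LR W S (e i) (e j) \<Longrightarrow> i \<le> j"
  using ext by (auto simp: linear_extension_def)

lemma e_carrier: "i \<in> enum_index (carrier W) \<Longrightarrow> e i \<in> carrier W"
  using e_bij bij_betwE by blast

lemma e_obtain:
  assumes "w \<in> carrier W"
  obtains i where "i \<in> enum_index (carrier W)" "e i = w"
  using assms e_bij by (metis bij_betw_imp_surj_on imageE)

lemma not_minimal_descent:
  assumes "I \<subseteq> S" "J \<subseteq> S" and k: "k \<in> enum_index (carrier W)" and "e k \<notin> mdr I J"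
  obtains s j where "s \<in> I" "j \<in> enum_index (carrier W)" "j < k" "e j = s \<otimes> e k"
  | s j where "s \<in> J" "j \<in> enum_index (carrier W)" "j < k" "e j = e k \<otimes> s"
proof -
  have w: "e k \<in> carrier W" using e_carrier k .
  have earlier: "\<exists>j. j \<in> enum_index (carrier W) \<and> j < k \<and> e j = v" if v: "v \<in> carrier W" "weak_LR W S v (e k)" "v \<noteq> e k" for v
  proof -
    obtain j where j: "j \<in> enum_index (carrier W)" "e j = v" by (rule e_obtain[OF v(1)])
    then have "j \<le> k" "j \<noteq> k" using e_mono[of j k] k v by auto
    then show ?thesis using j by auto
  qed
  consider s where "s \<in> I" "\<not> lg (e k) < lg (s \<otimes> e k)" | s where "s \<in> J" "\<not> lg (e k) < lg (e k \<otimes> s)"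
    using assms(4) w by (auto simp: mdr_iff[OF assms(1,2)])
  then show thesis
  proof cases
    case 1
    then have s: "s \<in> S" using assms by blast
    have lt: "lg (s \<otimes> e k) < lg (e k)" using 1 len_left[OF s w] by auto
    then have "weak_LR W S (s \<otimes> e k) (e k)" using weak_LR_left[OF s, of "s \<otimes> e k"] s w by simp
    then show ?thesis using earlier[of "s \<otimes> e k"] that(1)[of s] 1 s w lt by (metis S_in less_irrefl m_closed)
  next
    case 2
    then have s: "s \<in> S" using assms by blast
    have lt: "lg (e k \<otimes> s) < lg (e k)" using 2 len_right[OF s w] by auto
    then have "weak_LR W S (e k \<otimes> s) (e k)" using weak_LR_right[OF s, of "e k \<otimes> s"] s w by simp
    then show ?thesis using earlier[of "e k \<otimes> s"] that(2)[of s] 2 s w lt by (metis S_in less_irrefl m_closed)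
  qed
qed

text \<open>
  Let \<open>G\<close> be a face of \<open>F\<^sub>k\<close> and of an earlier facet. Then \<open>e k\<close> is not minimal in the double coset of \<open>G\<close>, as otherwise
  it would come first. The wall of a descent in one of the types of \<open>G\<close> is a face \<open>H\<close> of codimension one above \<open>G\<close>
  shared with an earlier facet, so a maximal \<open>G\<close> equals \<open>H\<close>.
\<close>

lemma shelling_Xi: "shelling P fle (\<lambda>k. ({}, e k, {}))"
  unfolding shelling_def
proof (intro conjI ballI impI)
  show "face_dim P fle G = face_dim P fle H" if "G \<in> facets P fle" "H \<in> facets P fle" for G H
  proof -
    have "face_dim P fle F = 2 * int (card S) - 1" if "F \<in> facets P fle" for F
      using that face_dim_Xi unfolding facets_Xi by (auto simp: Xi_iff mdr_iff)
    then show ?thesis using that by simp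
  qed
  have idx: "enum_index (facets P fle) = enum_index (carrier W)" using enum_index_bij[OF facets_bij] by simp
  show "bij_betw (\<lambda>k. ({}, e k, {})) (enum_index (facets P fle)) (facets P fle)"
    unfolding idx using bij_betw_trans[OF e_bij facets_bij] by (simp add: o_def)
  fix k G
  assume "k \<in> enum_index (facets P fle)" and "1 \<le> k"
    and G: "G \<in> maximal_elems (bd P fle ({}, e k, {}) \<inter> (\<Union>i<k. bd P fle ({}, e i, {}))) fle"
  then have k: "k \<in> enum_index (carrier W)" using idx by simp
  then have w: "e k \<in> carrier W" by (rule e_carrier)
  let ?F = "\<lambda>i. ({}, e i, {}) :: 'a set \<times> 'a \<times> 'a set"
  have F: "?F i = face {} (e i) {}" if "i \<in> enum_index (carrier W)" for i
    using face_empty e_carrier[OF that] by simp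
  obtain i where i: "i < k" "G \<in> bd P fle (?F i)" and Gk: "G \<in> bd P fle (?F k)"
    using G by (auto simp: maximal_elems_def)
  have iK: "i \<in> enum_index (carrier W)" using enum_index_down k i by blast
  have "G \<in> P" using Gk by (simp add: bd_def)
  then obtain I u J where g: "G = (I, u, J)" "G = face I u J" "I \<subseteq> S" "J \<subseteq> S" "u \<in> carrier W"
    by (rule face_cases)
  have mem: "e k \<in> dc I u J" "e i \<in> dc I u J"
    using Gk i(2) g F[OF k] F[OF iK] face_le_iff[of I J "{}" "{}" u] e_carrier[OF iK] w by (auto simp: bd_def)
  have not_min: "e k \<notin> mdr I J"
  proof
    assume min: "e k \<in> mdr I J"
    have "e i \<in> dc I (e k) J" using mem g w dc_eq_iff[OF g(3,4)] by blast
    then have "k \<le> i" using min_rep_weak_le[OF g(3,4) min] e_mono k iK by blast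
    then show False using i by simp
  qed
  obtain A B j where AB: "A \<subseteq> I" "B \<subseteq> J" "card (S - A) + card (S - B) + 1 = 2 * card S" "A \<noteq> {} \<or> B \<noteq> {}"
    and j: "j \<in> enum_index (carrier W)" "j < k" "e j \<in> dc A (e k) B"
  proof (cases rule: not_minimal_descent[OF g(3,4) k not_min])
    case (1 s j)
    have s: "{s} \<subseteq> S" "s \<in> S" using 1 g by auto
    have "e j \<in> dc {s} (e k) {}" using dc_left[OF s(1), of "{}" "e k" "e k" s] dc_self[OF s(1), of "{}" "e k"] w 1 by simp
    moreover have "card (S - {s}) + 1 = card S" using s finite_S by (metis Suc_eq_plus1 card_Suc_Diff1)
    ultimately show thesis using that[of "{s}" "{}" j] 1 by simp
  next
    case (2 s j)
    have s: "{s} \<subseteq> S" "s \<in> S" using 2 g by auto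
    have "e j \<in> dc {} (e k) {s}" using dc_right[OF _ s(1), of "{}" "e k" "e k" s] dc_self[OF _ s(1), of "{}" "e k"] w 2 by simp
    moreover have "card (S - {s}) + 1 = card S" using s finite_S by (metis Suc_eq_plus1 card_Suc_Diff1)
    ultimately show thesis using that[of "{}" "{s}" j] 2 by simp
  qed
  let ?H = "face A (e k) B"
  have S: "A \<subseteq> S" "B \<subseteq> S" using AB g by auto
  have HP: "?H \<in> P" using face_in_Xi S w by simp
  have "?H \<noteq> ?F l" for l using AB(4) by (auto simp: face_def)
  moreover have "fle ?H (?F k)" "fle ?H (?F j)"
    unfolding F[OF k] F[OF j(1)] using face_le_iff[of A B "{}" "{}" "e k"] S w j e_carrier[OF j(1)] dc_self by auto
  ultimately have "?H \<in> bd P fle (?F k) \<inter> (\<Union>i<k. bd P fle (?F i))" using HP j(2) by (auto simp: bd_def)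
  moreover have "fle G ?H" unfolding g(2) using face_le_iff[of I J A B u "e k"] g S w AB mem by simp
  ultimately have "?H = G" using G by (auto simp: maximal_elems_def)
  then have G': "G = (A, u, B)" "(A, u, B) \<in> P" using g HP by (auto simp: face_def)
  have Fk: "?F k \<in> P" using face_in_Xi[of "{}" "{}" "e k"] w F[OF k] by simp
  show "face_dim P fle G = face_dim P fle (?F k) - 1"
    unfolding G'(1) face_dim_Xi[OF G'(2)] face_dim_Xi[OF Fk] using AB(3) by simp
qed

end

lemma finite_ball: "finite {w \<in> carrier W. lg w \<le> k}"
proof (rule finite_subset)
  show "{w \<in> carrier W. lg w \<le> k} \<subseteq> wp ` {u. set u \<subseteq> S \<and> length u \<le> k}"
  proof
    fix w assume "w \<in> {w \<in> carrier W. lg w \<le> k}"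
    moreover then obtain u where "u \<in> lists S" "wp u = w" "length u = lg w" using reduced_word by blast
    ultimately show "w \<in> wp ` {u. set u \<subseteq> S \<and> length u \<le> k}" by auto
  qed
qed (use finite_lists_length_le[OF finite_S] in blast)

text \<open>
  There are finitely many elements of each length, so the elements can be listed by increasing length; and an
  element is longer than all elements below it in the weak order.
\<close>

lemma linear_extension_exists: "\<exists>e. linear_extension W S e"
proof -
  have "countable (\<Union>k. {w \<in> carrier W. lg w \<le> k})"
    by (rule countable_UN) (auto intro: countable_finite[OF finite_ball])
  moreover have "carrier W = (\<Union>k. {w \<in> carrier W. lg w \<le> k})" by auto
  ultimately have "countable (carrier W)" by simp
  then obtain c :: "'a \<Rightarrow> nat" where c: "inj_on c (carrier W)" by (rule countableE)
  define b where "b k = Suc (Max (c ` {w \<in> carrier W. lg w \<le> k}))" for k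
  have cb: "c w < b (lg w)" if "w \<in> carrier W" for w
    unfolding b_def using that finite_ball by (auto simp: less_Suc_eq_le intro!: Max_ge)
  \<comment> \<open>\<open>key\<close> orders the elements by length and then by the code \<open>c\<close>; the codes of length \<open>k\<close> are below \<open>b k\<close>.\<close>
  define key where "key w = (\<Sum>i<lg w. b i) + c w" for w
  have key_less: "key v < key w" if "v \<in> carrier W" "lg v < lg w" for v w
  proof -
    have "key v < (\<Sum>i<Suc (lg v). b i)" using cb[OF that(1)] by (simp add: key_def)
    also have "\<dots> \<le> (\<Sum>i<lg w. b i)" using that(2) by (intro sum_mono2) auto
    finally show ?thesis by (simp add: key_def)
  qed
  have inj: "inj_on key (carrier W)"
  proof (rule inj_onI)
    fix v w assume vw: "v \<in> carrier W" "w \<in> carrier W" "key v = key w"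
    then have "lg v = lg w" using key_less[of v w] key_less[of w v] by (metis less_irrefl linorder_neqE_nat)
    then show "v = w" using vw c by (simp add: key_def inj_on_eq_iff)
  qed
  let ?A = "key ` carrier W"
  have key_bij: "bij_betw key (carrier W) ?A" using inj by (simp add: bij_betw_def)
  have idx: "enum_index (carrier W) = enum_index ?A" by (rule enum_index_bij[OF key_bij])
  have bij: "bij_betw (enumerate ?A) (enum_index ?A) ?A"
    using finite_bij_enumerate[of ?A] bij_enumerate[of ?A] by (simp add: enum_index_def)
  have mono: "enumerate ?A i < enumerate ?A j" if "i < j" "j \<in> enum_index ?A" for i j
    using that finite_enumerate_mono[of i j ?A] enumerate_mono[of i j ?A]
    by (auto simp: enum_index_def split: if_splits)
  let ?e = "inv_into (carrier W) key \<circ> enumerate ?A"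
  have "bij_betw ?e (enum_index ?A) (carrier W)"
    by (rule bij_betw_trans[OF bij bij_betw_inv_into[OF key_bij]])
  moreover have "i \<le> j" if ij: "i \<in> enum_index ?A" "j \<in> enum_index ?A" "weak_LR W S (?e i) (?e j)" for i j
  proof (rule ccontr)
    assume "\<not> i \<le> j"
    then have less: "enumerate ?A j < enumerate ?A i" using mono[of j i] ij by simp
    have key_e: "key (?e l) = enumerate ?A l" "?e l \<in> carrier W" if "l \<in> enum_index ?A" for l
      using bij that bij_betwE[OF bij] by (auto intro: f_inv_into_f inv_into_into)
    have "?e i = ?e j \<or> lg (?e i) < lg (?e j)" using weak_LR_len[OF ij(3)] .
    then have "key (?e i) \<le> key (?e j)" using key_less[OF key_e(2)[OF ij(1)], of "?e j"] by auto
    then show False using less key_e ij by simp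
  qed
  ultimately show ?thesis unfolding linear_extension_def idx by blast
qed

section \<open>The refined h-polynomial\<close>

lemma f_num_eq:
  assumes "K \<subseteq> S" "L \<subseteq> S"
  shows "f_num W S K L = card {w \<in> carrier W. Des_L W S w \<subseteq> K \<and> Des_R W S w \<subseteq> L}"
proof -
  have sub: "Des_L W S w \<subseteq> S" "Des_R W S w \<subseteq> S" for w by (auto simp: Des_L_def Des_R_def)
  have "S - K \<subseteq> Asc_L W S w \<longleftrightarrow> Des_L W S w \<subseteq> K" "S - L \<subseteq> Asc_R W S w \<longleftrightarrow> Des_R W S w \<subseteq> L" for w
    using assms sub[of w] by (auto simp: Asc_L_def Asc_R_def)
  then have "{F \<in> P. \<exists>w. F = (S - K, w, S - L)} =
      (\<lambda>w. (S - K, w, S - L)) ` {w \<in> carrier W. Des_L W S w \<subseteq> K \<and> Des_R W S w \<subseteq> L}"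
    by (auto simp: Xi_iff min_double_reps_def)
  then show ?thesis unfolding f_num_def by (simp add: card_image inj_on_def)
qed

text \<open>
  The left-hand side is the expansion of the product over \<open>x \<in> I\<close> of \<open>1 + g x\<close>, where \<open>g\<close> is \<open>0\<close> on \<open>A\<close> and \<open>-1\<close>
  elsewhere.
\<close>

lemma alternating_subset_sum:
  assumes I: "finite I"
  shows "(\<Sum>K\<in>Pow I. (- 1) ^ card (I - K) * (if A \<subseteq> K then 1 else 0)) = (if A = I then 1 else (0::int))"
proof (cases "A \<subseteq> I")
  case True
  let ?g = "\<lambda>x. if x \<in> A then 0 else - 1 :: int"
  have "(\<Prod>x\<in>I. 1 + ?g x) = (\<Sum>K\<in>Pow I. (\<Prod>x\<in>K. 1) * (\<Prod>x\<in>I - K. ?g x))"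
    by (rule prod_add[OF I])
  also have "\<dots> = (\<Sum>K\<in>Pow I. (- 1) ^ card (I - K) * (if A \<subseteq> K then 1 else 0))"
  proof (rule sum.cong[OF HOL.refl])
    fix K assume K: "K \<in> Pow I"
    show "(\<Prod>x\<in>K. 1) * (\<Prod>x\<in>I - K. ?g x) = (- 1) ^ card (I - K) * (if A \<subseteq> K then 1 else 0)"
    proof (cases "A \<subseteq> K")
      case True
      then have "(\<Prod>x\<in>I - K. ?g x) = (\<Prod>x\<in>I - K. - 1)" by (intro prod.cong) auto
      then show ?thesis using True by simp
    next
      case False
      then have "\<exists>x\<in>I - K. ?g x = 0" using \<open>A \<subseteq> I\<close> by auto
      then show ?thesis using False I by (simp add: prod_zero_iff)
    qed
  qed
  moreover have "(\<Prod>x\<in>I. 1 + ?g x) = (if A = I then 1 else 0)"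
  proof (cases "A = I")
    case False
    then have "\<exists>x\<in>I. 1 + ?g x = 0" using True by auto
    then show ?thesis using False I by (simp add: prod_zero_iff)
  qed simp
  ultimately show ?thesis by simp
next
  case False
  then have "\<not> A \<subseteq> K" if "K \<in> Pow I" for K using that by auto
  then have "(\<Sum>K\<in>Pow I. (- 1) ^ card (I - K) * (if A \<subseteq> K then 1 else 0)) = (0::int)" by (intro sum.neutral) auto
  then show ?thesis using False by auto
qed

lemma sum_rotate: "(\<Sum>x\<in>A. \<Sum>y\<in>B. \<Sum>z\<in>C. f x y z) = (\<Sum>z\<in>C. \<Sum>x\<in>A. \<Sum>y\<in>B. f x y z)"
proof -
  have "(\<Sum>x\<in>A. \<Sum>y\<in>B. \<Sum>z\<in>C. f x y z) = (\<Sum>x\<in>A. \<Sum>z\<in>C. \<Sum>y\<in>B. f x y z)"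
    by (intro sum.cong HOL.refl sum.swap)
  also have "\<dots> = (\<Sum>z\<in>C. \<Sum>x\<in>A. \<Sum>y\<in>B. f x y z)" by (rule sum.swap)
  finally show ?thesis .
qed

lemma h_num_eq:
  assumes fin: "finite (carrier W)" and "I \<subseteq> S" "J \<subseteq> S"
  shows "h_num W S I J = (\<Sum>w\<in>carrier W. if Des_L W S w = I \<and> Des_R W S w = J then 1 else 0)"
proof -
  let ?l = "\<lambda>w K. if Des_L W S w \<subseteq> K then 1 else 0 :: int" and ?r = "\<lambda>w L. if Des_R W S w \<subseteq> L then 1 else 0 :: int"
  have finIJ: "finite I" "finite J" using assms finite_S finite_subset by auto
  have f: "int (f_num W S K L) = (\<Sum>w\<in>carrier W. ?l w K * ?r w L)" if "K \<in> Pow I" "L \<in> Pow J" for K L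
  proof -
    have "int (f_num W S K L) = (\<Sum>w\<in>{w \<in> carrier W. Des_L W S w \<subseteq> K \<and> Des_R W S w \<subseteq> L}. 1)"
      using f_num_eq[of K L] that assms by auto
    also have "\<dots> = (\<Sum>w\<in>carrier W. if Des_L W S w \<subseteq> K \<and> Des_R W S w \<subseteq> L then 1 else 0)"
      using fin by (subst sum.inter_filter) auto
    also have "\<dots> = (\<Sum>w\<in>carrier W. ?l w K * ?r w L)" by (rule sum.cong) auto
    finally show ?thesis .
  qed
  have "h_num W S I J = (\<Sum>K\<in>Pow I. \<Sum>L\<in>Pow J. (- 1) ^ (card (I - K) + card (J - L)) * (\<Sum>w\<in>carrier W. ?l w K * ?r w L))"
    unfolding h_num_def by (intro sum.cong HOL.refl) (simp only: f)
  also have "\<dots> = (\<Sum>K\<in>Pow I. \<Sum>L\<in>Pow J. \<Sum>w\<in>carrier W. ((- 1) ^ card (I - K) * ?l w K) * ((- 1) ^ card (J - L) * ?r w L))"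
    by (intro sum.cong HOL.refl) (simp add: sum_distrib_left power_add mult_ac)
  also have "\<dots> = (\<Sum>w\<in>carrier W. \<Sum>K\<in>Pow I. \<Sum>L\<in>Pow J. ((- 1) ^ card (I - K) * ?l w K) * ((- 1) ^ card (J - L) * ?r w L))"
    by (rule sum_rotate)
  also have "\<dots> = (\<Sum>w\<in>carrier W. (\<Sum>K\<in>Pow I. (- 1) ^ card (I - K) * ?l w K) * (\<Sum>L\<in>Pow J. (- 1) ^ card (J - L) * ?r w L))"
    by (simp only: sum_product)
  also have "\<dots> = (\<Sum>w\<in>carrier W. if Des_L W S w = I \<and> Des_R W S w = J then 1 else 0)"
    unfolding alternating_subset_sum[OF finIJ(1)] alternating_subset_sum[OF finIJ(2)] by (rule sum.cong) auto
  finally show ?thesis .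
qed

lemma monom_st_sum: "monom_st (\<Sum>w\<in>A. c w) i j = (\<Sum>w\<in>A. monom_st (c w) i j)"
  by (induction A rule: infinite_finite_induct) (simp_all add: monom_st_def add_monom[symmetric])

lemma h_poly_eq:
  assumes fin: "finite (carrier W)"
  shows "h_poly W S = (\<Sum>w\<in>carrier W. monom_st 1 (des_L W S w) (des_R W S w))"
proof -
  let ?t = "\<lambda>w I J. if Des_L W S w = I \<and> Des_R W S w = J then monom_st 1 (card I) (card J) else 0"
  have "h_poly W S = (\<Sum>I\<in>Pow S. \<Sum>J\<in>Pow S. \<Sum>w\<in>carrier W. ?t w I J)"
    unfolding h_poly_def
  proof (intro sum.cong HOL.refl)
    fix I J assume "I \<in> Pow S" "J \<in> Pow S"
    then have "monom_st (h_num W S I J) (card I) (card J) =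
        (\<Sum>w\<in>carrier W. monom_st (if Des_L W S w = I \<and> Des_R W S w = J then 1 else 0) (card I) (card J))"
      using h_num_eq[OF fin, of I J] by (simp add: monom_st_sum)
    also have "\<dots> = (\<Sum>w\<in>carrier W. ?t w I J)"
      by (rule sum.cong) (auto simp: monom_st_def)
    finally show "monom_st (h_num W S I J) (card I) (card J) = (\<Sum>w\<in>carrier W. ?t w I J)" .
  qed
  also have "\<dots> = (\<Sum>w\<in>carrier W. \<Sum>I\<in>Pow S. \<Sum>J\<in>Pow S. ?t w I J)"
    by (rule sum_rotate)
  also have "\<dots> = (\<Sum>w\<in>carrier W. monom_st 1 (des_L W S w) (des_R W S w))"
  proof (rule sum.cong[OF HOL.refl])
    fix w
    have sub: "Des_L W S w \<in> Pow S" "Des_R W S w \<in> Pow S" by (auto simp: Des_L_def Des_R_def)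
    have "(\<Sum>I\<in>Pow S. \<Sum>J\<in>Pow S. ?t w I J) = (\<Sum>I\<in>Pow S. if Des_L W S w = I then \<Sum>J\<in>Pow S. if Des_R W S w = J then monom_st 1 (card I) (card J) else 0 else 0)"
      by (intro sum.cong HOL.refl) auto
    also have "\<dots> = monom_st 1 (des_L W S w) (des_R W S w)"
      using sub finite_S by (simp add: sum.delta' des_L_def des_R_def)
    finally show "(\<Sum>I\<in>Pow S. \<Sum>J\<in>Pow S. ?t w I J) = monom_st 1 (des_L W S w) (des_R W S w)" .
  qed
  finally show ?thesis .
qed

end

section \<open>The realization as a gluing of simplices\<close>

lemma closed_simplex_mono:
  assumes "A \<subseteq> B" "finite B"
  shows "closed_simplex A \<subseteq> closed_simplex B"
proof
  fix z assume z: "z \<in> closed_simplex A"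
  then have "sum z B = sum z A"
    using assms by (intro sum.mono_neutral_right) (auto simp: closed_simplex_def)
  then show "z \<in> closed_simplex B" using z assms by (auto simp: closed_simplex_def)
qed

lemma supp_subset: "z \<in> closed_simplex A \<Longrightarrow> supp z \<subseteq> A"
  by (auto simp: closed_simplex_def supp_def)

lemma closed_simplex_supp:
  assumes "z \<in> closed_simplex A" "finite A"
  shows "z \<in> closed_simplex (supp z)"
proof -
  have "supp z \<subseteq> A" using supp_subset assms by blast
  then have "sum z A = sum z (supp z)"
    using assms by (intro sum.mono_neutral_right) (auto simp: supp_def)
  then show ?thesis using assms by (auto simp: closed_simplex_def supp_def)
qed

lemma simplex_topology_eq: "simplex_topology V = top_of_set (closed_simplex V)"
  by (simp add: simplex_topology_def euclidean_product_topology)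

context finite_rank_coxeter
begin

abbreviation "V \<equiv> vertices P fle"

text \<open>
  The left and right types that belong to a set of vertices; for the vanishing coordinates of a point they are the
  types of the smallest face containing it.
\<close>

definition "zl A = {s\<in>S. vl s \<in> A}"
definition "zr A = {s\<in>S. vr s \<in> A}"

lemma zl_sub: "zl A \<subseteq> S" and zr_sub: "zr A \<subseteq> S"
  by (auto simp: zl_def zr_def)

lemma zl_mono: "A \<subseteq> B \<Longrightarrow> zl A \<subseteq> zl B" and zr_mono: "A \<subseteq> B \<Longrightarrow> zr A \<subseteq> zr B"
  by (auto simp: zl_def zr_def)

lemma zl_V: "zl V = S" and zr_V: "zr V = S"
  by (auto simp: zl_def zr_def vertices_Xi)

lemma zl_vl: "s \<in> S \<Longrightarrow> zl {vl s} = {s}" "s \<in> S \<Longrightarrow> zr {vl s} = {}"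
  and zr_vr: "s \<in> S \<Longrightarrow> zl {vr s} = {}" "s \<in> S \<Longrightarrow> zr {vr s} = {s}"
  using vl_inj vr_inj vl_vr by (auto simp: zl_def zr_def)

abbreviation "zl0 z \<equiv> zl (zeros V z)"
abbreviation "zr0 z \<equiv> zr (zeros V z)"

text \<open>
  The smallest face containing the point arises from the given face by adding to its types the generators whose
  coordinates vanish.
\<close>

lemma char_map_Xi:
  assumes F: "F \<in> P" "F = (I, w, J)" and z: "z \<in> closed_simplex (verts_of P fle F)"
  shows "char_map P fle F z = (face (zl0 z) w (zr0 z), z)"
    and "verts_of P fle (face (zl0 z) w (zr0 z)) = supp z"
proof -
  have f: "F = face I w J" "I \<subseteq> S" "J \<subseteq> S" "w \<in> carrier W"
    using F face_of mdr_carrier by (auto simp: Xi_iff)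
  have vF: "verts_of P fle F = vl ` (S - I) \<union> vr ` (S - J)" by (rule verts_of_Xi[OF F])
  have sub: "supp z \<subseteq> verts_of P fle F" by (rule supp_subset[OF z])
  have zero: "z v = 0" if "v \<notin> verts_of P fle F" for v
  proof -
    have "v \<notin> supp z" using sub that by blast
    then show ?thesis by (simp add: supp_def)
  qed
  have "z (vl s) = 0" if "s \<in> I" for s
    by (rule zero) (use that f(2) vl_inj vl_vr in \<open>unfold vF, blast\<close>)
  then have I: "I \<subseteq> zl0 z" using f(2) by (auto simp: zl_def zeros_def vertices_Xi)
  have "z (vr s) = 0" if "s \<in> J" for s
    by (rule zero) (use that f(3) vr_inj vl_vr in \<open>unfold vF, blast\<close>)
  then have J: "J \<subseteq> zr0 z" using f(3) by (auto simp: zr_def zeros_def vertices_Xi)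
  let ?G = "face (zl0 z) w (zr0 z)"
  have G: "?G \<in> P" using face_in_Xi zl_sub zr_sub f(4) .
  have GF: "fle ?G F"
    unfolding f(1) face_le_iff[OF zl_sub zr_sub f(2-4) f(4)] using I J dc_self[OF zl_sub zr_sub f(4)] by blast
  have "verts_of P fle ?G = vl ` (S - zl0 z) \<union> vr ` (S - zr0 z)"
    using verts_of_Xi[OF G] by (simp add: face_def)
  also have "\<dots> = supp z"
  proof
    show "vl ` (S - zl0 z) \<union> vr ` (S - zr0 z) \<subseteq> supp z"
      by (auto simp: zl_def zr_def zeros_def supp_def vertices_Xi)
    show "supp z \<subseteq> vl ` (S - zl0 z) \<union> vr ` (S - zr0 z)"
    proof
      fix v assume v: "v \<in> supp z"
      then consider s where "s \<in> S" "v = vl s" | s where "s \<in> S" "v = vr s" using sub unfolding vF by blast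
      then show "v \<in> vl ` (S - zl0 z) \<union> vr ` (S - zr0 z)"
        using v by cases (auto simp: zl_def zr_def zeros_def supp_def)
    qed
  qed
  finally show verts: "verts_of P fle ?G = supp z" .
  have "(THE G. G \<in> P \<and> fle G F \<and> verts_of P fle G = supp z) = ?G"
    by (rule the1_equality[OF boolean_complex_face_unique[OF boolean_complex_Xi F(1) sub]])
      (intro conjI G GF verts)
  then show "char_map P fle F z = (?G, z)" by (simp add: char_map_def)
qed

lemma verts_of_facet: "w \<in> carrier W \<Longrightarrow> verts_of P fle ({}, w, {}) = V"
  using verts_of_Xi[of "({}, w, {})" "{}" w "{}"] by (simp add: Xi_iff mdr_iff vertices_Xi)

lemma facet_in_Xi: "w \<in> carrier W \<Longrightarrow> ({}, w, {}) \<in> P"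
  by (simp add: Xi_iff mdr_iff)

lemma verts_of_subset: "verts_of P fle F \<subseteq> V"
  by (auto simp: verts_of_def)

text \<open>
  So the characteristic maps of facets determine all others, and the realization is glued from its facets.
\<close>

lemma char_map_facet:
  assumes "F \<in> P" "F = (I, w, J)" "z \<in> closed_simplex (verts_of P fle F)"
  shows "char_map P fle F z = char_map P fle ({}, w, {}) z"
proof -
  have w: "w \<in> carrier W" using assms mdr_carrier by (auto simp: Xi_iff)
  have "z \<in> closed_simplex V" using assms(3) closed_simplex_mono[OF verts_of_subset finite_vertices] by blast
  then have "z \<in> closed_simplex (verts_of P fle ({}, w, {}))" by (simp only: verts_of_facet[OF w])
  then show ?thesis
    using char_map_Xi(1)[OF assms] char_map_Xi(1)[OF facet_in_Xi[OF w] HOL.refl] by simp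
qed

lemma realization_points_Xi:
  "realization_points P fle = (\<Union>w\<in>carrier W. char_map P fle ({}, w, {}) ` closed_simplex V)"
proof (intro equalityI subsetI)
  fix p assume "p \<in> realization_points P fle"
  then obtain G x where p: "p = (G, x)" "G \<in> P" "x \<in> closed_simplex (verts_of P fle G)" "supp x = verts_of P fle G"
    by (auto simp: realization_points_def)
  obtain I w J where G: "G = (I, w, J)" by (cases G)
  have w: "w \<in> carrier W" using p(2) G by (auto simp: Xi_iff min_double_reps_def)
  have "(THE H. H \<in> P \<and> fle H G \<and> verts_of P fle H = supp x) = G"
    by (rule the1_equality[OF boolean_complex_face_unique[OF boolean_complex_Xi p(2)]])
      (use p Xi_le_refl in auto)
  then have "char_map P fle G x = p" by (simp add: char_map_def p(1))
  then have "p = char_map P fle ({}, w, {}) x" using char_map_facet[OF p(2) G p(3)] by simp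
  moreover have "x \<in> closed_simplex V" using p(3) closed_simplex_mono[OF verts_of_subset finite_vertices] by blast
  ultimately show "p \<in> (\<Union>w\<in>carrier W. char_map P fle ({}, w, {}) ` closed_simplex V)" using w by blast
next
  fix p assume "p \<in> (\<Union>w\<in>carrier W. char_map P fle ({}, w, {}) ` closed_simplex V)"
  then obtain w z where w: "w \<in> carrier W" and z: "z \<in> closed_simplex V" and p: "p = char_map P fle ({}, w, {}) z"
    by blast
  note c = char_map_Xi[OF facet_in_Xi[OF w] HOL.refl, unfolded verts_of_facet[OF w], OF z]
  show "p \<in> realization_points P fle"
    unfolding realization_points_def p c(1)
    using face_in_Xi[OF zl_sub zr_sub w] closed_simplex_supp[OF z finite_vertices] c(2) by simp
qed

end

locale coxeter_enumeration = finite_rank_coxeter +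
  fixes e :: "nat \<Rightarrow> 'a"
  assumes ext: "linear_extension W S e"
begin

abbreviation "K \<equiv> enum_index (carrier W)"

definition "idx w = inv_into K e w"

lemma idx: "w \<in> carrier W \<Longrightarrow> idx w \<in> K" "w \<in> carrier W \<Longrightarrow> e (idx w) = w"
  and idx_e: "k \<in> K \<Longrightarrow> idx (e k) = k"
proof -
  note b = e_bij[OF ext]
  show "w \<in> carrier W \<Longrightarrow> idx w \<in> K" "w \<in> carrier W \<Longrightarrow> e (idx w) = w"
    using bij_betw_imp_surj_on[OF b] by (auto simp: idx_def inv_into_into f_inv_into_f)
  show "k \<in> K \<Longrightarrow> idx (e k) = k"
    using bij_betw_imp_inj_on[OF b] by (simp add: idx_def)
qed

lemmas eW = e_carrier[OF ext]

definition "cls A k = dc (zl A) (e k) (zr A)"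

text \<open>
  The facet of \<open>F\<^sub>w\<close> opposite to a vertex is shared with exactly one other facet, obtained from \<open>w\<close> by multiplication
  with the generator of the vertex on its side.
\<close>

definition "act v w = (if v \<in> vl ` S then (SOME s. s \<in> S \<and> v = vl s) \<otimes> w else w \<otimes> (SOME s. s \<in> S \<and> v = vr s))"

lemma act_vl: "s \<in> S \<Longrightarrow> act (vl s) w = s \<otimes> w"
proof -
  assume s: "s \<in> S"
  then have "(SOME t. t \<in> S \<and> vl s = vl t) = s" by (intro some_equality) (use vl_inj in blast)+
  then show ?thesis using s by (simp add: act_def)
qed

lemma act_vr: "s \<in> S \<Longrightarrow> act (vr s) w = w \<otimes> s"
proof -
  assume s: "s \<in> S"
  then have "(SOME t. t \<in> S \<and> vr s = vr t) = s" by (intro some_equality) (use vr_inj in blast)+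
  moreover have "vr s \<notin> vl ` S" using vl_vr by blast
  ultimately show ?thesis by (simp add: act_def)
qed

lemma vertex_cases:
  assumes "v \<in> V"
  obtains s where "s \<in> S" "v = vl s" | s where "s \<in> S" "v = vr s"
  using assms unfolding vertices_Xi by blast

definition "nb k v = idx (act v (e k))"

lemma act_properties:
  assumes v: "v \<in> V" and w: "w \<in> carrier W"
  shows "act v w \<in> carrier W" "act v w \<noteq> w" "act v (act v w) = w"
    "dc (zl {v}) (act v w) (zr {v}) = dc (zl {v}) w (zr {v})"
proof -
  have "act v w \<in> carrier W \<and> act v w \<noteq> w \<and> act v (act v w) = w \<and>
      dc (zl {v}) (act v w) (zr {v}) = dc (zl {v}) w (zr {v})"
    using v
  proof (cases rule: vertex_cases)
    case (1 s)
    have s: "{s} \<subseteq> S" using 1 by blast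
    have sw: "s \<otimes> w \<in> carrier W" using 1 w by simp
    have "s \<otimes> w \<noteq> w" using len_left[OF 1(1) w] by auto
    moreover have "dc {s} (s \<otimes> w) {} = dc {s} w {}"
      unfolding dc_eq_iff[OF s empty_subsetI w sw]
      by (rule dc_left[OF s empty_subsetI w dc_self[OF s empty_subsetI w]]) simp
    ultimately show ?thesis
      unfolding 1(2) act_vl[OF 1(1)] zl_vl[OF 1(1)] using sw 1(1) w by simp
  next
    case (2 s)
    have s: "{s} \<subseteq> S" using 2 by blast
    have sw: "w \<otimes> s \<in> carrier W" using 2 w by simp
    have "w \<otimes> s \<noteq> w" using len_right[OF 2(1) w] by auto
    moreover have "dc {} (w \<otimes> s) {s} = dc {} w {s}"
      unfolding dc_eq_iff[OF empty_subsetI s w sw]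
      by (rule dc_right[OF empty_subsetI s w dc_self[OF empty_subsetI s w]]) simp
    ultimately show ?thesis
      unfolding 2(2) act_vr[OF 2(1)] zr_vr[OF 2(1)] using sw 2(1) w by simp
  qed
  then show "act v w \<in> carrier W" "act v w \<noteq> w" "act v (act v w) = w"
    "dc (zl {v}) (act v w) (zr {v}) = dc (zl {v}) w (zr {v})" by auto
qed

lemma nb_vl_less:
  assumes "k \<in> K" "s \<in> S"
  shows "nb k (vl s) < k \<longleftrightarrow> lg (s \<otimes> e k) < lg (e k)"
proof -
  have w: "e k \<in> carrier W" "s \<otimes> e k \<in> carrier W" using eW assms by auto
  have nb: "nb k (vl s) = idx (s \<otimes> e k)" by (simp add: nb_def act_vl[OF assms(2)])
  have ne: "s \<otimes> e k \<noteq> e k" using len_left[OF assms(2) w(1)] by auto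
  show ?thesis
  proof (cases "lg (s \<otimes> e k) < lg (e k)")
    case True
    then have "weak_LR W S (s \<otimes> e k) (e k)" using weak_LR_left[OF assms(2) w(2)] assms(2) w(1) by simp
    then have "idx (s \<otimes> e k) \<le> k" using e_mono[OF ext idx(1)[OF w(2)] assms(1)] idx(2)[OF w(2)] by simp
    moreover have "idx (s \<otimes> e k) \<noteq> k" using idx(2)[OF w(2)] ne by metis
    ultimately show ?thesis using True nb by simp
  next
    case False
    then have "lg (e k) < lg (s \<otimes> e k)" using len_left[OF assms(2) w(1)] by auto
    then have "weak_LR W S (e k) (s \<otimes> e k)" using weak_LR_left[OF assms(2) w(1)] by simp
    then have "k \<le> idx (s \<otimes> e k)" using e_mono[OF ext assms(1) idx(1)[OF w(2)]] idx(2)[OF w(2)] by simp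
    then show ?thesis using False nb by simp
  qed
qed

lemma nb_vr_less:
  assumes "k \<in> K" "s \<in> S"
  shows "nb k (vr s) < k \<longleftrightarrow> lg (e k \<otimes> s) < lg (e k)"
proof -
  have w: "e k \<in> carrier W" "e k \<otimes> s \<in> carrier W" using eW assms by auto
  have nb: "nb k (vr s) = idx (e k \<otimes> s)" by (simp add: nb_def act_vr[OF assms(2)])
  have ne: "e k \<otimes> s \<noteq> e k" using len_right[OF assms(2) w(1)] by auto
  show ?thesis
  proof (cases "lg (e k \<otimes> s) < lg (e k)")
    case True
    then have "weak_LR W S (e k \<otimes> s) (e k)" using weak_LR_right[OF assms(2) w(2)] assms(2) w(1) by simp
    then have "idx (e k \<otimes> s) \<le> k" using e_mono[OF ext idx(1)[OF w(2)] assms(1)] idx(2)[OF w(2)] by simp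
    moreover have "idx (e k \<otimes> s) \<noteq> k" using idx(2)[OF w(2)] ne by metis
    ultimately show ?thesis using True nb by simp
  next
    case False
    then have "lg (e k) < lg (e k \<otimes> s)" using len_right[OF assms(2) w(1)] by auto
    then have "weak_LR W S (e k) (e k \<otimes> s)" using weak_LR_right[OF assms(2) w(1)] by simp
    then have "k \<le> idx (e k \<otimes> s)" using e_mono[OF ext assms(1) idx(1)[OF w(2)]] idx(2)[OF w(2)] by simp
    then show ?thesis using False nb by simp
  qed
qed

lemma cls_eq_iff:
  assumes "i \<in> K" "k \<in> K"
  shows "cls A i = cls A k \<longleftrightarrow> e i \<in> dc (zl A) (e k) (zr A)"
  unfolding cls_def by (rule dc_eq_iff[OF zl_sub zr_sub eW[OF assms(2)] eW[OF assms(1)]])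

text \<open>
  The shelling condition is the minimality of elements without descents in the types: if no facet in \<open>A\<close> leads to
  an earlier copy, then \<open>e k\<close> is minimal in its double coset and cannot come after \<open>e i\<close>.
\<close>

lemma simplicial_gluing_Xi:
  assumes "S \<noteq> {}"
  shows "simplicial_gluing V K cls nb"
proof
  show "finite V" by (rule finite_vertices)
  show "V \<noteq> {}" using assms by (simp add: vertices_Xi)
  show "0 \<in> K" using one_closed by (auto simp: enum_index_def card_gt_0_iff)
  show "i \<in> K" if "k \<in> K" "i < k" for i k using enum_index_down that by blast
  show "cls B i = cls B j" if "A \<subseteq> B" "B \<subseteq> V" "i \<in> K" "j \<in> K" "cls A i = cls A j" for A B i j
    using that(5) dc_mono[OF zl_mono[OF that(1)] zr_mono[OF that(1)] zl_sub zr_sub eW[OF that(4)]]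
    unfolding cls_eq_iff[OF that(3,4)] by blast
  show "cls V i = cls V j" if "i \<in> K" "j \<in> K" for i j
    using dc_full_left[OF subset_refl] eW that by (simp add: cls_def zl_V zr_V)
  fix k v assume k: "k \<in> K" and v: "v \<in> V"
  note a = act_properties[OF v eW[OF k]]
  show "nb k v \<in> K" using idx(1)[OF a(1)] by (simp add: nb_def)
  show "nb k v \<noteq> k" using idx(2)[OF a(1)] a(2) unfolding nb_def by metis
  show "nb (nb k v) v = k" unfolding nb_def idx(2)[OF a(1)] a(3) by (rule idx_e[OF k])
  show "cls {v} (nb k v) = cls {v} k" unfolding cls_def nb_def idx(2)[OF a(1)] by (rule a(4))
next
  fix A i k assume k: "k \<in> K" and i: "i < k" and A: "A \<subseteq> V" and eq: "cls A i = cls A k"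
  have iK: "i \<in> K" using enum_index_down k i by blast
  show "\<exists>v\<in>A. nb k v < k"
  proof (rule ccontr)
    assume neg: "\<not> (\<exists>v\<in>A. nb k v < k)"
    have "e k \<in> mdr (zl A) (zr A)"
      unfolding mdr_iff[OF zl_sub zr_sub]
    proof (intro conjI ballI eW k)
      fix s assume s: "s \<in> zl A"
      then have "\<not> lg (s \<otimes> e k) < lg (e k)" using nb_vl_less[OF k, of s] neg by (auto simp: zl_def)
      then show "lg (e k) < lg (s \<otimes> e k)" using len_left[of s, OF _ eW[OF k]] s by (auto simp: zl_def)
    next
      fix s assume s: "s \<in> zr A"
      then have "\<not> lg (e k \<otimes> s) < lg (e k)" using nb_vr_less[OF k, of s] neg by (auto simp: zr_def)
      then show "lg (e k) < lg (e k \<otimes> s)" using len_right[of s, OF _ eW[OF k]] s by (auto simp: zr_def)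
    qed
    then have "weak_LR W S (e k) (e i)"
      using min_rep_weak_le[OF zl_sub zr_sub] eq cls_eq_iff[OF iK k] by blast
    then have "k \<le> i" using e_mono[OF ext k iK] by blast
    then show False using i by simp
  qed
qed

lemma descents_of_down:
  assumes "S \<noteq> {}" "k \<in> K" "A \<subseteq> simplicial_gluing.down V nb k"
  shows "s \<in> zl A \<Longrightarrow> lg (s \<otimes> e k) < lg (e k)" "s \<in> zr A \<Longrightarrow> lg (e k \<otimes> s) < lg (e k)"
  using assms nb_vl_less[OF assms(2), of s] nb_vr_less[OF assms(2), of s]
  by (auto simp: zl_def zr_def simplicial_gluing.down_def[OF simplicial_gluing_Xi[OF assms(1)]])

text \<open>
  If crossing any facet in \<open>A\<close> leads to an earlier copy, the types consist of descents and \<open>e k\<close> is the maximum of its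
  double coset.
\<close>

lemma sphere_gluing_Xi:
  assumes "S \<noteq> {}" "finite (carrier W)"
  shows "sphere_gluing V K cls nb"
proof -
  interpret simplicial_gluing V K cls nb by (rule simplicial_gluing_Xi[OF assms(1)])
  show ?thesis
  proof
    fix A i k assume k: "k \<in> K" and i: "i \<in> K" and A: "A \<subseteq> down k" and eq: "cls A i = cls A k"
    have "weak_LR W S (e i) (e k)"
      using max_rep_weak_ge[OF assms(2) zl_sub zr_sub eW[OF k] descents_of_down[OF assms(1) k A]]
        eq[unfolded cls_eq_iff[OF i k]] by blast
    then show "i \<le> k" using e_mono[OF ext i k] by blast
  qed
qed

lemma glued_space_Xi:
  assumes "S \<noteq> {}"
  shows "glued_space V K cls nb (realization P fle) (\<lambda>k. char_map P fle ({}, e k, {}))"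
proof -
  interpret simplicial_gluing V K cls nb by (rule simplicial_gluing_Xi[OF assms])
  have top: "topspace (realization P fle) = realization_points P fle"
    by (rule topspace_realization[OF boolean_complex_Xi])
  have eK: "e ` K = carrier W" using e_bij[OF ext] by (simp add: bij_betw_def)
  show ?thesis
  proof
    show "topspace (realization P fle) = (\<Union>k\<in>K. char_map P fle ({}, e k, {}) ` closed_simplex V)"
    proof -
      have "(\<Union>k\<in>K. char_map P fle ({}, e k, {}) ` closed_simplex V)
          = (\<Union>w\<in>e ` K. char_map P fle ({}, w, {}) ` closed_simplex V)" by (simp only: image_image)
      then show ?thesis by (simp only: top realization_points_Xi eK)
    qed
  next
    fix U assume U: "U \<subseteq> topspace (realization P fle)"
    let ?pre = "\<lambda>F. {z \<in> closed_simplex (verts_of P fle F). char_map P fle F z \<in> U}"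
    have all: "openin (realization P fle) U \<longleftrightarrow>
        (\<forall>F\<in>P. openin (top_of_set (closed_simplex (verts_of P fle F))) (?pre F))"
      using U top by (simp add: openin_realization simplex_topology_eq)
    show "openin (realization P fle) U \<longleftrightarrow>
        (\<forall>k\<in>K. openin (top_of_set (closed_simplex V)) {z \<in> closed_simplex V. char_map P fle ({}, e k, {}) z \<in> U})"
      unfolding all
    proof (intro iffI ballI)
      fix k assume a: "\<forall>F\<in>P. openin (top_of_set (closed_simplex (verts_of P fle F))) (?pre F)" and k: "k \<in> K"
      show "openin (top_of_set (closed_simplex V)) {z \<in> closed_simplex V. char_map P fle ({}, e k, {}) z \<in> U}"
        using a[rule_format, OF facet_in_Xi[OF eW[OF k]]] unfolding verts_of_facet[OF eW[OF k]] .
    next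
      fix F assume a: "\<forall>k\<in>K. openin (top_of_set (closed_simplex V)) {z \<in> closed_simplex V. char_map P fle ({}, e k, {}) z \<in> U}"
        and F: "F \<in> P"
      obtain I w J where f: "F = (I, w, J)" by (cases F)
      then have "w \<in> carrier W" using F by (auto simp: Xi_iff min_double_reps_def)
      then obtain k where k: "k \<in> K" "e k = w" by (rule e_obtain[OF ext])
      obtain Q where Q: "open Q" "{z \<in> closed_simplex V. char_map P fle ({}, w, {}) z \<in> U} = closed_simplex V \<inter> Q"
        using a[rule_format, OF k(1)] unfolding k(2) openin_open by (elim exE conjE) (rule that)
      have "?pre F = closed_simplex (verts_of P fle F) \<inter> Q"
      proof (intro equalityI subsetI)
        fix z assume z: "z \<in> ?pre F"
        then have "z \<in> {z \<in> closed_simplex V. char_map P fle ({}, w, {}) z \<in> U}"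
          using char_map_facet[OF F f, of z] closed_simplex_mono[OF verts_of_subset finite_vertices, of F]
          by (simp add: subset_iff)
        then show "z \<in> closed_simplex (verts_of P fle F) \<inter> Q" unfolding Q(2) using z by simp
      next
        fix z assume z: "z \<in> closed_simplex (verts_of P fle F) \<inter> Q"
        then have "z \<in> closed_simplex V \<inter> Q"
          using closed_simplex_mono[OF verts_of_subset finite_vertices, of F] by (simp add: subset_iff)
        then have "char_map P fle ({}, w, {}) z \<in> U" unfolding Q(2)[symmetric] by simp
        then show "z \<in> ?pre F" using z char_map_facet[OF F f, of z] by simp
      qed
      then show "openin (top_of_set (closed_simplex (verts_of P fle F))) (?pre F)"
        unfolding openin_open using Q(1) by blast
    qed
  next
    fix j k y z assume j: "j \<in> K" and k: "k \<in> K" and y: "y \<in> closed_simplex V" and z: "z \<in> closed_simplex V"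
    have char: "char_map P fle ({}, e i, {}) x = (face (zl0 x) (e i) (zr0 x), x)"
      if "i \<in> K" "x \<in> closed_simplex V" for i x
      using char_map_Xi(1)[OF facet_in_Xi[OF eW[OF that(1)]] HOL.refl, unfolded verts_of_facet[OF eW[OF that(1)]], OF that(2)] .
    show "char_map P fle ({}, e j, {}) y = char_map P fle ({}, e k, {}) z \<longleftrightarrow>
        y = z \<and> cls (zeros V z) j = cls (zeros V z) k"
      unfolding char[OF j y] char[OF k z]
      using face_eq_iff[OF zl_sub zr_sub eW[OF j] eW[OF k]] by (auto simp: cls_def)
  qed
qed

lemma realization_sphere:
  assumes "S \<noteq> {}" "finite (carrier W)"
  shows "realization P fle homeomorphic_space unit_sphere (2 * card S)"
proof -
  have "0 < card S" using assms(1) finite_S by (simp add: card_gt_0_iff)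
  then have N: "2 * card S = Suc (2 * card S - 1)" by simp
  have "finite K" using assms(2) by (simp add: enum_index_def)
  from glued_space_sphere[OF glued_space_Xi[OF assms(1)] sphere_gluing_Xi[OF assms] this, of "2 * card S - 1"]
  show ?thesis using N card_vertices by simp
qed

text \<open>
  An element for which all generators are descents exists only in a finite group.
\<close>

lemma realization_contractible:
  assumes "infinite (carrier W)"
  shows "contractible_space (realization P fle)"
proof -
  have "S \<noteq> {}" using assms carrier_words by auto
  interpret glued_space V K cls nb "realization P fle" "\<lambda>k. char_map P fle ({}, e k, {})"
    by (rule glued_space_Xi[OF \<open>S \<noteq> {}\<close>])
  interpret noncompact_gluing V K cls nb "realization P fle" "\<lambda>k. char_map P fle ({}, e k, {})"
  proof
    fix k assume k: "k \<in> K"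
    show "down k \<noteq> V"
    proof
      assume "down k = V"
      then have "lg (s \<otimes> e k) < lg (e k)" if "s \<in> S" for s
        using descents_of_down(1)[OF \<open>S \<noteq> {}\<close> k, of V s] that zl_V by simp
      then show False using finite_if_all_descents[OF finite_S eW[OF k]] assms by blast
    qed
  qed
  show ?thesis by (rule contractible)
qed

end

lemma unit_sphere_0: "topspace (unit_sphere 0) = {}"
  by (simp add: unit_sphere_def)

theorem theorem2:
  fixes W :: "('a, 'b) monoid_scheme" and S :: "'a set" and n :: nat
  assumes "coxeter_system W S" and "finite S" and "card S = n"
  shows
    "(boolean_complex (Xi W S) (Xi_le W) \<and>
      balanced (Xi W S) (Xi_le W) \<and>
      has_complex_dim (Xi W S) (Xi_le W) (2 * int n - 1) \<and>
      (\<forall>(I, w, J)\<in>Xi W S.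
         face_dim (Xi W S) (Xi_le W) (I, w, J) = int (card (S - I)) + int (card (S - J)) - 1))
   \<and> (bij_betw (\<lambda>w. ({}, w, {})) (carrier W) (facets (Xi W S) (Xi_le W)) \<and>
      (\<exists>f. poset_iso (Sigma_cox W S) Sigma_le
             {F \<in> Xi W S. Xi_le W ({}, \<one>\<^bsub>W\<^esub>, S) F} (Xi_le W) f))
   \<and> (shellable (Xi W S) (Xi_le W) \<and>
      (\<forall>w. linear_extension W S w \<longrightarrow> shelling (Xi W S) (Xi_le W) (\<lambda>k. ({}, w k, {}))))
   \<and> (infinite (carrier W) \<longrightarrow> contractible_space (realization (Xi W S) (Xi_le W)))
   \<and> (finite (carrier W) \<longrightarrow>
        realization (Xi W S) (Xi_le W) homeomorphic_space unit_sphere (2 * n) \<and>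
        h_poly W S = (\<Sum>w\<in>carrier W. monom_st 1 (des_L W S w) (des_R W S w)))"
proof -
  from assms(1) obtain m where "group W" "S \<subseteq> carrier W" "generate W S = carrier W" "coxeter_matrix S m"
    "\<forall>u\<in>lists S. \<forall>v\<in>lists S. word_prod W u = word_prod W v \<longleftrightarrow> coxeter_cong S m u v"
    unfolding coxeter_system_def by blast
  then interpret finite_rank_coxeter W S m
    using assms(2) by (intro finite_rank_coxeter.intro coxeter.intro coxeter_axioms.intro finite_rank_coxeter_axioms.intro) auto
  obtain e where e: "linear_extension W S e" using linear_extension_exists by blast
  then interpret coxeter_enumeration W S m e by unfold_locales
  have sphere: "realization P fle homeomorphic_space unit_sphere (2 * n)" if fin: "finite (carrier W)"
  proof (cases "S = {}")
    case True
    \<comment> \<open>Without vertices the realization has no points, and the sphere of dimension \<open>-1\<close> is empty.\<close>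
    have "V = {}" unfolding vertices_Xi using True by simp
    then have "verts_of P fle G = {}" for G using verts_of_subset[of G] by blast
    then have "closed_simplex (verts_of P fle G) = {}" for G
      by (simp only: closed_simplex_def sum.empty) simp
    then have "topspace (realization P fle) = {}"
      unfolding topspace_realization[OF boolean_complex_Xi] realization_points_def by simp
    then have "realization P fle = trivial_topology" "unit_sphere (2 * n) = trivial_topology"
      using unit_sphere_0 True assms(3) by (auto simp: null_topspace_iff_trivial)
    then show ?thesis by (simp add: homeomorphic_empty_space_eq)
  next
    case False
    then show ?thesis using realization_sphere[OF _ fin] assms(3) by simp
  qed
  have dims: "\<forall>(I, w, J)\<in>P. face_dim P fle (I, w, J) = int (card (S - I)) + int (card (S - J)) - 1"
    using face_dim_Xi by auto
  have shell: "\<forall>w. linear_extension W S w \<longrightarrow> shelling P fle (\<lambda>k. ({}, w k, {}))"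
    using shelling_Xi by blast
  then have "shellable P fle" unfolding shellable_def using e by blast
  then show ?thesis
    using boolean_complex_Xi balanced_Xi has_complex_dim_Xi[unfolded assms(3)] dims facets_bij Sigma_iso shell
      realization_contractible sphere h_poly_eq by (intro conjI impI)
qed

end
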